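(* Let $\mathsf{X}$ and $\mathsf{B}$ be categories with finite products, and let $P\colon \mathsf{X}\to\mathsf{B}$ be an opfibration strictly preserving finite products. Let $Q\colon \mathsf{X}\to\mathsf{Q}$ be the category of fractions of $\mathsf{X}$ with respect to the class of $P$-vertical morphisms, and let $\overline{P}\colon \mathsf{Q}\to\mathsf{B}$ be the unique functor with $\overline{P}\cdot Q=P$. Then $\overline{P}$ is a cartesian monoidal opfibration with groupoidal fibres. If moreover $\mathsf{B}$ is additive, then each fibre of $\overline{P}$ is endowed with a symmetric $2$-group structure (the canonical one described in the context), and the change-of-base functors of $\overline{P}$ are symmetric monoidal.
   Context: A morphism of $\mathsf{X}$ is $P$-vertical if $P$ sends it to an identity; the fibre of $P$ over $B$ is the subcategory of objects over $B$ and morphisms over $1_B$; fibres are groupoidal if they are all groupoids. Opfibration is meant in the sense of Grothendieck: every $f\colon P(X)\to B'$ has a cocartesian lifting with domain $X$. The category of fractions of $\mathsf{X}$ with respect to a class $\Sigma$ of morphisms is the universal functor $Q\colon \mathsf{X}\to \mathsf{X}[\Sigma^{-1}]$ sending the morphisms of $\Sigma$ to isomorphisms. An opfibration $P\colon\mathsf{X}\to\mathsf{B}$ between categories with finite products is called cartesian monoidal if it strictly preserves finite products and the product of two cocartesian morphisms is cocartesian. For $f\colon B\to B'$ in $\mathsf{B}$, $f_*$ denotes the change-of-base functor between the fibres over $B$ and $B'$ given by (chosen) cocartesian liftings. If $\mathsf{B}$ is additive, each object $B$ carries a unique commutative monoid structure, with addition $[1,1]\colon B\times B\to B$ and zero $0\to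 B$. For a cartesian monoidal opfibration over $\mathsf{B}$, the canonical symmetric monoidal structure on the fibre over $B$ has tensor product $X\otimes Y=[1,1]_*(X\times Y)$, unit $I=(0\to B)_*(1)$, where $1$ is the terminal object of the total category (lying over $0$), and coherence isomorphisms induced by the universal properties. A $2$-group is a (not necessarily strict) monoidal groupoid in which every object is invertible with respect to the tensor product up to isomorphism; it is symmetric if the monoidal structure is symmetric. *)

theory Defs
  imports "HOL-Library.Infinite_Typeclass" "HOL-Algebra.Group"
begin

section \<open>Categories and functors\<close>

text \<open>Composition is written in the usual order: \<open>Comp C g f\<close> is \<open>g\<close> after \<open>f\<close>.
  The operations are only meaningful on objects and composable arrows of the category.\<close>

record ('o, 'm) cat =
  Obj :: "'o set"
  Arr :: "'m set"
  Dom :: "'m \<Rightarrow> 'o"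
  Cod :: "'m \<Rightarrow> 'o"
  Ide :: "'o \<Rightarrow> 'm"
  Comp :: "'m \<Rightarrow> 'm \<Rightarrow> 'm"  (infixl "\<cdot>\<index>" 70)

definition Hom :: "('o, 'm) cat \<Rightarrow> 'o \<Rightarrow> 'o \<Rightarrow> 'm set" where
  "Hom C a b = {f \<in> Arr C. Dom C f = a \<and> Cod C f = b}"

locale category =
  fixes C :: "('o, 'm) cat" (structure)
  assumes Dom_Obj: "f \<in> Arr C \<Longrightarrow> Dom C f \<in> Obj C"
    and Cod_Obj: "f \<in> Arr C \<Longrightarrow> Cod C f \<in> Obj C"
    and Ide_Hom: "a \<in> Obj C \<Longrightarrow> Ide C a \<in> Hom C a a"
    and Comp_Hom: "\<lbrakk>f \<in> Hom C a b; g \<in> Hom C b c\<rbrakk> \<Longrightarrow> g \<cdot> f \<in> Hom C a c"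
    and Ide_left: "f \<in> Arr C \<Longrightarrow> Ide C (Cod C f) \<cdot> f = f"
    and Ide_right: "f \<in> Arr C \<Longrightarrow> f \<cdot> Ide C (Dom C f) = f"
    and Comp_assoc: "\<lbrakk>f \<in> Hom C a b; g \<in> Hom C b c; h \<in> Hom C c d\<rbrakk>
          \<Longrightarrow> (h \<cdot> g) \<cdot> f = h \<cdot> (g \<cdot> f)"

definition is_iso :: "('o, 'm) cat \<Rightarrow> 'm \<Rightarrow> bool" where
  "is_iso C f \<longleftrightarrow> f \<in> Arr C \<and>
     (\<exists>g \<in> Hom C (Cod C f) (Dom C f).
        g \<cdot>\<^bsub>C\<^esub> f = Ide C (Dom C f) \<and> f \<cdot>\<^bsub>C\<^esub> g = Ide C (Cod C f))"

definition isomorphic :: "('o, 'm) cat \<Rightarrow> 'o \<Rightarrow> 'o \<Rightarrow> bool" where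
  "isomorphic C a b \<longleftrightarrow> (\<exists>f \<in> Hom C a b. is_iso C f)"

locale groupoid = category +
  assumes all_iso: "f \<in> Arr C \<Longrightarrow> is_iso C f"

record ('o1, 'm1, 'o2, 'm2) func =
  fob :: "'o1 \<Rightarrow> 'o2"
  far :: "'m1 \<Rightarrow> 'm2"

locale cat_functor = A: category A + B: category B
  for A :: "('o1, 'm1) cat" and B :: "('o2, 'm2) cat" +
  fixes F :: "('o1, 'm1, 'o2, 'm2) func"
  assumes fob_Obj: "a \<in> Obj A \<Longrightarrow> fob F a \<in> Obj B"
    and far_Hom: "f \<in> Hom A a b \<Longrightarrow> far F f \<in> Hom B (fob F a) (fob F b)"
    and far_Ide: "a \<in> Obj A \<Longrightarrow> far F (Ide A a) = Ide B (fob F a)"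
    and far_Comp: "\<lbrakk>f \<in> Hom A a b; g \<in> Hom A b c\<rbrakk>
          \<Longrightarrow> far F (g \<cdot>\<^bsub>A\<^esub> f) = far F g \<cdot>\<^bsub>B\<^esub> far F f"

definition func_comp ::
  "('o2, 'm2, 'o3, 'm3) func \<Rightarrow> ('o1, 'm1, 'o2, 'm2) func \<Rightarrow> ('o1, 'm1, 'o3, 'm3) func" where
  "func_comp G F = \<lparr>fob = fob G \<circ> fob F, far = far G \<circ> far F\<rparr>"

text \<open>Equality of functors with domain \<open>A\<close>: the values off \<open>A\<close> are irrelevant.\<close>

definition func_eq ::
  "('o1, 'm1) cat \<Rightarrow> ('o1, 'm1, 'o2, 'm2) func \<Rightarrow> ('o1, 'm1, 'o2, 'm2) func \<Rightarrow> bool" where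
  "func_eq A F G \<longleftrightarrow>
     (\<forall>a \<in> Obj A. fob F a = fob G a) \<and> (\<forall>f \<in> Arr A. far F f = far G f)"


section \<open>Categories of fractions\<close>

definition inverts ::
  "('o1, 'm1, 'o2, 'm2) func \<Rightarrow> 'm1 set \<Rightarrow> ('o2, 'm2) cat \<Rightarrow> bool" where
  "inverts F \<Sigma> Y \<longleftrightarrow> (\<forall>s \<in> \<Sigma>. is_iso Y (far F s))"

text \<open>The types \<open>'o\<close> and \<open>'m\<close> play the role of a universe: the functor \<open>L\<close> is universal among
  the functors to categories with objects in \<open>'o\<close> and arrows in \<open>'m\<close>. As \<open>'m\<close> is infinite, the
  category of zigzags in \<open>X\<close> has a copy with objects \<open>Obj X\<close> and arrows in \<open>'m\<close>. So a category
  of fractions exists at these types, and being universal here is the same as being universal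
  among functors to categories of arbitrary types.\<close>

definition category_of_fractions ::
  "('o, 'm::infinite) cat \<Rightarrow> 'm set \<Rightarrow> ('o, 'm) cat \<Rightarrow> ('o, 'm, 'o, 'm) func \<Rightarrow> bool" where
  "category_of_fractions X \<Sigma> Q L \<longleftrightarrow>
     cat_functor X Q L \<and> inverts L \<Sigma> Q \<and>
     (\<forall>(Y :: ('o, 'm) cat) F. cat_functor X Y F \<and> inverts F \<Sigma> Y \<longrightarrow>
        (\<exists>G. cat_functor Q Y G \<and> func_eq X (func_comp G L) F \<and>
           (\<forall>G'. cat_functor Q Y G' \<and> func_eq X (func_comp G' L) F \<longrightarrow> func_eq Q G' G)))"


section \<open>Finite products\<close>

text \<open>A category with finite products comes with a chosen terminal object and chosen binary
  products, so that strict preservation makes sense.\<close>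

record ('o, 'm) products =
  One :: 'o
  Prod :: "'o \<Rightarrow> 'o \<Rightarrow> 'o"
  Fst :: "'o \<Rightarrow> 'o \<Rightarrow> 'm"
  Snd :: "'o \<Rightarrow> 'o \<Rightarrow> 'm"

locale finite_products = category C for C :: "('o, 'm) cat" +
  fixes S :: "('o, 'm) products"
  assumes One_Obj: "One S \<in> Obj C"
    and One_terminal: "a \<in> Obj C \<Longrightarrow> \<exists>!h. h \<in> Hom C a (One S)"
    and Prod_Obj: "\<lbrakk>a \<in> Obj C; b \<in> Obj C\<rbrakk> \<Longrightarrow> Prod S a b \<in> Obj C"
    and Fst_Hom: "\<lbrakk>a \<in> Obj C; b \<in> Obj C\<rbrakk> \<Longrightarrow> Fst S a b \<in> Hom C (Prod S a b) a"
    and Snd_Hom: "\<lbrakk>a \<in> Obj C; b \<in> Obj C\<rbrakk> \<Longrightarrow> Snd S a b \<in> Hom C (Prod S a b) b"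
    and Prod_universal: "\<lbrakk>a \<in> Obj C; b \<in> Obj C; f \<in> Hom C c a; g \<in> Hom C c b\<rbrakk> \<Longrightarrow>
          \<exists>!h. h \<in> Hom C c (Prod S a b) \<and> Fst S a b \<cdot>\<^bsub>C\<^esub> h = f \<and> Snd S a b \<cdot>\<^bsub>C\<^esub> h = g"

definition to_one :: "('o, 'm) cat \<Rightarrow> ('o, 'm) products \<Rightarrow> 'o \<Rightarrow> 'm" where
  "to_one C S a = (THE h. h \<in> Hom C a (One S))"

definition pairing :: "('o, 'm) cat \<Rightarrow> ('o, 'm) products \<Rightarrow> 'm \<Rightarrow> 'm \<Rightarrow> 'm" where
  "pairing C S f g = (THE h. h \<in> Hom C (Dom C f) (Prod S (Cod C f) (Cod C g)) \<and>
     Fst S (Cod C f) (Cod C g) \<cdot>\<^bsub>C\<^esub> h = f \<and> Snd S (Cod C f) (Cod C g) \<cdot>\<^bsub>C\<^esub> h = g)"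

definition prod_arr :: "('o, 'm) cat \<Rightarrow> ('o, 'm) products \<Rightarrow> 'm \<Rightarrow> 'm \<Rightarrow> 'm" where
  "prod_arr C S f g = pairing C S
     (f \<cdot>\<^bsub>C\<^esub> Fst S (Dom C f) (Dom C g)) (g \<cdot>\<^bsub>C\<^esub> Snd S (Dom C f) (Dom C g))"

definition prod_swap :: "('o, 'm) cat \<Rightarrow> ('o, 'm) products \<Rightarrow> 'o \<Rightarrow> 'o \<Rightarrow> 'm" where
  "prod_swap C S a b = pairing C S (Snd S a b) (Fst S a b)"

text \<open>The canonical arrow from \<open>(a \<times> b) \<times> c\<close> to \<open>a \<times> (b \<times> c)\<close>.\<close>

definition prod_assoc :: "('o, 'm) cat \<Rightarrow> ('o, 'm) products \<Rightarrow> 'o \<Rightarrow> 'o \<Rightarrow> 'o \<Rightarrow> 'm" where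
  "prod_assoc C S a b c = pairing C S
     (Fst S a b \<cdot>\<^bsub>C\<^esub> Fst S (Prod S a b) c)
     (pairing C S (Snd S a b \<cdot>\<^bsub>C\<^esub> Fst S (Prod S a b) c) (Snd S (Prod S a b) c))"

definition strictly_preserves_products ::
  "('o1, 'm1) cat \<Rightarrow> ('o1, 'm1) products \<Rightarrow> ('o2, 'm2) products
     \<Rightarrow> ('o1, 'm1, 'o2, 'm2) func \<Rightarrow> bool" where
  "strictly_preserves_products A SA SB F \<longleftrightarrow>
     fob F (One SA) = One SB \<and>
     (\<forall>a \<in> Obj A. \<forall>b \<in> Obj A.
        fob F (Prod SA a b) = Prod SB (fob F a) (fob F b) \<and>
        far F (Fst SA a b) = Fst SB (fob F a) (fob F b) \<and>
        far F (Snd SA a b) = Snd SB (fob F a) (fob F b))"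


section \<open>Opfibrations\<close>

definition vertical ::
  "('o1, 'm1) cat \<Rightarrow> ('o2, 'm2) cat \<Rightarrow> ('o1, 'm1, 'o2, 'm2) func \<Rightarrow> 'm1 set" where
  "vertical X B P = {v \<in> Arr X. \<exists>b \<in> Obj B. far P v = Ide B b}"

definition fibre ::
  "('o1, 'm1) cat \<Rightarrow> ('o2, 'm2) cat \<Rightarrow> ('o1, 'm1, 'o2, 'm2) func \<Rightarrow> 'o2 \<Rightarrow> ('o1, 'm1) cat" where
  "fibre X B P b = X\<lparr>Obj := {x \<in> Obj X. fob P x = b}, Arr := {f \<in> Arr X. far P f = Ide B b}\<rparr>"

definition cocartesian ::
  "('o1, 'm1) cat \<Rightarrow> ('o2, 'm2) cat \<Rightarrow> ('o1, 'm1, 'o2, 'm2) func \<Rightarrow> 'm1 \<Rightarrow> bool" where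
  "cocartesian X B P u \<longleftrightarrow> u \<in> Arr X \<and>
     (\<forall>v \<in> Arr X. \<forall>g \<in> Hom B (fob P (Cod X u)) (fob P (Cod X v)).
        Dom X v = Dom X u \<and> g \<cdot>\<^bsub>B\<^esub> far P u = far P v \<longrightarrow>
        (\<exists>!w. w \<in> Hom X (Cod X u) (Cod X v) \<and> far P w = g \<and> w \<cdot>\<^bsub>X\<^esub> u = v))"

locale opfibration = cat_functor X B P
  for X :: "('o1, 'm1) cat" and B :: "('o2, 'm2) cat" and P :: "('o1, 'm1, 'o2, 'm2) func" +
  assumes cocartesian_lifting: "\<lbrakk>x \<in> Obj X; f \<in> Arr B; Dom B f = fob P x\<rbrakk>
    \<Longrightarrow> \<exists>u. cocartesian X B P u \<and> Dom X u = x \<and> far P u = f"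

locale cartesian_monoidal_opfibration =
  opfibration X B P + X: finite_products X SX + B: finite_products B SB
  for X :: "('o1, 'm1) cat" and SX :: "('o1, 'm1) products"
    and B :: "('o2, 'm2) cat" and SB :: "('o2, 'm2) products"
    and P :: "('o1, 'm1, 'o2, 'm2) func" +
  assumes strict: "strictly_preserves_products X SX SB P"
    and prod_cocartesian: "\<lbrakk>cocartesian X B P u; cocartesian X B P v\<rbrakk>
      \<Longrightarrow> cocartesian X B P (prod_arr X SX u v)"

definition groupoidal_fibres ::
  "('o1, 'm1) cat \<Rightarrow> ('o2, 'm2) cat \<Rightarrow> ('o1, 'm1, 'o2, 'm2) func \<Rightarrow> bool" where
  "groupoidal_fibres X B P \<longleftrightarrow> (\<forall>b \<in> Obj B. groupoid (fibre X B P b))"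

text \<open>A choice of cocartesian liftings: \<open>k f x\<close> is the lifting of \<open>f\<close> with domain \<open>x\<close>,
  and its codomain is \<open>f\<^sub>* x\<close>.\<close>

definition cleavage ::
  "('o1, 'm1) cat \<Rightarrow> ('o2, 'm2) cat \<Rightarrow> ('o1, 'm1, 'o2, 'm2) func
     \<Rightarrow> ('m2 \<Rightarrow> 'o1 \<Rightarrow> 'm1) \<Rightarrow> bool" where
  "cleavage X B P k \<longleftrightarrow>
     (\<forall>x \<in> Obj X. \<forall>f \<in> Arr B. Dom B f = fob P x \<longrightarrow>
        cocartesian X B P (k f x) \<and> Dom X (k f x) = x \<and> far P (k f x) = f)"

text \<open>For \<open>c\<close> cocartesian, and \<open>d\<close> with the same domain and the same image under \<open>P\<close>,
  the vertical arrow \<open>h\<close> with \<open>h \<cdot> c = d\<close>.\<close>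

definition induced ::
  "('o1, 'm1) cat \<Rightarrow> ('o2, 'm2) cat \<Rightarrow> ('o1, 'm1, 'o2, 'm2) func \<Rightarrow> 'm1 \<Rightarrow> 'm1 \<Rightarrow> 'm1" where
  "induced X B P c d = (THE h. h \<in> Hom X (Cod X c) (Cod X d) \<and>
     far P h = Ide B (fob P (Cod X c)) \<and> h \<cdot>\<^bsub>X\<^esub> c = d)"

definition change_of_base ::
  "('o1, 'm1) cat \<Rightarrow> ('o2, 'm2) cat \<Rightarrow> ('o1, 'm1, 'o2, 'm2) func
     \<Rightarrow> ('m2 \<Rightarrow> 'o1 \<Rightarrow> 'm1) \<Rightarrow> 'm2 \<Rightarrow> ('o1, 'm1, 'o1, 'm1) func" where
  "change_of_base X B P k f =
     \<lparr>fob = \<lambda>x. Cod X (k f x),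
      far = \<lambda>h. induced X B P (k f (Dom X h)) (k f (Cod X h) \<cdot>\<^bsub>X\<^esub> h)\<rparr>"


section \<open>Symmetric monoidal categories and 2-groups\<close>

record ('o, 'm) monoidal =
  tensor :: "'o \<Rightarrow> 'o \<Rightarrow> 'o"
  tensor_arr :: "'m \<Rightarrow> 'm \<Rightarrow> 'm"
  unit_obj :: 'o
  associator :: "'o \<Rightarrow> 'o \<Rightarrow> 'o \<Rightarrow> 'm"
  lunitor :: "'o \<Rightarrow> 'm"
  runitor :: "'o \<Rightarrow> 'm"
  braiding :: "'o \<Rightarrow> 'o \<Rightarrow> 'm"

text \<open>The field \<open>braiding\<close> is not used in the following locale.\<close>

locale monoidal_category = category C for C :: "('o, 'm) cat" (structure) +
  fixes M :: "('o, 'm) monoidal"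
  assumes tensor_Obj: "\<lbrakk>x \<in> Obj C; y \<in> Obj C\<rbrakk> \<Longrightarrow> tensor M x y \<in> Obj C"
    and tensor_arr_Hom: "\<lbrakk>f \<in> Hom C x x'; g \<in> Hom C y y'\<rbrakk>
      \<Longrightarrow> tensor_arr M f g \<in> Hom C (tensor M x y) (tensor M x' y')"
    and tensor_arr_Ide: "\<lbrakk>x \<in> Obj C; y \<in> Obj C\<rbrakk>
      \<Longrightarrow> tensor_arr M (Ide C x) (Ide C y) = Ide C (tensor M x y)"
    and tensor_arr_Comp:
      "\<lbrakk>f \<in> Hom C x x'; f' \<in> Hom C x' x''; g \<in> Hom C y y'; g' \<in> Hom C y' y''\<rbrakk>
      \<Longrightarrow> tensor_arr M (f' \<cdot> f) (g' \<cdot> g) = tensor_arr M f' g' \<cdot> tensor_arr M f g"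
    and unit_Obj: "unit_obj M \<in> Obj C"
    and associator_Hom: "\<lbrakk>x \<in> Obj C; y \<in> Obj C; z \<in> Obj C\<rbrakk>
      \<Longrightarrow> associator M x y z \<in> Hom C (tensor M (tensor M x y) z) (tensor M x (tensor M y z))"
    and associator_iso: "\<lbrakk>x \<in> Obj C; y \<in> Obj C; z \<in> Obj C\<rbrakk> \<Longrightarrow> is_iso C (associator M x y z)"
    and associator_natural: "\<lbrakk>f \<in> Hom C x x'; g \<in> Hom C y y'; h \<in> Hom C z z'\<rbrakk>
      \<Longrightarrow> associator M x' y' z' \<cdot> tensor_arr M (tensor_arr M f g) h
        = tensor_arr M f (tensor_arr M g h) \<cdot> associator M x y z"
    and lunitor_Hom: "x \<in> Obj C \<Longrightarrow> lunitor M x \<in> Hom C (tensor M (unit_obj M) x) x"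
    and lunitor_iso: "x \<in> Obj C \<Longrightarrow> is_iso C (lunitor M x)"
    and lunitor_natural: "f \<in> Hom C x x'
      \<Longrightarrow> lunitor M x' \<cdot> tensor_arr M (Ide C (unit_obj M)) f = f \<cdot> lunitor M x"
    and runitor_Hom: "x \<in> Obj C \<Longrightarrow> runitor M x \<in> Hom C (tensor M x (unit_obj M)) x"
    and runitor_iso: "x \<in> Obj C \<Longrightarrow> is_iso C (runitor M x)"
    and runitor_natural: "f \<in> Hom C x x'
      \<Longrightarrow> runitor M x' \<cdot> tensor_arr M f (Ide C (unit_obj M)) = f \<cdot> runitor M x"
    and pentagon: "\<lbrakk>w \<in> Obj C; x \<in> Obj C; y \<in> Obj C; z \<in> Obj C\<rbrakk>
      \<Longrightarrow> associator M w x (tensor M y z) \<cdot> associator M (tensor M w x) y z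
        = tensor_arr M (Ide C w) (associator M x y z) \<cdot> associator M w (tensor M x y) z
            \<cdot> tensor_arr M (associator M w x y) (Ide C z)"
    and triangle: "\<lbrakk>x \<in> Obj C; y \<in> Obj C\<rbrakk>
      \<Longrightarrow> tensor_arr M (Ide C x) (lunitor M y) \<cdot> associator M x (unit_obj M) y
        = tensor_arr M (runitor M x) (Ide C y)"

locale symmetric_monoidal_category = monoidal_category +
  assumes braiding_Hom: "\<lbrakk>x \<in> Obj C; y \<in> Obj C\<rbrakk>
      \<Longrightarrow> braiding M x y \<in> Hom C (tensor M x y) (tensor M y x)"
    and braiding_natural: "\<lbrakk>f \<in> Hom C x x'; g \<in> Hom C y y'\<rbrakk>
      \<Longrightarrow> braiding M x' y' \<cdot> tensor_arr M f g = tensor_arr M g f \<cdot> braiding M x y"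
    and symmetry: "\<lbrakk>x \<in> Obj C; y \<in> Obj C\<rbrakk>
      \<Longrightarrow> braiding M y x \<cdot> braiding M x y = Ide C (tensor M x y)"
    and hexagon: "\<lbrakk>x \<in> Obj C; y \<in> Obj C; z \<in> Obj C\<rbrakk>
      \<Longrightarrow> associator M y z x \<cdot> braiding M x (tensor M y z) \<cdot> associator M x y z
        = tensor_arr M (Ide C y) (braiding M x z) \<cdot> associator M y x z
            \<cdot> tensor_arr M (braiding M x y) (Ide C z)"

locale two_group = monoidal_category + groupoid +
  assumes invertible: "x \<in> Obj C
    \<Longrightarrow> \<exists>y \<in> Obj C. isomorphic C (tensor M x y) (unit_obj M) \<and> isomorphic C (tensor M y x) (unit_obj M)"

locale symmetric_two_group = symmetric_monoidal_category + two_group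

text \<open>A symmetric (strong) monoidal functor \<open>F\<close> with structure isomorphisms
  \<open>m x y : F x \<otimes> F y \<rightarrow> F (x \<otimes> y)\<close> and \<open>e : I \<rightarrow> F I\<close>.\<close>

locale symmetric_monoidal_functor =
  cat_functor C D F + C: symmetric_monoidal_category C M + D: symmetric_monoidal_category D N
  for C :: "('o1, 'm1) cat" and M :: "('o1, 'm1) monoidal"
    and D :: "('o2, 'm2) cat" (structure) and N :: "('o2, 'm2) monoidal"
    and F :: "('o1, 'm1, 'o2, 'm2) func" +
  fixes m :: "'o1 \<Rightarrow> 'o1 \<Rightarrow> 'm2" and e :: 'm2
  assumes m_Hom: "\<lbrakk>x \<in> Obj C; y \<in> Obj C\<rbrakk>
      \<Longrightarrow> m x y \<in> Hom D (tensor N (fob F x) (fob F y)) (fob F (tensor M x y))"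
    and m_iso: "\<lbrakk>x \<in> Obj C; y \<in> Obj C\<rbrakk> \<Longrightarrow> is_iso D (m x y)"
    and m_natural: "\<lbrakk>f \<in> Hom C x x'; g \<in> Hom C y y'\<rbrakk>
      \<Longrightarrow> m x' y' \<cdot> tensor_arr N (far F f) (far F g) = far F (tensor_arr M f g) \<cdot> m x y"
    and e_Hom: "e \<in> Hom D (unit_obj N) (fob F (unit_obj M))"
    and e_iso: "is_iso D e"
    and m_associative: "\<lbrakk>x \<in> Obj C; y \<in> Obj C; z \<in> Obj C\<rbrakk>
      \<Longrightarrow> far F (associator M x y z) \<cdot> m (tensor M x y) z
            \<cdot> tensor_arr N (m x y) (Ide D (fob F z))
        = m x (tensor M y z) \<cdot> tensor_arr N (Ide D (fob F x)) (m y z)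
            \<cdot> associator N (fob F x) (fob F y) (fob F z)"
    and m_left_unit: "x \<in> Obj C
      \<Longrightarrow> far F (lunitor M x) \<cdot> m (unit_obj M) x \<cdot> tensor_arr N e (Ide D (fob F x))
        = lunitor N (fob F x)"
    and m_right_unit: "x \<in> Obj C
      \<Longrightarrow> far F (runitor M x) \<cdot> m x (unit_obj M) \<cdot> tensor_arr N (Ide D (fob F x)) e
        = runitor N (fob F x)"
    and m_symmetric: "\<lbrakk>x \<in> Obj C; y \<in> Obj C\<rbrakk>
      \<Longrightarrow> far F (braiding M x y) \<cdot> m x y = m y x \<cdot> braiding N (fob F x) (fob F y)"


section \<open>The canonical symmetric monoidal structure on fibres over an additive base\<close>

locale additive_category = finite_products C S
  for C :: "('o, 'm) cat" and S :: "('o, 'm) products" +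
  assumes preadditive: "\<exists>plus zero.
     (\<forall>a \<in> Obj C. \<forall>b \<in> Obj C.
        comm_group \<lparr>carrier = Hom C a b, monoid.mult = plus, one = zero a b\<rparr>) \<and>
     (\<forall>a b c f f' g. f \<in> Hom C a b \<and> f' \<in> Hom C a b \<and> g \<in> Hom C b c \<longrightarrow>
        g \<cdot>\<^bsub>C\<^esub> plus f f' = plus (g \<cdot>\<^bsub>C\<^esub> f) (g \<cdot>\<^bsub>C\<^esub> f')) \<and>
     (\<forall>a b c f g g'. f \<in> Hom C a b \<and> g \<in> Hom C b c \<and> g' \<in> Hom C b c \<longrightarrow>
        plus g g' \<cdot>\<^bsub>C\<^esub> f = plus (g \<cdot>\<^bsub>C\<^esub> f) (g' \<cdot>\<^bsub>C\<^esub> f))"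

text \<open>In an additive category the terminal object is a zero object and \<open>b \<times> b\<close> is a biproduct
  with injections \<open>\<langle>1, 0\<rangle>\<close> and \<open>\<langle>0, 1\<rangle>\<close>; \<open>codiagonal\<close> is the copairing \<open>[1, 1] : b \<times> b \<rightarrow> b\<close>.\<close>

definition from_zero :: "('o, 'm) cat \<Rightarrow> ('o, 'm) products \<Rightarrow> 'o \<Rightarrow> 'm" where
  "from_zero C S b = (THE h. h \<in> Hom C (One S) b)"

definition codiagonal :: "('o, 'm) cat \<Rightarrow> ('o, 'm) products \<Rightarrow> 'o \<Rightarrow> 'm" where
  "codiagonal C S b =
     (let zero = from_zero C S b \<cdot>\<^bsub>C\<^esub> to_one C S b in
      THE s. s \<in> Hom C (Prod S b b) b \<and>
        s \<cdot>\<^bsub>C\<^esub> pairing C S (Ide C b) zero = Ide C b \<and>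
        s \<cdot>\<^bsub>C\<^esub> pairing C S zero (Ide C b) = Ide C b)"

text \<open>The chosen cocartesian arrows \<open>x \<times> y \<rightarrow> x \<otimes> y\<close> over \<open>[1, 1]\<close> and \<open>1 \<rightarrow> I\<close> over \<open>0 \<rightarrow> b\<close>
  for \<open>x\<close> and \<open>y\<close> in the fibre over \<open>b\<close>.\<close>

definition to_tensor ::
  "('o1, 'm1) products \<Rightarrow> ('o2, 'm2) cat \<Rightarrow> ('o2, 'm2) products
     \<Rightarrow> ('m2 \<Rightarrow> 'o1 \<Rightarrow> 'm1) \<Rightarrow> 'o2 \<Rightarrow> 'o1 \<Rightarrow> 'o1 \<Rightarrow> 'm1" where
  "to_tensor SX B SB k b x y = k (codiagonal B SB b) (Prod SX x y)"

definition to_unit ::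
  "('o1, 'm1) products \<Rightarrow> ('o2, 'm2) cat \<Rightarrow> ('o2, 'm2) products
     \<Rightarrow> ('m2 \<Rightarrow> 'o1 \<Rightarrow> 'm1) \<Rightarrow> 'o2 \<Rightarrow> 'm1" where
  "to_unit SX B SB k b = k (from_zero B SB b) (One SX)"

text \<open>Each structure arrow is the vertical arrow induced, along the composite cocartesian arrow out
  of a product of objects of the total category, by the corresponding arrow for the cartesian
  structure. The associator, for instance, is the \<open>h\<close> making
  \<open>(x \<times> y) \<times> z \<rightarrow> (x \<otimes> y) \<otimes> z\<close> followed by \<open>h\<close> equal to
  \<open>(x \<times> y) \<times> z \<cong> x \<times> (y \<times> z) \<rightarrow> x \<otimes> (y \<otimes> z)\<close>.\<close>

definition fibre_monoidal ::
  "('o1, 'm1) cat \<Rightarrow> ('o1, 'm1) products \<Rightarrow> ('o2, 'm2) cat \<Rightarrow> ('o2, 'm2) products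
     \<Rightarrow> ('o1, 'm1, 'o2, 'm2) func \<Rightarrow> ('m2 \<Rightarrow> 'o1 \<Rightarrow> 'm1) \<Rightarrow> 'o2 \<Rightarrow> ('o1, 'm1) monoidal" where
  "fibre_monoidal X SX B SB P k b =
     (let t = to_tensor SX B SB k b;
          u = to_unit SX B SB k b;
          T = (\<lambda>x y. Cod X (t x y));
          I = Cod X u
      in \<lparr>tensor = T,
          tensor_arr = (\<lambda>f g. induced X B P (t (Dom X f) (Dom X g))
            (t (Cod X f) (Cod X g) \<cdot>\<^bsub>X\<^esub> prod_arr X SX f g)),
          unit_obj = I,
          associator = (\<lambda>x y z. induced X B P
            (t (T x y) z \<cdot>\<^bsub>X\<^esub> prod_arr X SX (t x y) (Ide X z))
            (t x (T y z) \<cdot>\<^bsub>X\<^esub> prod_arr X SX (Ide X x) (t y z) \<cdot>\<^bsub>X\<^esub> prod_assoc X SX x y z)),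
          lunitor = (\<lambda>x. induced X B P
            (t I x \<cdot>\<^bsub>X\<^esub> prod_arr X SX u (Ide X x)) (Snd SX (One SX) x)),
          runitor = (\<lambda>x. induced X B P
            (t x I \<cdot>\<^bsub>X\<^esub> prod_arr X SX (Ide X x) u) (Fst SX x (One SX))),
          braiding = (\<lambda>x y. induced X B P (t x y) (t y x \<cdot>\<^bsub>X\<^esub> prod_swap X SX x y))\<rparr>)"

text \<open>The comparison arrows \<open>f\<^sub>* x \<otimes> f\<^sub>* y \<rightarrow> f\<^sub>* (x \<otimes> y)\<close> and \<open>I \<rightarrow> f\<^sub>* I\<close>.\<close>

definition change_tensor ::
  "('o1, 'm1) cat \<Rightarrow> ('o1, 'm1) products \<Rightarrow> ('o2, 'm2) cat \<Rightarrow> ('o2, 'm2) products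
     \<Rightarrow> ('o1, 'm1, 'o2, 'm2) func \<Rightarrow> ('m2 \<Rightarrow> 'o1 \<Rightarrow> 'm1) \<Rightarrow> 'm2 \<Rightarrow> 'o1 \<Rightarrow> 'o1 \<Rightarrow> 'm1" where
  "change_tensor X SX B SB P k f x y =
     (let t = to_tensor SX B SB k (Dom B f); t' = to_tensor SX B SB k (Cod B f) in
      induced X B P
        (t' (Cod X (k f x)) (Cod X (k f y)) \<cdot>\<^bsub>X\<^esub> prod_arr X SX (k f x) (k f y))
        (k f (Cod X (t x y)) \<cdot>\<^bsub>X\<^esub> t x y))"

definition change_unit ::
  "('o1, 'm1) cat \<Rightarrow> ('o1, 'm1) products \<Rightarrow> ('o2, 'm2) cat \<Rightarrow> ('o2, 'm2) products
     \<Rightarrow> ('o1, 'm1, 'o2, 'm2) func \<Rightarrow> ('m2 \<Rightarrow> 'o1 \<Rightarrow> 'm1) \<Rightarrow> 'm2 \<Rightarrow> 'm1" where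
  "change_unit X SX B SB P k f =
     (let u = to_unit SX B SB k (Dom B f); u' = to_unit SX B SB k (Cod B f) in
      induced X B P u' (k f (Cod X u) \<cdot>\<^bsub>X\<^esub> u))"

end

theory Submission
  imports Defs
begin

text \<open>Three ideas carry the proof.

  \<^bold>\<open>Products.\<close> As \<open>P\<close> preserves products, \<open>- \<times> a\<close> and \<open>a \<times> -\<close> preserve vertical arrows, so they extend
  along \<open>L\<close> to functors on \<open>Q\<close>. Natural transformations extend along \<open>L\<close> as well
  (\<open>natural_extension\<close>), in particular projections, diagonal and the maps to the terminal object.
  These are the data and equations of a right adjoint to the diagonal functor, so \<open>Q\<close> has finite
  products and \<open>L\<close> preserves them (\<open>finite_products_fractions\<close>, \<open>strict_L\<close>).

  \<^bold>\<open>Cocartesian arrows.\<close> The danger is that inverting vertical arrows identifies too much: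
  if \<open>u\<close> is cocartesian in \<open>X\<close>, an equation \<open>w \<cdot> L u = w' \<cdot> L u\<close> with \<open>w\<close> and \<open>w'\<close> over the same base arrow
  must force \<open>w = w'\<close>. This is detected by a functor out of \<open>Q\<close>. An arrow \<open>h : y \<rightarrow> y'\<close> of \<open>X\<close> and a base
  arrow \<open>g\<close> out of \<open>P y'\<close> induce a vertical arrow \<open>(g \<cdot> P h)\<^sub>* y \<rightarrow> g\<^sub>* y'\<close>. The families, indexed by \<open>g\<close>, of
  the images of these arrows in \<open>Q\<close> can be composed, and for vertical \<open>h\<close> they can be
  inverted. This gives a functor from \<open>X\<close> to a transport category that inverts vertical
  arrows, hence a functor on \<open>Q\<close>. Its component at \<open>g = 1\<close> determines an arrow \<open>w : y \<rightarrow> y'\<close> of \<open>Q\<close>,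
  because \<open>component w g \<cdot> L (y \<rightarrow> (g \<cdot> P' w)\<^sub>* y) = L (y' \<rightarrow> g\<^sub>* y') \<cdot> w\<close> (\<open>component_square\<close>) and
  \<open>y' \<rightarrow> 1\<^sub>* y'\<close> is vertical. It follows that \<open>L\<close> preserves cocartesian arrows (\<open>cocartesian_L\<close>) and
  that every vertical arrow of \<open>Q\<close> is invertible (\<open>vertical_is_iso\<close>).
  The transport category can have more arrows than \<open>'m\<close> has elements; the universal property of \<open>Q\<close>
  still applies to it, since a functor needs only the values of zigzags (\<open>extension\<close>).

  \<^bold>\<open>Coherence.\<close> In an opfibration with groupoidal fibres every arrow is cocartesian
  (\<open>all_cocartesian\<close>). So products of cocartesian arrows are cocartesian, and two arrows from \<open>x\<close> to the
  same object and over the same base arrow are equal when they agree after composition with a single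
  arrow into \<open>x\<close>. An arrow \<open>c \<rightarrow> x\<close> is used as a generalized element of \<open>x\<close>, and elements \<open>p\<close> of \<open>x\<close> and
  \<open>q\<close> of \<open>y\<close> have a tensor product \<open>p \<otimes> q\<close>, lying over the sum \<open>P p + P q\<close>. The structure arrows act on
  elements by \<open>(p \<otimes> q) \<otimes> r \<mapsto> p \<otimes> (q \<otimes> r)\<close>, \<open>p \<otimes> q \<mapsto> q \<otimes> p\<close> and so on, and the coherence conditions
  become evident. The inverse of \<open>x\<close> for the tensor product is \<open>(-1)\<^sub>* x\<close>.\<close>

section \<open>Arrows, inverses and functors\<close>

lemma Hom_iff: "f \<in> Hom C a b \<longleftrightarrow> f \<in> Arr C \<and> Dom C f = a \<and> Cod C f = b"
  by (simp add: Hom_def)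

context category begin

declare Dom_Obj [simp] Cod_Obj [simp]

lemma Ide_simps [simp]:
  assumes "a \<in> Obj C"
  shows "Ide C a \<in> Arr C" "Dom C (Ide C a) = a" "Cod C (Ide C a) = a"
  using Ide_Hom[OF assms] by (simp_all add: Hom_iff)

lemma Comp_simps [simp]:
  assumes "f \<in> Arr C" "g \<in> Arr C" "Dom C g = Cod C f"
  shows "g \<cdot> f \<in> Arr C" "Dom C (g \<cdot> f) = Dom C f" "Cod C (g \<cdot> f) = Cod C g"
  using Comp_Hom[of f "Dom C f" "Cod C f" g "Cod C g"] assms by (simp_all add: Hom_iff)

lemma assoc:
  assumes "f \<in> Arr C" "g \<in> Arr C" "h \<in> Arr C" "Dom C g = Cod C f" "Dom C h = Cod C g"
  shows "(h \<cdot> g) \<cdot> f = h \<cdot> (g \<cdot> f)"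
  using Comp_assoc[of f "Dom C f" "Cod C f" g "Cod C g" h "Cod C h"] assms by (simp add: Hom_iff)

lemma Comp_Ide_left [simp]: "\<lbrakk>f \<in> Arr C; a = Cod C f\<rbrakk> \<Longrightarrow> Ide C a \<cdot> f = f"
  using Ide_left by simp

lemma Comp_Ide_right [simp]: "\<lbrakk>f \<in> Arr C; a = Dom C f\<rbrakk> \<Longrightarrow> f \<cdot> Ide C a = f"
  using Ide_right by simp

end

definition inverses :: "('o, 'm) cat \<Rightarrow> 'm \<Rightarrow> 'm \<Rightarrow> bool" where
  "inverses C f g \<longleftrightarrow> f \<in> Arr C \<and> g \<in> Arr C \<and> Dom C g = Cod C f \<and> Cod C g = Dom C f \<and>
     g \<cdot>\<^bsub>C\<^esub> f = Ide C (Dom C f) \<and> f \<cdot>\<^bsub>C\<^esub> g = Ide C (Cod C f)"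

lemma is_iso_iff: "is_iso C f \<longleftrightarrow> (\<exists>g. inverses C f g)"
  by (auto simp: is_iso_def inverses_def Hom_iff)

definition inv_arrow :: "('o, 'm) cat \<Rightarrow> 'm \<Rightarrow> 'm" where
  "inv_arrow C f = (SOME g. inverses C f g)"

lemma inverses_inv_arrow: "is_iso C f \<Longrightarrow> inverses C f (inv_arrow C f)"
  unfolding is_iso_iff inv_arrow_def by (rule someI_ex)

lemma inverses_sym: "inverses C f g \<Longrightarrow> inverses C g f"
  by (auto simp: inverses_def)

context category begin

lemma inverses_Comp:
  assumes "inverses C f f'" "inverses C g g'" "Dom C g = Cod C f"
  shows "inverses C (g \<cdot> f) (f' \<cdot> g')"
proof -
  have t: "f \<in> Arr C" "f' \<in> Arr C" "Dom C f' = Cod C f" "Cod C f' = Dom C f"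
    "g \<in> Arr C" "g' \<in> Arr C" "Dom C g' = Cod C g" "Cod C g' = Dom C g"
    using assms unfolding inverses_def by simp_all
  have a: "(f' \<cdot> g') \<cdot> (g \<cdot> f) = f' \<cdot> ((g' \<cdot> g) \<cdot> f)"
    using t assms(3) by (simp add: assoc)
  have b: "(g \<cdot> f) \<cdot> (f' \<cdot> g') = g \<cdot> ((f \<cdot> f') \<cdot> g')"
    using t assms(3) by (simp add: assoc)
  show ?thesis unfolding inverses_def a b using assms unfolding inverses_def by simp
qed

lemma is_iso_Comp: "\<lbrakk>is_iso C f; is_iso C g; Dom C g = Cod C f\<rbrakk> \<Longrightarrow> is_iso C (g \<cdot> f)"
  unfolding is_iso_iff using inverses_Comp by blast

lemma is_iso_Ide [simp]: "a \<in> Obj C \<Longrightarrow> is_iso C (Ide C a)"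
  unfolding is_iso_iff inverses_def by (intro exI[of _ "Ide C a"]) simp

lemma iso_cancel_right:
  assumes "is_iso C f" "g \<in> Arr C" "h \<in> Arr C" "Dom C g = Cod C f" "Dom C h = Cod C f"
    and "g \<cdot> f = h \<cdot> f"
  shows "g = h"
proof -
  obtain f' where f': "f \<in> Arr C" "f' \<in> Arr C" "Cod C f' = Dom C f" "f \<cdot> f' = Ide C (Cod C f)"
    using assms(1) by (auto simp: is_iso_iff inverses_def)
  have "g = g \<cdot> (f \<cdot> f')" using f' assms(2,4) by simp
  also have "\<dots> = (h \<cdot> f) \<cdot> f'"
    unfolding assms(6)[symmetric] using f' assms(2,4) by (intro assoc[symmetric]) simp_all
  also have "\<dots> = h \<cdot> (f \<cdot> f')" using f' assms(3,5) by (intro assoc) simp_all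
  also have "\<dots> = h" using f' assms(3,5) by simp
  finally show ?thesis .
qed

lemma move_inverse_left:
  assumes "inverses C f f'" "g \<in> Arr C" "Cod C g = Dom C f" "f \<cdot> g = h"
  shows "g = f' \<cdot> h"
proof -
  have "f' \<cdot> (f \<cdot> g) = (f' \<cdot> f) \<cdot> g"
    using assms by (intro assoc[symmetric]; simp add: inverses_def)
  then show ?thesis using assms by (simp add: inverses_def)
qed

end

context cat_functor begin

lemma fob_Obj' [simp]: "a \<in> Obj A \<Longrightarrow> fob F a \<in> Obj B"
  by (rule fob_Obj)

lemma far_simps [simp]:
  assumes "f \<in> Arr A"
  shows "far F f \<in> Arr B" "Dom B (far F f) = fob F (Dom A f)" "Cod B (far F f) = fob F (Cod A f)"
  using far_Hom[of f "Dom A f" "Cod A f"] assms by (simp_all add: Hom_iff)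

lemma far_Ide' [simp]: "a \<in> Obj A \<Longrightarrow> far F (Ide A a) = Ide B (fob F a)"
  by (rule far_Ide)

lemma far_Comp' [simp]:
  "\<lbrakk>f \<in> Arr A; g \<in> Arr A; Dom A g = Cod A f\<rbrakk> \<Longrightarrow> far F (g \<cdot>\<^bsub>A\<^esub> f) = far F g \<cdot>\<^bsub>B\<^esub> far F f"
  using far_Comp[of f "Dom A f" "Cod A f" g "Cod A g"] by (simp add: Hom_iff)

lemma inverses_far: "inverses A f g \<Longrightarrow> inverses B (far F f) (far F g)"
  unfolding inverses_def
  by (metis far_Comp' far_Ide' far_simps A.Cod_Obj A.Dom_Obj)

lemma is_iso_far: "is_iso A f \<Longrightarrow> is_iso B (far F f)"
  unfolding is_iso_iff using inverses_far by blast

end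

lemma cat_functorI:
  assumes "category A" "category B"
    and "\<And>a. a \<in> Obj A \<Longrightarrow> fob F a \<in> Obj B"
    and "\<And>f. f \<in> Arr A \<Longrightarrow> far F f \<in> Arr B \<and> Dom B (far F f) = fob F (Dom A f) \<and>
      Cod B (far F f) = fob F (Cod A f)"
    and "\<And>a. a \<in> Obj A \<Longrightarrow> far F (Ide A a) = Ide B (fob F a)"
    and "\<And>f g. \<lbrakk>f \<in> Arr A; g \<in> Arr A; Dom A g = Cod A f\<rbrakk>
      \<Longrightarrow> far F (g \<cdot>\<^bsub>A\<^esub> f) = far F g \<cdot>\<^bsub>B\<^esub> far F f"
  shows "cat_functor A B F"
proof -
  interpret A: category A by fact
  interpret B: category B by fact
  show ?thesis by unfold_locales (use assms in \<open>auto simp: Hom_iff\<close>)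
qed

lemma cat_functor_id: "category C \<Longrightarrow> cat_functor C C \<lparr>fob = \<lambda>a. a, far = \<lambda>f. f\<rparr>"
  by (rule cat_functorI) auto

lemma cat_functor_comp:
  assumes "cat_functor A B F" "cat_functor B C G"
  shows "cat_functor A C (func_comp G F)"
proof -
  interpret F: cat_functor A B F by fact
  interpret G: cat_functor B C G by fact
  show ?thesis
    by (rule cat_functorI) (auto simp: func_comp_def F.A.category_axioms G.B.category_axioms)
qed

section \<open>The universal property at arbitrary types\<close>

text \<open>Iterate an injective pairing on \<open>'a\<close>, and record the length of the list so that the code can be
  decoded.\<close>

lemma inj_list_infinite:
  assumes "infinite (UNIV :: 'a set)"
  shows "\<exists>f :: 'a list \<Rightarrow> 'a. inj f"
proof -
  obtain p :: "'a \<times> 'a \<Rightarrow> 'a" where p: "inj p"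
    using card_of_Times_same_infinite[OF assms] unfolding card_of_ordIso[symmetric]
    by (auto simp: bij_betw_def)
  obtain n :: "nat \<Rightarrow> 'a" where n: "inj n"
    using assms infinite_countable_subset by blast
  define e where "e xs = foldr (\<lambda>x c. p (x, c)) xs (n 0)" for xs
  have e: "e xs = e ys \<Longrightarrow> length xs = length ys \<Longrightarrow> xs = ys" for xs ys
  proof (induction xs arbitrary: ys)
    case (Cons x xs)
    then obtain y zs where ys: "ys = y # zs" by (cases ys) auto
    have "p (x, e xs) = p (y, e zs)" using Cons.prems(1) by (simp add: e_def ys)
    then have "x = y" "e xs = e zs" using injD[OF p] by blast+
    then show ?case using Cons.IH Cons.prems(2) by (simp add: ys)
  qed simp
  have "inj (\<lambda>xs. p (n (length xs), e xs))"
  proof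
    fix xs ys assume "p (n (length xs), e xs) = p (n (length ys), e ys)"
    then have "n (length xs) = n (length ys)" "e xs = e ys" using injD[OF p] by blast+
    then show "xs = ys" using e injD[OF n] by blast
  qed
  then show ?thesis by blast
qed

text \<open>Transport of structure along an \<open>e\<close> injective on arrows: it brings a small enough category to the
  type of arrows over which the universal property quantifies.\<close>

definition copy_arrows :: "('o, 'a) cat \<Rightarrow> ('a \<Rightarrow> 'm) \<Rightarrow> ('o, 'm) cat" where
  "copy_arrows C e = (let d = inv_into (Arr C) e in
     \<lparr>Obj = Obj C, Arr = e ` Arr C, Dom = Dom C \<circ> d, Cod = Cod C \<circ> d, Ide = e \<circ> Ide C,
      Comp = \<lambda>g f. e (d g \<cdot>\<^bsub>C\<^esub> d f)\<rparr>)"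

lemma copy_arrows:
  assumes "category C" "inj_on e (Arr C)"
  shows "cat_functor C (copy_arrows C e) \<lparr>fob = \<lambda>a. a, far = e\<rparr>" (is ?to)
    and "cat_functor (copy_arrows C e) C \<lparr>fob = \<lambda>a. a, far = inv_into (Arr C) e\<rparr>" (is ?from)
proof -
  interpret C: category C by fact
  have [simp]: "inv_into (Arr C) e (e f) = f" if "f \<in> Arr C" for f
    using assms(2) that by (rule inv_into_f_f)
  have cat: "category (copy_arrows C e)"
    by unfold_locales (auto simp: copy_arrows_def Let_def Hom_iff C.assoc)
  show ?to ?from
    by (rule cat_functorI; auto simp: copy_arrows_def Let_def cat[unfolded copy_arrows_def Let_def] C.category_axioms)+
qed

text \<open>The values in \<open>Y\<close> of the zigzags in \<open>X\<close>, with arrows of \<open>\<Sigma>\<close> traversed backwards. They are the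
  only arrows of \<open>Y\<close> that an extension of \<open>F\<close> to the category of fractions can hit.\<close>

inductive zigzag :: "('o, 'm) cat \<Rightarrow> 'm set \<Rightarrow> ('p, 'n) cat \<Rightarrow> ('o, 'm, 'p, 'n) func \<Rightarrow>
    'o \<Rightarrow> 'n \<Rightarrow> 'o \<Rightarrow> bool"
  for X :: "('o, 'm) cat" and \<Sigma> and Y :: "('p, 'n) cat" and F where
  empty: "x \<in> Obj X \<Longrightarrow> zigzag X \<Sigma> Y F x (Ide Y (fob F x)) x"
| forward: "\<lbrakk>zigzag X \<Sigma> Y F x \<phi> y; h \<in> Arr X; Dom X h = y\<rbrakk>
    \<Longrightarrow> zigzag X \<Sigma> Y F x (far F h \<cdot>\<^bsub>Y\<^esub> \<phi>) (Cod X h)"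
| backward: "\<lbrakk>zigzag X \<Sigma> Y F x \<phi> y; s \<in> \<Sigma>; Cod X s = y\<rbrakk>
    \<Longrightarrow> zigzag X \<Sigma> Y F x (inv_arrow Y (far F s) \<cdot>\<^bsub>Y\<^esub> \<phi>) (Dom X s)"

definition zigzag_cat ::
  "('o, 'm) cat \<Rightarrow> 'm set \<Rightarrow> ('p, 'n) cat \<Rightarrow> ('o, 'm, 'p, 'n) func \<Rightarrow> ('o, 'o \<times> 'n \<times> 'o) cat" where
  "zigzag_cat X \<Sigma> Y F =
     \<lparr>Obj = Obj X, Arr = {(x, \<phi>, y). zigzag X \<Sigma> Y F x \<phi> y}, Dom = fst, Cod = snd \<circ> snd,
      Ide = \<lambda>x. (x, Ide Y (fob F x), x),
      Comp = \<lambda>(_, \<psi>, z) (x, \<phi>, _). (x, \<psi> \<cdot>\<^bsub>Y\<^esub> \<phi>, z)\<rparr>"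

text \<open>A zigzag is a word in the arrows of \<open>X\<close>, so there are no more values of zigzags than
  elements of \<open>'m\<close>.\<close>

lemma zigzag_cat_small:
  fixes X :: "('o, 'm::infinite) cat"
  assumes "category X"
  shows "\<exists>e :: 'o \<times> 'n \<times> 'o \<Rightarrow> 'm. inj_on e (Arr (zigzag_cat X \<Sigma> (Y :: ('p, 'n) cat) F))"
proof -
  interpret X: category X by fact
  define step :: "'m \<times> bool \<Rightarrow> 'n \<times> 'o \<Rightarrow> 'n \<times> 'o" where
    "step = (\<lambda>(h, b) (\<phi>, y). if b then (far F h \<cdot>\<^bsub>Y\<^esub> \<phi>, Cod X h)
       else (inv_arrow Y (far F h) \<cdot>\<^bsub>Y\<^esub> \<phi>, Dom X h))"
  \<comment> \<open>A word is read from right to left; the identity put at its head only records the object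
    where the zigzag starts.\<close>
  define val :: "('m \<times> bool) list \<Rightarrow> 'o \<times> 'n \<times> 'o" where
    "val w = (let x = Dom X (fst (hd w)) in
       (x, foldr step (tl w) (Ide Y (fob F x), x)))" for w
  have words: "\<exists>w. foldr step w (Ide Y (fob F x), x) = (\<phi>, y) \<and> x \<in> Obj X"
    if "zigzag X \<Sigma> Y F x \<phi> y" for x \<phi> y
    using that
  proof induction
    case (empty x)
    then show ?case by (intro exI[of _ "[]"]) simp
  next
    case (forward x \<phi> y h)
    then obtain w where "foldr step w (Ide Y (fob F x), x) = (\<phi>, y)" "x \<in> Obj X" by blast
    then show ?case
      by (intro exI[of _ "(h, True) # w"]) (simp add: step_def)
  next
    case (backward x \<phi> y s)
    then obtain w where "foldr step w (Ide Y (fob F x), x) = (\<phi>, y)" "x \<in> Obj X" by blast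
    then show ?case
      by (intro exI[of _ "(s, False) # w"]) (simp add: step_def)
  qed
  have "\<exists>w. (x, \<phi>, y) = val ((Ide X x, True) # w)" if zz: "zigzag X \<Sigma> Y F x \<phi> y" for x \<phi> y
  proof -
    obtain w where "foldr step w (Ide Y (fob F x), x) = (\<phi>, y)" "x \<in> Obj X"
      using words[OF zz] by blast
    then show ?thesis by (intro exI[of _ w]) (simp add: val_def)
  qed
  then have sub: "Arr (zigzag_cat X \<Sigma> Y F) \<subseteq> range val"
    by (fastforce simp: zigzag_cat_def)
  obtain l :: "'m list \<Rightarrow> 'm" where l: "inj l" using inj_list_infinite infinite_UNIV by blast
  obtain a b :: 'm where ab: "a \<noteq> b"
    using arb_element[of "{undefined :: 'm}"] by auto
  \<comment> \<open>Two distinct elements of \<open>'m\<close> encode the direction in which an arrow is traversed.\<close>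
  define letter :: "'m \<times> bool \<Rightarrow> 'm" where
    "letter c = l [fst c, if snd c then a else b]" for c
  have "inj letter"
  proof
    fix c d assume "letter c = letter d"
    then have "[fst c, if snd c then a else b] = [fst d, if snd d then a else b]"
      unfolding letter_def by (rule injD[OF l])
    then show "c = d" using ab by (auto simp: prod_eq_iff split: if_splits)
  qed
  define word where "word = l \<circ> map letter"
  have "inj word"
    unfolding word_def using l \<open>inj letter\<close> by (intro inj_compose inj_mapI)
  then have "inj_on (word \<circ> inv_into UNIV val) (Arr (zigzag_cat X \<Sigma> Y F))"
    using sub by (intro comp_inj_on inj_on_inv_into) (auto intro: inj_on_subset)
  then show ?thesis by blast
qed

lemma zigzag_cat:
  assumes "cat_functor X Y F" "inverts F \<Sigma> Y" "\<Sigma> \<subseteq> Arr X"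
  shows "cat_functor X (zigzag_cat X \<Sigma> Y F) \<lparr>fob = \<lambda>x. x, far = \<lambda>h. (Dom X h, far F h, Cod X h)\<rparr>"
      (is "cat_functor X ?Z ?I")
    and "inverts \<lparr>fob = \<lambda>x. x, far = \<lambda>h. (Dom X h, far F h, Cod X h)\<rparr> \<Sigma> (zigzag_cat X \<Sigma> Y F)"
    and "cat_functor (zigzag_cat X \<Sigma> Y F) Y \<lparr>fob = fob F, far = \<lambda>(x, \<phi>, y). \<phi>\<rparr>"
proof -
  interpret F: cat_functor X Y F by fact
  have bwd: "inverses Y (far F s) (inv_arrow Y (far F s))" if "s \<in> \<Sigma>" for s
    using assms(2) that by (simp add: inverts_def inverses_inv_arrow)
  note zz = zigzag.intros[where X = X and \<Sigma> = \<Sigma> and Y = Y and F = F]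
  have dc: "x \<in> Obj X \<and> y \<in> Obj X \<and> \<phi> \<in> Arr Y \<and> Dom Y \<phi> = fob F x \<and> Cod Y \<phi> = fob F y"
    if "zigzag X \<Sigma> Y F x \<phi> y" for x \<phi> y
    using that
  proof induction
    case (backward x \<phi> y s)
    then show ?case using bwd[of s] assms(3) by (auto simp: inverses_def subset_iff)
  qed auto
  have comp: "zigzag X \<Sigma> Y F x (\<psi> \<cdot>\<^bsub>Y\<^esub> \<phi>) z"
    if \<psi>: "zigzag X \<Sigma> Y F y \<psi> z" and \<phi>: "zigzag X \<Sigma> Y F x \<phi> y" for x y z \<phi> \<psi>
    using \<psi> \<phi>
  proof induction
    case (empty x)
    then show ?case using dc[OF empty(2)] by simp
  next
    case (forward y \<psi> z h)
    show ?case using zz(2)[OF forward.IH[OF forward.prems] forward.hyps(2-)]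
        dc[OF forward.prems] dc[OF forward.hyps(1)] forward.hyps
      by (simp add: F.B.assoc)
  next
    case (backward y \<psi> z s)
    have "(inv_arrow Y (far F s) \<cdot>\<^bsub>Y\<^esub> \<psi>) \<cdot>\<^bsub>Y\<^esub> \<phi> = inv_arrow Y (far F s) \<cdot>\<^bsub>Y\<^esub> (\<psi> \<cdot>\<^bsub>Y\<^esub> \<phi>)"
      using dc[OF backward.prems] dc[OF backward.hyps(1)] backward.hyps bwd[of s] assms(3)
      by (auto simp: F.B.assoc inverses_def)
    then show ?case using zz(3)[OF backward.IH[OF backward.prems] backward.hyps(2-)]
      by simp
  qed
  have cat: "category ?Z"
    by (unfold_locales; auto simp: zigzag_cat_def Hom_iff intro: zz(1) comp)
      (auto dest!: dc intro!: F.B.assoc)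
  have far: "zigzag X \<Sigma> Y F (Dom X h) (far F h) (Cod X h)" if "h \<in> Arr X" for h
    using zz(2)[OF zz(1), of "Dom X h" h] that by simp
  show I: "cat_functor X ?Z ?I"
    by (rule cat_functorI[OF F.A.category_axioms cat]) (auto simp: zigzag_cat_def far)
  show "inverts ?I \<Sigma> ?Z"
    unfolding inverts_def
  proof
    fix s assume s: "s \<in> \<Sigma>"
    have "zigzag X \<Sigma> Y F (Cod X s) (inv_arrow Y (far F s)) (Dom X s)"
      using zz(3)[OF zz(1) s, of "Cod X s"] bwd[OF s] s assms(3) by (auto simp: inverses_def)
    then have "inverses ?Z (far ?I s) (Cod X s, inv_arrow Y (far F s), Dom X s)"
      using far[of s] s assms(3) bwd[OF s] by (auto simp: inverses_def zigzag_cat_def)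
    then show "is_iso ?Z (far ?I s)" by (auto simp: is_iso_iff)
  qed
  show "cat_functor ?Z Y \<lparr>fob = fob F, far = \<lambda>(x, \<phi>, y). \<phi>\<rparr>"
    by (rule cat_functorI[OF cat F.B.category_axioms]) (auto simp: zigzag_cat_def dest: dc)
qed

lemma inverts_comp:
  assumes "cat_functor Y Z G" "inverts F \<Sigma> Y"
  shows "inverts (func_comp G F) \<Sigma> Z"
proof -
  interpret G: cat_functor Y Z G by fact
  show ?thesis using assms(2) G.is_iso_far by (simp add: inverts_def func_comp_def)
qed

locale fractions =
  fixes X :: "('o, 'm::infinite) cat" and \<Sigma> Q L
  assumes fractions: "category_of_fractions X \<Sigma> Q L"
    and \<Sigma>_Arr: "\<Sigma> \<subseteq> Arr X"
begin

sublocale L: cat_functor X Q L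
  using fractions by (simp add: category_of_fractions_def)

lemma L_iso: "s \<in> \<Sigma> \<Longrightarrow> is_iso Q (far L s)"
  using fractions by (simp add: category_of_fractions_def inverts_def)

text \<open>A functor to a category \<open>Y\<close> with arrows of another type takes its values on zigzags in
  a category that has a copy with arrows in \<open>'m\<close>; the universal property applies to the copy.\<close>

lemma extension:
  assumes F: "cat_functor X Y F" "inverts F \<Sigma> Y"
  obtains G where "cat_functor Q Y G" "\<And>x. x \<in> Obj X \<Longrightarrow> fob G (fob L x) = fob F x"
    "\<And>h. h \<in> Arr X \<Longrightarrow> far G (far L h) = far F h"
proof -
  let ?Z = "zigzag_cat X \<Sigma> Y F"
  note Z = zigzag_cat[OF F \<Sigma>_Arr]
  interpret Z: cat_functor ?Z Y "\<lparr>fob = fob F, far = \<lambda>(x, \<phi>, y). \<phi>\<rparr>" by (rule Z(3))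
  interpret I: cat_functor X ?Z "\<lparr>fob = \<lambda>x. x, far = \<lambda>h. (Dom X h, far F h, Cod X h)\<rparr>" by (rule Z(1))
  obtain e :: "_ \<Rightarrow> 'm" where e: "inj_on e (Arr ?Z)"
    using zigzag_cat_small[OF L.A.category_axioms] by blast
  note c = copy_arrows[OF Z.A.category_axioms e]
  obtain G where G: "cat_functor Q (copy_arrows ?Z e) G"
    "func_eq X (func_comp G L) (func_comp \<lparr>fob = \<lambda>a. a, far = e\<rparr>
       \<lparr>fob = \<lambda>x. x, far = \<lambda>h. (Dom X h, far F h, Cod X h)\<rparr>)"
    using fractions cat_functor_comp[OF Z(1) c(1)] inverts_comp[OF c(1) Z(2)]
    unfolding category_of_fractions_def by blast
  let ?G = "func_comp \<lparr>fob = fob F, far = \<lambda>(x, \<phi>, y). \<phi>\<rparr>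
    (func_comp \<lparr>fob = \<lambda>a. a, far = inv_into (Arr ?Z) e\<rparr> G)"
  show ?thesis
  proof
    show "cat_functor Q Y ?G" by (intro cat_functor_comp[OF _ Z(3)] cat_functor_comp[OF _ c(2)] G(1))
    show "fob ?G (fob L x) = fob F x" if "x \<in> Obj X" for x
      using G(2) that by (simp add: func_eq_def func_comp_def)
    show "far ?G (far L h) = far F h" if "h \<in> Arr X" for h
      using G(2) that I.far_simps(1)[OF that] e by (simp add: func_eq_def func_comp_def)
  qed
qed

text \<open>The objects of the image of \<open>L\<close> and the arrows with the property \<open>S\<close> form a subcategory
  through which \<open>L\<close> factors; by the universal property it is the whole of \<open>Q\<close>.\<close>

lemma generated:
  assumes L: "\<And>h. h \<in> Arr X \<Longrightarrow> S (far L h)"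
    and comp: "\<And>f g. \<lbrakk>f \<in> Arr Q; g \<in> Arr Q; Dom Q g = Cod Q f; S f; S g\<rbrakk> \<Longrightarrow> S (g \<cdot>\<^bsub>Q\<^esub> f)"
    and inv: "\<And>s t. \<lbrakk>s \<in> \<Sigma>; inverses Q (far L s) t\<rbrakk> \<Longrightarrow> S t"
  shows "a \<in> Obj Q \<Longrightarrow> a \<in> fob L ` Obj X" "f \<in> Arr Q \<Longrightarrow> S f"
proof -
  define R where "R = Q\<lparr>Obj := fob L ` Obj X,
    Arr := {f \<in> Arr Q. S f \<and> Dom Q f \<in> fob L ` Obj X \<and> Cod Q f \<in> fob L ` Obj X}\<rparr>"
  have ide: "S (Ide Q a)" if a: "a \<in> fob L ` Obj X" for a
  proof -
    obtain x where "x \<in> Obj X" "a = fob L x" using a by blast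
    then show ?thesis using L[of "Ide X x"] by simp
  qed
  interpret R: category R
    by unfold_locales (auto simp: R_def Hom_iff ide L.B.assoc comp)
  have J: "cat_functor R Q \<lparr>fob = \<lambda>a. a, far = \<lambda>f. f\<rparr>"
    by (rule cat_functorI[OF R.category_axioms L.B.category_axioms]) (auto simp: R_def)
  have L': "cat_functor X R L"
    by (rule cat_functorI[OF L.A.category_axioms R.category_axioms]) (auto simp: R_def L)
  have "inverts L \<Sigma> R"
    unfolding inverts_def
  proof
    fix s assume s: "s \<in> \<Sigma>"
    obtain t where t: "inverses Q (far L s) t" using L_iso[OF s] by (auto simp: is_iso_iff)
    have "inverses R (far L s) t"
      using t inv[OF s t] s \<Sigma>_Arr L by (auto simp: inverses_def R_def)
    then show "is_iso R (far L s)" by (auto simp: is_iso_iff)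
  qed
  then obtain G where G: "cat_functor Q R G" "func_eq X (func_comp G L) L"
    using fractions L' unfolding category_of_fractions_def by blast
  interpret G: cat_functor Q R G by (rule G(1))
  have GQ: "cat_functor Q Q G"
    using cat_functor_comp[OF G(1) J] by (cases G) (simp add: func_comp_def comp_def)
  let ?id = "\<lparr>fob = \<lambda>a. a, far = \<lambda>f. f\<rparr> :: ('o, 'm, 'o, 'm) func"
  have "inverts L \<Sigma> Q" by (simp add: inverts_def L_iso)
  then obtain H where H: "\<And>G. \<lbrakk>cat_functor Q Q G; func_eq X (func_comp G L) L\<rbrakk> \<Longrightarrow> func_eq Q G H"
    using fractions L.cat_functor_axioms unfolding category_of_fractions_def by meson
  have "func_eq X (func_comp ?id L) L" by (simp add: func_eq_def func_comp_def)
  then have "func_eq Q ?id H" by (rule H[OF cat_functor_id[OF L.B.category_axioms]])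
  moreover have "func_eq Q G H" using GQ G(2) by (rule H)
  ultimately have "func_eq Q G ?id" unfolding func_eq_def by metis
  then show "a \<in> Obj Q \<Longrightarrow> a \<in> fob L ` Obj X" "f \<in> Arr Q \<Longrightarrow> S f"
    using G.fob_Obj[of a] G.far_simps(1)[of f] by (auto simp: func_eq_def R_def)
qed

text \<open>The functor from \<open>X\<close> to the indiscrete category on its objects inverts everything, so it
  factors through \<open>L\<close>.\<close>

lemma fob_L_inj: "inj_on (fob L) (Obj X)"
proof -
  define I :: "('o, 'o \<times> 'o) cat" where
    "I = \<lparr>Obj = Obj X, Arr = Obj X \<times> Obj X, Dom = fst, Cod = snd, Ide = \<lambda>x. (x, x),
      Comp = \<lambda>g f. (fst f, snd g)\<rparr>"
  interpret I: category I by unfold_locales (auto simp: I_def Hom_iff)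
  have 1: "cat_functor X I \<lparr>fob = \<lambda>x. x, far = \<lambda>h. (Dom X h, Cod X h)\<rparr>"
    by (rule cat_functorI[OF L.A.category_axioms I.category_axioms]) (auto simp: I_def)
  have "inverses I (x, y) (y, x)" if "x \<in> Obj X" "y \<in> Obj X" for x y
    using that by (auto simp: inverses_def I_def)
  then have 2: "inverts \<lparr>fob = \<lambda>x. x, far = \<lambda>h. (Dom X h, Cod X h)\<rparr> \<Sigma> I"
    using \<Sigma>_Arr unfolding inverts_def is_iso_iff
    by (metis L.A.Cod_Obj L.A.Dom_Obj func.select_convs(2) subsetD)
  show ?thesis
    by (rule extension[OF 1 2]) (metis (no_types, lifting) func.select_convs(1) inj_onI)
qed

text \<open>The functor \<open>L\<close> is bijective on objects, with inverse \<open>obj\<close>.\<close>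

definition obj :: "'o \<Rightarrow> 'o" where "obj = inv_into (Obj X) (fob L)"

lemma obj_L [simp]: "x \<in> Obj X \<Longrightarrow> obj (fob L x) = x"
  unfolding obj_def using fob_L_inj by (rule inv_into_f_f)

lemma obj_Obj [simp]: "a \<in> Obj Q \<Longrightarrow> obj a \<in> Obj X"
  and L_obj [simp]: "a \<in> Obj Q \<Longrightarrow> fob L (obj a) = a"
  using generated(1)[of "\<lambda>_. True" a] obj_L by auto

lemma arr_induct [consumes 1, case_names L Comp inverse]:
  assumes "f \<in> Arr Q"
    and "\<And>h. h \<in> Arr X \<Longrightarrow> S (far L h)"
    and "\<And>f g. \<lbrakk>f \<in> Arr Q; g \<in> Arr Q; Dom Q g = Cod Q f; S f; S g\<rbrakk> \<Longrightarrow> S (g \<cdot>\<^bsub>Q\<^esub> f)"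
    and "\<And>s t. \<lbrakk>s \<in> \<Sigma>; inverses Q (far L s) t; S (far L s)\<rbrakk> \<Longrightarrow> S t"
  shows "S f"
  using generated(2)[of S, OF assms(2,3) _ assms(1)] assms(2,4) \<Sigma>_Arr by blast

text \<open>The two-dimensional part of the universal property. A naturality square can be composed with
  another one, and it can be reversed when its two parallel sides \<open>F f\<close> and \<open>G f\<close> are invertible.\<close>

lemma natural_extension:
  assumes "cat_functor Q Y F" "cat_functor Q Y G"
    and \<eta>: "\<And>a. a \<in> Obj Q \<Longrightarrow> \<eta> a \<in> Hom Y (fob F a) (fob G a)"
    and nat: "\<And>h. h \<in> Arr X \<Longrightarrow>
      \<eta> (fob L (Cod X h)) \<cdot>\<^bsub>Y\<^esub> far F (far L h) = far G (far L h) \<cdot>\<^bsub>Y\<^esub> \<eta> (fob L (Dom X h))"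
    and "f \<in> Arr Q"
  shows "\<eta> (Cod Q f) \<cdot>\<^bsub>Y\<^esub> far F f = far G f \<cdot>\<^bsub>Y\<^esub> \<eta> (Dom Q f)"
proof -
  interpret F: cat_functor Q Y F by fact
  interpret G: cat_functor Q Y G by fact
  have [simp]: "\<eta> a \<in> Arr Y" "Dom Y (\<eta> a) = fob F a" "Cod Y (\<eta> a) = fob G a" if "a \<in> Obj Q" for a
    using \<eta>[OF that] by (simp_all add: Hom_iff)
  show ?thesis using assms(5)
  proof (induction rule: arr_induct)
    case (L h)
    then show ?case using nat by simp
  next
    case (Comp f g)
    have "\<eta> (Cod Q g) \<cdot>\<^bsub>Y\<^esub> far F (g \<cdot>\<^bsub>Q\<^esub> f) = (\<eta> (Cod Q g) \<cdot>\<^bsub>Y\<^esub> far F g) \<cdot>\<^bsub>Y\<^esub> far F f"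
      using Comp(1-3) by (simp add: F.B.assoc)
    also have "\<dots> = far G g \<cdot>\<^bsub>Y\<^esub> (\<eta> (Dom Q g) \<cdot>\<^bsub>Y\<^esub> far F f)"
      unfolding Comp(5) using Comp(1-3) by (simp add: F.B.assoc)
    also have "\<dots> = far G (g \<cdot>\<^bsub>Q\<^esub> f) \<cdot>\<^bsub>Y\<^esub> \<eta> (Dom Q f)"
      unfolding Comp(3,4) using Comp(1-3) by (simp add: F.B.assoc)
    finally show ?case using Comp(1-3) by simp
  next
    case (inverse s t)
    let ?s = "far L s"
    have st: "inverses Y (far F ?s) (far F t)" "inverses Y (far G ?s) (far G t)"
      using inverse(2) F.inverses_far G.inverses_far by blast+
    have ty: "?s \<in> Arr Q" "t \<in> Arr Q" "Dom Q t = Cod Q ?s" "Cod Q t = Dom Q ?s"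
      using inverse(2) by (simp_all add: inverses_def)
    have "far G ?s \<cdot>\<^bsub>Y\<^esub> (\<eta> (Cod Q t) \<cdot>\<^bsub>Y\<^esub> far F t) = (far G ?s \<cdot>\<^bsub>Y\<^esub> \<eta> (Dom Q ?s)) \<cdot>\<^bsub>Y\<^esub> far F t"
      using ty by (simp add: F.B.assoc)
    also have "\<dots> = \<eta> (Cod Q ?s) \<cdot>\<^bsub>Y\<^esub> (far F ?s \<cdot>\<^bsub>Y\<^esub> far F t)"
      unfolding inverse(3)[symmetric] using ty by (simp add: F.B.assoc)
    also have "\<dots> = \<eta> (Cod Q ?s)" using st ty by (simp add: inverses_def)
    finally show ?case
      using F.B.move_inverse_left[OF st(2)] ty by simp
  qed
qed

end

section \<open>Finite products in a category of fractions\<close>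

context finite_products begin

declare One_Obj [simp] Prod_Obj [simp]

lemma Fst_Snd_simps [simp]:
  assumes "a \<in> Obj C" "b \<in> Obj C"
  shows "Fst S a b \<in> Arr C" "Dom C (Fst S a b) = Prod S a b" "Cod C (Fst S a b) = a"
    "Snd S a b \<in> Arr C" "Dom C (Snd S a b) = Prod S a b" "Cod C (Snd S a b) = b"
  using Fst_Hom[OF assms] Snd_Hom[OF assms] by (simp_all add: Hom_iff)

lemma pairing:
  assumes "f \<in> Arr C" "g \<in> Arr C" "Dom C f = Dom C g"
  shows "pairing C S f g \<in> Hom C (Dom C f) (Prod S (Cod C f) (Cod C g)) \<and>
    Fst S (Cod C f) (Cod C g) \<cdot>\<^bsub>C\<^esub> pairing C S f g = f \<and>
    Snd S (Cod C f) (Cod C g) \<cdot>\<^bsub>C\<^esub> pairing C S f g = g"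
  unfolding pairing_def
  by (rule theI', rule Prod_universal) (use assms in \<open>simp_all add: Hom_iff\<close>)

lemma pairing_simps [simp]:
  assumes "f \<in> Arr C" "g \<in> Arr C" "Dom C f = Dom C g"
  shows "pairing C S f g \<in> Arr C" "Dom C (pairing C S f g) = Dom C g"
    "Cod C (pairing C S f g) = Prod S (Cod C f) (Cod C g)"
  using pairing[OF assms] assms by (simp_all add: Hom_iff)

lemma Fst_pairing [simp]:
  "\<lbrakk>f \<in> Arr C; g \<in> Arr C; Dom C f = Dom C g; a = Cod C f; b = Cod C g\<rbrakk>
    \<Longrightarrow> Fst S a b \<cdot>\<^bsub>C\<^esub> pairing C S f g = f"
  using pairing by simp

lemma Snd_pairing [simp]:
  "\<lbrakk>f \<in> Arr C; g \<in> Arr C; Dom C f = Dom C g; a = Cod C f; b = Cod C g\<rbrakk>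
    \<Longrightarrow> Snd S a b \<cdot>\<^bsub>C\<^esub> pairing C S f g = g"
  using pairing by simp

lemma product_ext:
  assumes "h \<in> Arr C" "h' \<in> Arr C" "Dom C h = Dom C h'" "Cod C h = Prod S a b" "Cod C h' = Prod S a b"
    "a \<in> Obj C" "b \<in> Obj C"
    "Fst S a b \<cdot>\<^bsub>C\<^esub> h = Fst S a b \<cdot>\<^bsub>C\<^esub> h'" "Snd S a b \<cdot>\<^bsub>C\<^esub> h = Snd S a b \<cdot>\<^bsub>C\<^esub> h'"
  shows "h = h'"
  using Prod_universal[of a b "Fst S a b \<cdot>\<^bsub>C\<^esub> h" "Dom C h" "Snd S a b \<cdot>\<^bsub>C\<^esub> h"] assms
  by (auto simp: Hom_iff)

lemma pairing_unique:
  assumes "h \<in> Arr C" "Cod C h = Prod S a b" "a \<in> Obj C" "b \<in> Obj C"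
    "Fst S a b \<cdot>\<^bsub>C\<^esub> h = f" "Snd S a b \<cdot>\<^bsub>C\<^esub> h = g"
  shows "pairing C S f g = h"
  by (rule product_ext[of _ _ a b]) (use assms in auto)

lemma pairing_Comp:
  assumes "f \<in> Arr C" "g \<in> Arr C" "Dom C f = Dom C g" "h \<in> Arr C" "Cod C h = Dom C g"
  shows "pairing C S f g \<cdot>\<^bsub>C\<^esub> h = pairing C S (f \<cdot>\<^bsub>C\<^esub> h) (g \<cdot>\<^bsub>C\<^esub> h)"
  by (rule product_ext[of _ _ "Cod C f" "Cod C g"]) (use assms in \<open>simp_all add: assoc[symmetric]\<close>)

lemma pairing_Fst_Snd [simp]:
  "\<lbrakk>a \<in> Obj C; b \<in> Obj C\<rbrakk> \<Longrightarrow> pairing C S (Fst S a b) (Snd S a b) = Ide C (Prod S a b)"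
  by (rule pairing_unique[of _ a b]) auto

lemma prod_arr_simps [simp]:
  assumes "f \<in> Arr C" "g \<in> Arr C"
  shows "prod_arr C S f g \<in> Arr C" "Dom C (prod_arr C S f g) = Prod S (Dom C f) (Dom C g)"
    "Cod C (prod_arr C S f g) = Prod S (Cod C f) (Cod C g)"
  using assms by (simp_all add: prod_arr_def)

lemma prod_arr_pairing:
  assumes "f \<in> Arr C" "g \<in> Arr C" "p \<in> Arr C" "q \<in> Arr C"
    "Dom C p = Dom C q" "Cod C p = Dom C f" "Cod C q = Dom C g"
  shows "prod_arr C S f g \<cdot>\<^bsub>C\<^esub> pairing C S p q = pairing C S (f \<cdot>\<^bsub>C\<^esub> p) (g \<cdot>\<^bsub>C\<^esub> q)"
  using assms by (simp add: prod_arr_def pairing_Comp assoc)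

lemma prod_arr_Comp:
  assumes "f \<in> Arr C" "g \<in> Arr C" "f' \<in> Arr C" "g' \<in> Arr C"
    "Dom C f' = Cod C f" "Dom C g' = Cod C g"
  shows "prod_arr C S f' g' \<cdot>\<^bsub>C\<^esub> prod_arr C S f g = prod_arr C S (f' \<cdot>\<^bsub>C\<^esub> f) (g' \<cdot>\<^bsub>C\<^esub> g)"
  unfolding prod_arr_def[of _ _ f g] using assms
  by (simp add: prod_arr_pairing) (simp add: prod_arr_def assoc)

lemma prod_arr_Ide [simp]:
  "\<lbrakk>a \<in> Obj C; b \<in> Obj C\<rbrakk> \<Longrightarrow> prod_arr C S (Ide C a) (Ide C b) = Ide C (Prod S a b)"
  by (simp add: prod_arr_def)

lemma Fst_prod_arr [simp]:
  "\<lbrakk>f \<in> Arr C; g \<in> Arr C; a = Cod C f; b = Cod C g\<rbrakk>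
    \<Longrightarrow> Fst S a b \<cdot>\<^bsub>C\<^esub> prod_arr C S f g = f \<cdot>\<^bsub>C\<^esub> Fst S (Dom C f) (Dom C g)"
  by (simp add: prod_arr_def)

lemma Snd_prod_arr [simp]:
  "\<lbrakk>f \<in> Arr C; g \<in> Arr C; a = Cod C f; b = Cod C g\<rbrakk>
    \<Longrightarrow> Snd S a b \<cdot>\<^bsub>C\<^esub> prod_arr C S f g = g \<cdot>\<^bsub>C\<^esub> Snd S (Dom C f) (Dom C g)"
  by (simp add: prod_arr_def)

lemma to_one_simps [simp]:
  assumes "a \<in> Obj C"
  shows "to_one C S a \<in> Arr C" "Dom C (to_one C S a) = a" "Cod C (to_one C S a) = One S"
  using theI'[OF One_terminal[OF assms]] by (simp_all add: to_one_def Hom_iff)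

lemma to_one_unique: "\<lbrakk>f \<in> Arr C; Cod C f = One S\<rbrakk> \<Longrightarrow> f = to_one C S (Dom C f)"
  using One_terminal[of "Dom C f"] to_one_simps[of "Dom C f"] by (auto simp: Hom_iff)

end

locale product_functor = cat_functor A B F + A: finite_products A SA + B: finite_products B SB
  for A :: "('o1, 'm1) cat" and SA :: "('o1, 'm1) products" and B :: "('o2, 'm2) cat"
    and SB :: "('o2, 'm2) products" and F :: "('o1, 'm1, 'o2, 'm2) func" +
  assumes strict: "strictly_preserves_products A SA SB F"
begin

lemma products_simps [simp]:
  "fob F (One SA) = One SB"
  "\<lbrakk>x \<in> Obj A; y \<in> Obj A\<rbrakk> \<Longrightarrow> fob F (Prod SA x y) = Prod SB (fob F x) (fob F y)"
  "\<lbrakk>x \<in> Obj A; y \<in> Obj A\<rbrakk> \<Longrightarrow> far F (Fst SA x y) = Fst SB (fob F x) (fob F y)"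
  "\<lbrakk>x \<in> Obj A; y \<in> Obj A\<rbrakk> \<Longrightarrow> far F (Snd SA x y) = Snd SB (fob F x) (fob F y)"
  using strict by (simp_all add: strictly_preserves_products_def)

lemma far_pairing [simp]:
  assumes "f \<in> Arr A" "g \<in> Arr A" "Dom A f = Dom A g"
  shows "far F (pairing A SA f g) = pairing B SB (far F f) (far F g)"
proof (rule B.pairing_unique[symmetric, of _ "fob F (Cod A f)" "fob F (Cod A g)"])
  let ?F = "Fst SA (Cod A f) (Cod A g)" and ?S = "Snd SA (Cod A f) (Cod A g)"
  show "Fst SB (fob F (Cod A f)) (fob F (Cod A g)) \<cdot>\<^bsub>B\<^esub> far F (pairing A SA f g) = far F f"
    using far_Comp'[of "pairing A SA f g" ?F, symmetric] assms by simp
  show "Snd SB (fob F (Cod A f)) (fob F (Cod A g)) \<cdot>\<^bsub>B\<^esub> far F (pairing A SA f g) = far F g"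
    using far_Comp'[of "pairing A SA f g" ?S, symmetric] assms by simp
qed (use assms in simp_all)

lemma far_prod_arr [simp]:
  "\<lbrakk>f \<in> Arr A; g \<in> Arr A\<rbrakk> \<Longrightarrow> far F (prod_arr A SA f g) = prod_arr B SB (far F f) (far F g)"
  by (simp add: prod_arr_def)

lemma far_to_one [simp]: "x \<in> Obj A \<Longrightarrow> far F (to_one A SA x) = to_one B SB (fob F x)"
  using B.to_one_unique[of "far F (to_one A SA x)"] by simp

end

text \<open>When \<open>\<Sigma>\<close> is stable under products with objects, products descend to the category of
  fractions.\<close>

locale product_fractions = fractions X \<Sigma> Q L + X: finite_products X SX
  for X :: "('o, 'm::infinite) cat" and \<Sigma> Q L and SX :: "('o, 'm) products" +
  assumes \<Sigma>_times_Ide: "\<lbrakk>s \<in> \<Sigma>; a \<in> Obj X\<rbrakk> \<Longrightarrow> prod_arr X SX s (Ide X a) \<in> \<Sigma>"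
    and Ide_times_\<Sigma>: "\<lbrakk>s \<in> \<Sigma>; a \<in> Obj X\<rbrakk> \<Longrightarrow> prod_arr X SX (Ide X a) s \<in> \<Sigma>"
begin

definition SQ :: "('o, 'm) products" where
  "SQ = \<lparr>One = fob L (One SX), Prod = \<lambda>a b. fob L (Prod SX (obj a) (obj b)),
     Fst = \<lambda>a b. far L (Fst SX (obj a) (obj b)), Snd = \<lambda>a b. far L (Snd SX (obj a) (obj b))\<rparr>"

lemma SQ_L:
  assumes "x \<in> Obj X" "y \<in> Obj X"
  shows "fob L (Prod SX x y) = Prod SQ (fob L x) (fob L y)"
    "far L (Fst SX x y) = Fst SQ (fob L x) (fob L y)" "far L (Snd SX x y) = Snd SQ (fob L x) (fob L y)"
  using assms by (simp_all add: SQ_def)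

lemma strict_L: "strictly_preserves_products X SX SQ L"
  using SQ_L by (simp add: strictly_preserves_products_def) (simp add: SQ_def)

lemma SQ_simps [simp]:
  assumes "a \<in> Obj Q" "b \<in> Obj Q"
  shows "Prod SQ a b \<in> Obj Q"
    "Fst SQ a b \<in> Arr Q" "Dom Q (Fst SQ a b) = Prod SQ a b" "Cod Q (Fst SQ a b) = a"
    "Snd SQ a b \<in> Arr Q" "Dom Q (Snd SQ a b) = Prod SQ a b" "Cod Q (Snd SQ a b) = b"
  using assms by (simp_all add: SQ_def)

lemma ex_times_right:
  assumes "a \<in> Obj Q"
  shows "\<exists>G. cat_functor Q Q G \<and> (\<forall>x \<in> Obj X. fob G (fob L x) = fob L (Prod SX x (obj a))) \<and>
    (\<forall>h \<in> Arr X. far G (far L h) = far L (prod_arr X SX h (Ide X (obj a))))"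
proof -
  let ?F = "\<lparr>fob = \<lambda>x. fob L (Prod SX x (obj a)), far = \<lambda>h. far L (prod_arr X SX h (Ide X (obj a)))\<rparr>"
  have F: "cat_functor X Q ?F"
    by (rule cat_functorI[OF L.A.category_axioms L.B.category_axioms])
      (use assms in \<open>auto simp: X.prod_arr_Comp simp flip: L.far_Comp'\<close>)
  moreover have "inverts ?F \<Sigma> Q"
    using assms \<Sigma>_times_Ide L_iso by (simp add: inverts_def)
  ultimately show ?thesis by (rule extension) auto
qed

lemma ex_times_left:
  assumes "a \<in> Obj Q"
  shows "\<exists>G. cat_functor Q Q G \<and> (\<forall>x \<in> Obj X. fob G (fob L x) = fob L (Prod SX (obj a) x)) \<and>
    (\<forall>h \<in> Arr X. far G (far L h) = far L (prod_arr X SX (Ide X (obj a)) h))"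
proof -
  let ?F = "\<lparr>fob = \<lambda>x. fob L (Prod SX (obj a) x), far = \<lambda>h. far L (prod_arr X SX (Ide X (obj a)) h)\<rparr>"
  have F: "cat_functor X Q ?F"
    by (rule cat_functorI[OF L.A.category_axioms L.B.category_axioms])
      (use assms in \<open>auto simp: X.prod_arr_Comp simp flip: L.far_Comp'\<close>)
  moreover have "inverts ?F \<Sigma> Q"
    using assms Ide_times_\<Sigma> L_iso by (simp add: inverts_def)
  ultimately show ?thesis by (rule extension) auto
qed

text \<open>The functors \<open>- \<times> a\<close> and \<open>a \<times> -\<close> on \<open>Q\<close>. They are kept apart because the universal property
  extends one variable at a time; \<open>interchange\<close> joins them to a functor of two variables.\<close>

definition times_right :: "'o \<Rightarrow> ('o, 'm, 'o, 'm) func" where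
  "times_right a = (SOME G. cat_functor Q Q G \<and> (\<forall>x \<in> Obj X. fob G (fob L x) = fob L (Prod SX x (obj a))) \<and>
    (\<forall>h \<in> Arr X. far G (far L h) = far L (prod_arr X SX h (Ide X (obj a)))))"

definition times_left :: "'o \<Rightarrow> ('o, 'm, 'o, 'm) func" where
  "times_left a = (SOME G. cat_functor Q Q G \<and> (\<forall>x \<in> Obj X. fob G (fob L x) = fob L (Prod SX (obj a) x)) \<and>
    (\<forall>h \<in> Arr X. far G (far L h) = far L (prod_arr X SX (Ide X (obj a)) h)))"

lemma times_right:
  assumes "a \<in> Obj Q"
  shows "cat_functor Q Q (times_right a)" "b \<in> Obj Q \<Longrightarrow> fob (times_right a) b = Prod SQ b a"
    "h \<in> Arr X \<Longrightarrow> far (times_right a) (far L h) = far L (prod_arr X SX h (Ide X (obj a)))"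
proof -
  note t = someI_ex[OF ex_times_right[OF assms], folded times_right_def]
  show "cat_functor Q Q (times_right a)" using t by blast
  show "b \<in> Obj Q \<Longrightarrow> fob (times_right a) b = Prod SQ b a"
    using t obj_Obj[of b] L_obj[of b] unfolding SQ_def by (metis products.select_convs(2))
  show "h \<in> Arr X \<Longrightarrow> far (times_right a) (far L h) = far L (prod_arr X SX h (Ide X (obj a)))"
    using t by blast
qed

lemma times_left:
  assumes "a \<in> Obj Q"
  shows "cat_functor Q Q (times_left a)" "b \<in> Obj Q \<Longrightarrow> fob (times_left a) b = Prod SQ a b"
    "h \<in> Arr X \<Longrightarrow> far (times_left a) (far L h) = far L (prod_arr X SX (Ide X (obj a)) h)"
proof -
  note t = someI_ex[OF ex_times_left[OF assms], folded times_left_def]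
  show "cat_functor Q Q (times_left a)" using t by blast
  show "b \<in> Obj Q \<Longrightarrow> fob (times_left a) b = Prod SQ a b"
    using t obj_Obj[of b] L_obj[of b] unfolding SQ_def by (metis products.select_convs(2))
  show "h \<in> Arr X \<Longrightarrow> far (times_left a) (far L h) = far L (prod_arr X SX (Ide X (obj a)) h)"
    using t by blast
qed

lemma times_simps [simp]:
  assumes "a \<in> Obj Q" "f \<in> Arr Q"
  shows "far (times_right a) f \<in> Arr Q" "Dom Q (far (times_right a) f) = Prod SQ (Dom Q f) a"
    "Cod Q (far (times_right a) f) = Prod SQ (Cod Q f) a"
    "far (times_left a) f \<in> Arr Q" "Dom Q (far (times_left a) f) = Prod SQ a (Dom Q f)"
    "Cod Q (far (times_left a) f) = Prod SQ a (Cod Q f)"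
  using cat_functor.far_simps[OF times_right(1)[OF assms(1)] assms(2)]
    cat_functor.far_simps[OF times_left(1)[OF assms(1)] assms(2)] assms
  by (simp_all add: times_right(2) times_left(2))

lemma times_Comp:
  assumes "a \<in> Obj Q" "f \<in> Arr Q" "g \<in> Arr Q" "Dom Q g = Cod Q f"
  shows "far (times_right a) (g \<cdot>\<^bsub>Q\<^esub> f) = far (times_right a) g \<cdot>\<^bsub>Q\<^esub> far (times_right a) f"
    "far (times_left a) (g \<cdot>\<^bsub>Q\<^esub> f) = far (times_left a) g \<cdot>\<^bsub>Q\<^esub> far (times_left a) f"
  using cat_functor.far_Comp'[OF times_right(1)[OF assms(1)]] cat_functor.far_Comp'[OF times_left(1)[OF assms(1)]] assms
  by simp_all

lemma cat_functor_const: "b \<in> Obj Q \<Longrightarrow> cat_functor Q Q \<lparr>fob = \<lambda>_. b, far = \<lambda>_. Ide Q b\<rparr>"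
  by (rule cat_functorI[OF L.B.category_axioms L.B.category_axioms]) auto

lemma projections_natural:
  assumes "f \<in> Arr Q" "a \<in> Obj Q"
  shows "Fst SQ (Cod Q f) a \<cdot>\<^bsub>Q\<^esub> far (times_right a) f = f \<cdot>\<^bsub>Q\<^esub> Fst SQ (Dom Q f) a"
    and "Snd SQ (Cod Q f) a \<cdot>\<^bsub>Q\<^esub> far (times_right a) f = Snd SQ (Dom Q f) a"
    and "Fst SQ a (Cod Q f) \<cdot>\<^bsub>Q\<^esub> far (times_left a) f = Fst SQ a (Dom Q f)"
    and "Snd SQ a (Cod Q f) \<cdot>\<^bsub>Q\<^esub> far (times_left a) f = f \<cdot>\<^bsub>Q\<^esub> Snd SQ a (Dom Q f)"
proof -
  note id = cat_functor_id[OF L.B.category_axioms] and const = cat_functor_const[OF assms(2)]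
  have L: "Fst SQ (fob L x) a = far L (Fst SX x (obj a))" "Snd SQ (fob L x) a = far L (Snd SX x (obj a))"
    "Fst SQ a (fob L x) = far L (Fst SX (obj a) x)" "Snd SQ a (fob L x) = far L (Snd SX (obj a) x)"
    if "x \<in> Obj X" for x
    using that by (simp_all add: SQ_def)
  show "Fst SQ (Cod Q f) a \<cdot>\<^bsub>Q\<^esub> far (times_right a) f = f \<cdot>\<^bsub>Q\<^esub> Fst SQ (Dom Q f) a"
    using natural_extension[OF times_right(1)[OF assms(2)] id, of "\<lambda>b. Fst SQ b a" f] assms
    by (simp add: L times_right Hom_iff flip: L.far_Comp')
  show "Snd SQ (Cod Q f) a \<cdot>\<^bsub>Q\<^esub> far (times_right a) f = Snd SQ (Dom Q f) a"
    using natural_extension[OF times_right(1)[OF assms(2)] const, of "\<lambda>b. Snd SQ b a" f] assms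
    by (simp add: L times_right Hom_iff flip: L.far_Comp')
  show "Fst SQ a (Cod Q f) \<cdot>\<^bsub>Q\<^esub> far (times_left a) f = Fst SQ a (Dom Q f)"
    using natural_extension[OF times_left(1)[OF assms(2)] const, of "\<lambda>b. Fst SQ a b" f] assms
    by (simp add: L times_left Hom_iff flip: L.far_Comp')
  show "Snd SQ a (Cod Q f) \<cdot>\<^bsub>Q\<^esub> far (times_left a) f = f \<cdot>\<^bsub>Q\<^esub> Snd SQ a (Dom Q f)"
    using natural_extension[OF times_left(1)[OF assms(2)] id, of "\<lambda>b. Snd SQ a b" f] assms
    by (simp add: L times_left Hom_iff flip: L.far_Comp')
qed

text \<open>For \<open>f = L h\<close> this is naturality in \<open>g\<close> of \<open>h \<times> -\<close>; then, for fixed \<open>g\<close>, it is naturality in \<open>f\<close> of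
  \<open>- \<times> g\<close>.\<close>

lemma interchange:
  assumes f: "f \<in> Arr Q" and g: "g \<in> Arr Q"
  shows "far (times_left (Cod Q f)) g \<cdot>\<^bsub>Q\<^esub> far (times_right (Dom Q g)) f
    = far (times_right (Cod Q g)) f \<cdot>\<^bsub>Q\<^esub> far (times_left (Dom Q f)) g"
proof -
  have L: "far (times_right (Cod Q g)) (far L h) \<cdot>\<^bsub>Q\<^esub> far (times_left (fob L (Dom X h))) g
    = far (times_left (fob L (Cod X h))) g \<cdot>\<^bsub>Q\<^esub> far (times_right (Dom Q g)) (far L h)" if h: "h \<in> Arr X" for h
    using natural_extension[of Q "times_left (fob L (Dom X h))" "times_left (fob L (Cod X h))"
        "\<lambda>a. far (times_right a) (far L h)" g] h g
    by (simp add: SQ_L(1) times_left times_right Hom_iff X.prod_arr_Comp flip: L.far_Comp')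
  show ?thesis
    using natural_extension[of Q "times_right (Dom Q g)" "times_right (Cod Q g)" "\<lambda>a. far (times_left a) g" f] f g L
    by (simp add: times_left times_right Hom_iff)
qed

definition diag :: "'o \<Rightarrow> 'm" where
  "diag a = far L (pairing X SX (Ide X (obj a)) (Ide X (obj a)))"

lemma diag_simps [simp]:
  assumes "a \<in> Obj Q"
  shows "diag a \<in> Arr Q" "Dom Q (diag a) = a" "Cod Q (diag a) = Prod SQ a a"
  using assms by (simp_all add: diag_def SQ_def)

text \<open>By interchange, \<open>f \<mapsto> f \<times> f\<close> is a functor on \<open>Q\<close>, and the diagonal is natural.\<close>

lemma diag_natural:
  assumes f: "f \<in> Arr Q"
  shows "diag (Cod Q f) \<cdot>\<^bsub>Q\<^esub> f
    = far (times_left (Cod Q f)) f \<cdot>\<^bsub>Q\<^esub> (far (times_right (Dom Q f)) f \<cdot>\<^bsub>Q\<^esub> diag (Dom Q f))"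
proof -
  let ?D = "\<lparr>fob = \<lambda>a. Prod SQ a a,
    far = \<lambda>f. far (times_left (Cod Q f)) f \<cdot>\<^bsub>Q\<^esub> far (times_right (Dom Q f)) f\<rparr>"
  have D: "cat_functor Q Q ?D"
  proof (rule cat_functorI[OF L.B.category_axioms L.B.category_axioms])
    fix f g assume fg: "f \<in> Arr Q" "g \<in> Arr Q" "Dom Q g = Cod Q f"
    let ?a = "Dom Q f" and ?b = "Cod Q f" and ?c = "Cod Q g"
    have "far ?D (g \<cdot>\<^bsub>Q\<^esub> f) = far (times_left ?c) g \<cdot>\<^bsub>Q\<^esub>
      ((far (times_left ?c) f \<cdot>\<^bsub>Q\<^esub> far (times_right ?a) g) \<cdot>\<^bsub>Q\<^esub> far (times_right ?a) f)"
      using fg by (simp add: times_Comp L.B.assoc)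
    also have "\<dots> = far (times_left ?c) g \<cdot>\<^bsub>Q\<^esub>
      ((far (times_right ?b) g \<cdot>\<^bsub>Q\<^esub> far (times_left ?b) f) \<cdot>\<^bsub>Q\<^esub> far (times_right ?a) f)"
      using interchange[OF fg(2) fg(1)] fg by simp
    also have "\<dots> = far ?D g \<cdot>\<^bsub>Q\<^esub> far ?D f" using fg by (simp add: L.B.assoc)
    finally show "far ?D (g \<cdot>\<^bsub>Q\<^esub> f) = far ?D g \<cdot>\<^bsub>Q\<^esub> far ?D f" .
  next
    fix a assume a: "a \<in> Obj Q"
    have "far (times_right a) (Ide Q a) = Ide Q (Prod SQ a a)" "far (times_left a) (Ide Q a) = Ide Q (Prod SQ a a)"
      using cat_functor.far_Ide'[OF times_right(1)[OF a] a] cat_functor.far_Ide'[OF times_left(1)[OF a] a] a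
      by (simp_all add: times_right times_left)
    then show "far ?D (Ide Q a) = Ide Q (fob ?D a)" using a by simp
  qed auto
  show ?thesis
    using natural_extension[OF cat_functor_id[OF L.B.category_axioms] D, of diag f] f
    by (simp add: SQ_L(1) Hom_iff diag_def times_right times_left X.prod_arr_Comp X.prod_arr_pairing X.pairing_Comp
        L.B.assoc flip: L.far_Comp')
qed

text \<open>The pairing of \<open>f\<close> and \<open>g\<close> is \<open>(f \<times> g) \<cdot> \<Delta>\<close>; its components are computed from naturality of the
  projections. It is unique since any \<open>h\<close> into \<open>a \<times> b\<close> satisfies
  \<open>((Fst \<cdot> h) \<times> (Snd \<cdot> h)) \<cdot> \<Delta> = (Fst \<times> Snd) \<cdot> (h \<times> h) \<cdot> \<Delta> = (Fst \<times> Snd) \<cdot> \<Delta> \<cdot> h = h\<close>.\<close>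

lemma finite_products_fractions: "finite_products Q SQ"
proof
  show "One SQ \<in> Obj Q" by (simp add: SQ_def)
  have one: "One SQ = fob L (One SX)" by (simp add: SQ_def)
  show "\<exists>!h. h \<in> Hom Q a (One SQ)" if a: "a \<in> Obj Q" for a
  proof
    let ?t = "\<lambda>a. far L (to_one X SX (obj a))"
    show "?t a \<in> Hom Q a (One SQ)" using a by (simp add: Hom_iff one)
    fix h assume h: "h \<in> Hom Q a (One SQ)"
    have L: "to_one X SX (Cod X k) \<cdot>\<^bsub>X\<^esub> k = to_one X SX (Dom X k)" if "k \<in> Arr X" for k
      using X.to_one_unique[of "to_one X SX (Cod X k) \<cdot>\<^bsub>X\<^esub> k"] that by simp
    have "?t (Cod Q h) \<cdot>\<^bsub>Q\<^esub> h = ?t (Dom Q h)"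
      using natural_extension[OF cat_functor_id[OF L.B.category_axioms]
          cat_functor_const[of "One SQ"], of ?t h] h
      by (simp add: Hom_iff one L flip: L.far_Comp')
    moreover have "?t (One SQ) = Ide Q (One SQ)"
      using X.to_one_unique[of "Ide X (One SX)", symmetric] by (simp add: one)
    ultimately show "h = ?t a" using h by (simp add: Hom_iff)
  qed
  show "a \<in> Obj Q \<Longrightarrow> b \<in> Obj Q \<Longrightarrow> Prod SQ a b \<in> Obj Q"
    "a \<in> Obj Q \<Longrightarrow> b \<in> Obj Q \<Longrightarrow> Fst SQ a b \<in> Hom Q (Prod SQ a b) a"
    "a \<in> Obj Q \<Longrightarrow> b \<in> Obj Q \<Longrightarrow> Snd SQ a b \<in> Hom Q (Prod SQ a b) b" for a b
    by (simp_all add: Hom_iff)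
  fix a b c f g
  assume ab: "a \<in> Obj Q" "b \<in> Obj Q" and "f \<in> Hom Q c a" "g \<in> Hom Q c b"
  then have fg: "f \<in> Arr Q" "g \<in> Arr Q" "Dom Q f = c" "Dom Q g = c" "Cod Q f = a" "Cod Q g = b"
    "c \<in> Obj Q" by (auto simp: Hom_iff)
  define pair where "pair f g = far (times_left (Cod Q f)) g \<cdot>\<^bsub>Q\<^esub> (far (times_right (Dom Q f)) f \<cdot>\<^bsub>Q\<^esub> diag (Dom Q f))" for f g
  have diag: "Fst SQ c c \<cdot>\<^bsub>Q\<^esub> diag c = Ide Q c" "Snd SQ c c \<cdot>\<^bsub>Q\<^esub> diag c = Ide Q c"
    using fg(7) by (simp_all add: SQ_def diag_def flip: L.far_Comp')
  show "\<exists>!h. h \<in> Hom Q c (Prod SQ a b) \<and> Fst SQ a b \<cdot>\<^bsub>Q\<^esub> h = f \<and> Snd SQ a b \<cdot>\<^bsub>Q\<^esub> h = g"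
  proof
    have "Fst SQ a b \<cdot>\<^bsub>Q\<^esub> pair f g
      = (Fst SQ a b \<cdot>\<^bsub>Q\<^esub> far (times_left a) g) \<cdot>\<^bsub>Q\<^esub> (far (times_right c) f \<cdot>\<^bsub>Q\<^esub> diag c)"
      using fg ab by (simp add: pair_def L.B.assoc)
    also have "\<dots> = (Fst SQ a c \<cdot>\<^bsub>Q\<^esub> far (times_right c) f) \<cdot>\<^bsub>Q\<^esub> diag c"
      using projections_natural(3)[of g a] fg ab by (simp add: L.B.assoc)
    also have "\<dots> = f"
      using projections_natural(1)[of f c] fg ab by (simp add: L.B.assoc diag)
    finally have 1: "Fst SQ a b \<cdot>\<^bsub>Q\<^esub> pair f g = f" .
    have "Snd SQ a b \<cdot>\<^bsub>Q\<^esub> pair f g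
      = (Snd SQ a b \<cdot>\<^bsub>Q\<^esub> far (times_left a) g) \<cdot>\<^bsub>Q\<^esub> (far (times_right c) f \<cdot>\<^bsub>Q\<^esub> diag c)"
      using fg ab by (simp add: pair_def L.B.assoc)
    also have "\<dots> = g \<cdot>\<^bsub>Q\<^esub> ((Snd SQ a c \<cdot>\<^bsub>Q\<^esub> far (times_right c) f) \<cdot>\<^bsub>Q\<^esub> diag c)"
      using projections_natural(4)[of g a] fg ab by (simp add: L.B.assoc)
    also have "\<dots> = g"
      using projections_natural(2)[of f c] fg ab by (simp add: diag)
    finally have 2: "Snd SQ a b \<cdot>\<^bsub>Q\<^esub> pair f g = g" .
    show "pair f g \<in> Hom Q c (Prod SQ a b) \<and> Fst SQ a b \<cdot>\<^bsub>Q\<^esub> pair f g = f \<and>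
        Snd SQ a b \<cdot>\<^bsub>Q\<^esub> pair f g = g"
      using 1 2 fg ab by (simp add: pair_def Hom_iff)
  next
    fix h assume "h \<in> Hom Q c (Prod SQ a b) \<and> Fst SQ a b \<cdot>\<^bsub>Q\<^esub> h = f \<and> Snd SQ a b \<cdot>\<^bsub>Q\<^esub> h = g"
    then have h: "h \<in> Arr Q" "Dom Q h = c" "Cod Q h = Prod SQ a b"
      and f: "f = Fst SQ a b \<cdot>\<^bsub>Q\<^esub> h" and g: "g = Snd SQ a b \<cdot>\<^bsub>Q\<^esub> h"
      by (auto simp: Hom_iff)
    let ?p = "Prod SQ a b"
    have "pair f g = far (times_left a) (Snd SQ a b) \<cdot>\<^bsub>Q\<^esub> ((far (times_left a) h \<cdot>\<^bsub>Q\<^esub>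
      far (times_right c) (Fst SQ a b)) \<cdot>\<^bsub>Q\<^esub> (far (times_right c) h \<cdot>\<^bsub>Q\<^esub> diag c))"
      unfolding pair_def using h ab fg(7)
      by (simp add: f g times_Comp L.B.assoc)
    also have "far (times_left a) h \<cdot>\<^bsub>Q\<^esub> far (times_right c) (Fst SQ a b)
      = far (times_right ?p) (Fst SQ a b) \<cdot>\<^bsub>Q\<^esub> far (times_left ?p) h"
      using interchange[of "Fst SQ a b" h] h ab by simp
    also have "far (times_left a) (Snd SQ a b) \<cdot>\<^bsub>Q\<^esub> ((far (times_right ?p) (Fst SQ a b) \<cdot>\<^bsub>Q\<^esub> far (times_left ?p) h)
        \<cdot>\<^bsub>Q\<^esub> (far (times_right c) h \<cdot>\<^bsub>Q\<^esub> diag c))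
      = far (times_left a) (Snd SQ a b) \<cdot>\<^bsub>Q\<^esub> (far (times_right ?p) (Fst SQ a b) \<cdot>\<^bsub>Q\<^esub>
         (far (times_left ?p) h \<cdot>\<^bsub>Q\<^esub> (far (times_right c) h \<cdot>\<^bsub>Q\<^esub> diag c)))"
      using h ab fg(7) by (simp add: L.B.assoc)
    also have "far (times_left ?p) h \<cdot>\<^bsub>Q\<^esub> (far (times_right c) h \<cdot>\<^bsub>Q\<^esub> diag c) = diag ?p \<cdot>\<^bsub>Q\<^esub> h"
      using diag_natural[OF h(1)] h by simp
    also have "far (times_left a) (Snd SQ a b) \<cdot>\<^bsub>Q\<^esub> (far (times_right ?p) (Fst SQ a b) \<cdot>\<^bsub>Q\<^esub> (diag ?p \<cdot>\<^bsub>Q\<^esub> h))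
      = (far (times_left a) (Snd SQ a b) \<cdot>\<^bsub>Q\<^esub> (far (times_right ?p) (Fst SQ a b) \<cdot>\<^bsub>Q\<^esub> diag ?p)) \<cdot>\<^bsub>Q\<^esub> h"
      using h ab by (simp add: L.B.assoc)
    also have "far (times_left a) (Snd SQ a b) \<cdot>\<^bsub>Q\<^esub> (far (times_right ?p) (Fst SQ a b) \<cdot>\<^bsub>Q\<^esub> diag ?p) = Ide Q ?p"
      using ab by (simp add: SQ_def diag_def times_right times_left X.prod_arr_Comp X.prod_arr_pairing flip: L.far_Comp')
    finally show "h = pair f g" using h by simp
  qed
qed

end

section \<open>Cocartesian arrows and groupoidal fibres\<close>

lemma cocartesian_Arr: "cocartesian X B P u \<Longrightarrow> u \<in> Arr X"
  by (simp add: cocartesian_def)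

context cat_functor begin

lemma induced:
  assumes c: "cocartesian A B F c" and d: "d \<in> Arr A" "Dom A d = Dom A c" "far F d = far F c"
  shows "induced A B F c d \<in> Arr A" "Dom A (induced A B F c d) = Cod A c"
    "Cod A (induced A B F c d) = Cod A d" "far F (induced A B F c d) = Ide B (fob F (Cod A c))"
    "induced A B F c d \<cdot>\<^bsub>A\<^esub> c = d"
proof -
  have c': "c \<in> Arr A" using c by (simp add: cocartesian_def)
  have "fob F (Cod A d) = fob F (Cod A c)"
    using far_simps(3)[OF d(1)] far_simps(3)[OF c'] d(3) by simp
  then have "\<exists>!w. w \<in> Hom A (Cod A c) (Cod A d) \<and> far F w = Ide B (fob F (Cod A c)) \<and> w \<cdot>\<^bsub>A\<^esub> c = d"
    using c c' d unfolding cocartesian_def by (simp add: Hom_iff)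
  from theI'[OF this, folded induced_def]
  show "induced A B F c d \<in> Arr A" "Dom A (induced A B F c d) = Cod A c"
    "Cod A (induced A B F c d) = Cod A d" "far F (induced A B F c d) = Ide B (fob F (Cod A c))"
    "induced A B F c d \<cdot>\<^bsub>A\<^esub> c = d"
    by (simp_all add: Hom_iff)
qed

lemma cocartesian_ext:
  assumes c: "cocartesian A B F c" and w: "w \<in> Arr A" "w' \<in> Arr A" "Dom A w = Cod A c"
    "Dom A w' = Cod A c" "Cod A w = Cod A w'" "far F w = far F w'" "w \<cdot>\<^bsub>A\<^esub> c = w' \<cdot>\<^bsub>A\<^esub> c"
  shows "w = w'"
proof -
  have c': "c \<in> Arr A" using c by (simp add: cocartesian_def)
  have "\<exists>!v. v \<in> Hom A (Cod A c) (Cod A w') \<and> far F v = far F w' \<and> v \<cdot>\<^bsub>A\<^esub> c = w' \<cdot>\<^bsub>A\<^esub> c"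
    using c[unfolded cocartesian_def, THEN conjunct2, rule_format, of "w' \<cdot>\<^bsub>A\<^esub> c" "far F w'"] c' w(1-5)
    by (simp add: Hom_iff)
  then show ?thesis using w by (auto simp: Hom_iff)
qed

lemma fibre_simps [simp]:
  "Obj (fibre A B F b) = {x \<in> Obj A. fob F x = b}"
  "Arr (fibre A B F b) = {f \<in> Arr A. far F f = Ide B b}"
  "Dom (fibre A B F b) = Dom A" "Cod (fibre A B F b) = Cod A"
  "Ide (fibre A B F b) = Ide A" "Comp (fibre A B F b) = Comp A"
  by (simp_all add: fibre_def)

lemma vertical_objects:
  assumes "f \<in> Arr A" "far F f = Ide B b" "b \<in> Obj B"
  shows "fob F (Dom A f) = b" "fob F (Cod A f) = b"
  using far_simps(2,3)[OF assms(1)] assms(2,3) by simp_all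

lemma category_fibre:
  assumes "b \<in> Obj B"
  shows "category (fibre A B F b)"
  by unfold_locales (use assms in \<open>auto simp: Hom_iff A.assoc vertical_objects\<close>)

lemma inverse_of_vertical:
  assumes "inverses A f g" "far F f = Ide B b" "b \<in> Obj B"
  shows "far F g = Ide B b"
proof -
  have "far F g \<in> Arr B" "Dom B (far F g) = b" "far F g \<cdot>\<^bsub>B\<^esub> Ide B b = Ide B b"
    using inverses_far[OF assms(1)] assms(2,3) by (simp_all add: inverses_def)
  then show ?thesis by simp
qed

lemma groupoidal_fibres_iff:
  "groupoidal_fibres A B F \<longleftrightarrow> (\<forall>f \<in> vertical A B F. is_iso A f)"
proof
  assume g: "groupoidal_fibres A B F"
  show "\<forall>f \<in> vertical A B F. is_iso A f"
  proof
    fix f assume "f \<in> vertical A B F"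
    then obtain b where f: "f \<in> Arr A" "far F f = Ide B b" "b \<in> Obj B" by (auto simp: vertical_def)
    then interpret groupoid "fibre A B F b" using g by (simp add: groupoidal_fibres_def)
    show "is_iso A f"
      using all_iso[of f] f by (auto simp: is_iso_iff inverses_def)
  qed
next
  assume iso: "\<forall>f \<in> vertical A B F. is_iso A f"
  show "groupoidal_fibres A B F"
    unfolding groupoidal_fibres_def
  proof
    fix b assume b: "b \<in> Obj B"
    interpret category "fibre A B F b" using b by (rule category_fibre)
    show "groupoid (fibre A B F b)"
    proof
      fix f assume "f \<in> Arr (fibre A B F b)"
      then have f: "f \<in> Arr A" "far F f = Ide B b" by simp_all
      then obtain g where g: "inverses A f g" using iso b by (auto simp: vertical_def is_iso_iff)
      then have "far F g = Ide B b" using f(2) b by (rule inverse_of_vertical)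
      with g f show "is_iso (fibre A B F b) f" by (auto simp: is_iso_iff inverses_def)
    qed
  qed
qed

end

section \<open>Inverting the vertical arrows of an opfibration\<close>

locale vertical_fractions = P: opfibration X B P + fractions X "vertical X B P" Q L + P': cat_functor Q B P'
  for X Q :: "('o, 'm::infinite) cat" and B :: "('p, 'n) cat" and P :: "('o, 'm, 'p, 'n) func"
    and L and P' :: "('o, 'm, 'p, 'n) func" +
  assumes P'_L: "func_eq X (func_comp P' L) P"
begin

lemma P'_L_simps [simp]:
  "x \<in> Obj X \<Longrightarrow> fob P' (fob L x) = fob P x" "h \<in> Arr X \<Longrightarrow> far P' (far L h) = far P h"
  using P'_L by (simp_all add: func_eq_def func_comp_def)

lemma P_obj [simp]: "a \<in> Obj Q \<Longrightarrow> fob P (obj a) = fob P' a"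
  using P'_L_simps(1)[of "obj a"] by simp

definition k :: "'n \<Rightarrow> 'o \<Rightarrow> 'm" where "k = (SOME k. cleavage X B P k)"

lemma cleavage_k: "cleavage X B P k"
proof -
  let ?k = "\<lambda>f x. SOME u. cocartesian X B P u \<and> Dom X u = x \<and> far P u = f"
  have "cocartesian X B P (?k f x) \<and> Dom X (?k f x) = x \<and> far P (?k f x) = f"
    if "x \<in> Obj X" "f \<in> Arr B" "Dom B f = fob P x" for x f
    using someI_ex[OF P.cocartesian_lifting[OF that]] .
  then have "cleavage X B P ?k" unfolding cleavage_def by blast
  then show ?thesis unfolding k_def by (rule someI[of "cleavage X B P"])
qed

lemma k_simps [simp]:
  assumes "x \<in> Obj X" "f \<in> Arr B" "Dom B f = fob P x"
  shows "cocartesian X B P (k f x)" "k f x \<in> Arr X" "Dom X (k f x) = x" "far P (k f x) = f"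
    "fob P (Cod X (k f x)) = Cod B f" "Cod X (k f x) \<in> Obj X"
proof -
  show *: "cocartesian X B P (k f x)" "Dom X (k f x) = x" "far P (k f x) = f"
    using cleavage_k assms by (simp_all add: cleavage_def)
  show **: "k f x \<in> Arr X" using *(1) by (simp add: cocartesian_def)
  show "fob P (Cod X (k f x)) = Cod B f" using P.far_simps(3)[OF **] *(3) by simp
  show "Cod X (k f x) \<in> Obj X" using ** by simp
qed

text \<open>For \<open>h : x \<rightarrow> y\<close> and \<open>g\<close> out of \<open>P y\<close>, the vertical arrow \<open>(g \<cdot> P h)\<^sub>* x \<rightarrow> g\<^sub>* y\<close>. For vertical \<open>h\<close> it is
  the value \<open>g\<^sub>* h\<close> of change of base; the factor \<open>P h\<close> extends this functorially to all arrows of \<open>X\<close>.\<close>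

definition push :: "'n \<Rightarrow> 'm \<Rightarrow> 'm" where
  "push g h = induced X B P (k (g \<cdot>\<^bsub>B\<^esub> far P h) (Dom X h)) (k g (Cod X h) \<cdot>\<^bsub>X\<^esub> h)"

lemma push_simps [simp]:
  assumes "h \<in> Arr X" "g \<in> Arr B" "Dom B g = fob P (Cod X h)"
  shows "push g h \<in> Arr X" "Dom X (push g h) = Cod X (k (g \<cdot>\<^bsub>B\<^esub> far P h) (Dom X h))"
    "Cod X (push g h) = Cod X (k g (Cod X h))" "far P (push g h) = Ide B (Cod B g)"
  using P.induced[of "k (g \<cdot>\<^bsub>B\<^esub> far P h) (Dom X h)" "k g (Cod X h) \<cdot>\<^bsub>X\<^esub> h"] assms
  by (simp_all add: push_def)

lemma push_square:
  assumes "h \<in> Arr X" "g \<in> Arr B" "Dom B g = fob P (Cod X h)"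
  shows "push g h \<cdot>\<^bsub>X\<^esub> k (g \<cdot>\<^bsub>B\<^esub> far P h) (Dom X h) = k g (Cod X h) \<cdot>\<^bsub>X\<^esub> h"
  using P.induced(5)[of "k (g \<cdot>\<^bsub>B\<^esub> far P h) (Dom X h)" "k g (Cod X h) \<cdot>\<^bsub>X\<^esub> h"] assms
  by (simp add: push_def)

lemma push_vertical:
  assumes "h \<in> Arr X" "g \<in> Arr B" "Dom B g = fob P (Cod X h)"
  shows "push g h \<in> vertical X B P"
  using assms by (auto simp: vertical_def)

lemma push_Ide:
  assumes "x \<in> Obj X" "g \<in> Arr B" "Dom B g = fob P x"
  shows "push g (Ide X x) = Ide X (Cod X (k g x))"
  by (rule P.cocartesian_ext[of "k g x"]) (use assms push_square[of "Ide X x" g] in simp_all)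

lemma push_Comp:
  assumes "f \<in> Arr X" "h \<in> Arr X" "Dom X h = Cod X f" "g \<in> Arr B" "Dom B g = fob P (Cod X h)"
  shows "push g (h \<cdot>\<^bsub>X\<^esub> f) = push g h \<cdot>\<^bsub>X\<^esub> push (g \<cdot>\<^bsub>B\<^esub> far P h) f"
proof (rule P.cocartesian_ext[of "k (g \<cdot>\<^bsub>B\<^esub> far P (h \<cdot>\<^bsub>X\<^esub> f)) (Dom X f)"])
  let ?k = "k (g \<cdot>\<^bsub>B\<^esub> far P (h \<cdot>\<^bsub>X\<^esub> f)) (Dom X f)"
  have k: "?k = k ((g \<cdot>\<^bsub>B\<^esub> far P h) \<cdot>\<^bsub>B\<^esub> far P f) (Dom X f)"
    using assms by (simp add: P.B.assoc)
  have "(push g h \<cdot>\<^bsub>X\<^esub> push (g \<cdot>\<^bsub>B\<^esub> far P h) f) \<cdot>\<^bsub>X\<^esub> ?k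
    = push g h \<cdot>\<^bsub>X\<^esub> (push (g \<cdot>\<^bsub>B\<^esub> far P h) f \<cdot>\<^bsub>X\<^esub> ?k)"
    using assms by (intro P.A.assoc) (simp_all add: P.B.assoc)
  also have "\<dots> = (push g h \<cdot>\<^bsub>X\<^esub> k (g \<cdot>\<^bsub>B\<^esub> far P h) (Dom X h)) \<cdot>\<^bsub>X\<^esub> f"
    unfolding k using push_square[of f "g \<cdot>\<^bsub>B\<^esub> far P h"] assms by (simp add: P.A.assoc)
  also have "\<dots> = k g (Cod X h) \<cdot>\<^bsub>X\<^esub> (h \<cdot>\<^bsub>X\<^esub> f)"
    using push_square[of h g] assms by (simp add: P.A.assoc)
  also have "\<dots> = push g (h \<cdot>\<^bsub>X\<^esub> f) \<cdot>\<^bsub>X\<^esub> ?k"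
    using push_square[of "h \<cdot>\<^bsub>X\<^esub> f" g] assms by simp
  finally show "push g (h \<cdot>\<^bsub>X\<^esub> f) \<cdot>\<^bsub>X\<^esub> ?k = (push g h \<cdot>\<^bsub>X\<^esub> push (g \<cdot>\<^bsub>B\<^esub> far P h) f) \<cdot>\<^bsub>X\<^esub> ?k" ..
qed (use assms in \<open>simp_all add: P.B.assoc\<close>)

text \<open>The properties of the families \<open>g \<mapsto> L (push g h)\<close> that survive composition and inversion:
  the values are invertible in \<open>Q\<close> and vertical. Families are extensional, so that they are equal
  when they agree on the base arrows out of \<open>P y\<close>.\<close>

definition transport_arr :: "'o \<Rightarrow> 'n \<Rightarrow> ('n \<Rightarrow> 'm) \<Rightarrow> 'o \<Rightarrow> bool" where
  "transport_arr x h \<phi> y \<longleftrightarrow> x \<in> Obj X \<and> y \<in> Obj X \<and> h \<in> Arr B \<and> Dom B h = fob P x \<and> Cod B h = fob P y \<and>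
     \<phi> \<in> extensional {g \<in> Arr B. Dom B g = fob P y} \<and>
     (\<forall>g \<in> Arr B. Dom B g = fob P y \<longrightarrow>
       is_iso Q (\<phi> g) \<and> Dom Q (\<phi> g) = fob L (Cod X (k (g \<cdot>\<^bsub>B\<^esub> h) x)) \<and>
       Cod Q (\<phi> g) = fob L (Cod X (k g y)) \<and> far P' (\<phi> g) = Ide B (Cod B g))"

text \<open>The composite of \<open>\<psi>\<close> over \<open>i\<close> and \<open>\<phi>\<close> over \<open>h\<close> has at \<open>g\<close> the value
  \<open>(g \<cdot> i \<cdot> h)\<^sub>* x \<rightarrow> (g \<cdot> i)\<^sub>* y \<rightarrow> g\<^sub>* z\<close>, the first arrow being the value of \<open>\<phi>\<close> at \<open>g \<cdot> i\<close>.\<close>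

definition transport_cat :: "('o, 'o \<times> 'n \<times> ('n \<Rightarrow> 'm) \<times> 'o) cat" where
  "transport_cat = \<lparr>Obj = Obj X, Arr = {(x, h, \<phi>, y). transport_arr x h \<phi> y},
     Dom = fst, Cod = \<lambda>(x, h, \<phi>, y). y,
     Ide = \<lambda>x. (x, Ide B (fob P x),
       restrict (\<lambda>g. Ide Q (fob L (Cod X (k g x)))) {g \<in> Arr B. Dom B g = fob P x}, x),
     Comp = \<lambda>(y, i, \<psi>, z) (x, h, \<phi>, _).
       (x, i \<cdot>\<^bsub>B\<^esub> h, restrict (\<lambda>g. \<psi> g \<cdot>\<^bsub>Q\<^esub> \<phi> (g \<cdot>\<^bsub>B\<^esub> i)) {g \<in> Arr B. Dom B g = fob P z}, z)\<rparr>"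

lemma is_iso_Arr [simp]: "is_iso C f \<Longrightarrow> f \<in> Arr C"
  by (simp add: is_iso_def)

lemma transport_arr_Comp:
  assumes "transport_arr x h \<phi> y" "transport_arr y i \<psi> z"
  shows "transport_arr x (i \<cdot>\<^bsub>B\<^esub> h)
    (restrict (\<lambda>g. \<psi> g \<cdot>\<^bsub>Q\<^esub> \<phi> (g \<cdot>\<^bsub>B\<^esub> i)) {g \<in> Arr B. Dom B g = fob P z}) z"
  using assms unfolding transport_arr_def by (auto simp: P.B.assoc intro!: L.B.is_iso_Comp)

lemma transport_arr_Ide:
  assumes "x \<in> Obj X"
  shows "transport_arr x (Ide B (fob P x))
    (restrict (\<lambda>g. Ide Q (fob L (Cod X (k g x)))) {g \<in> Arr B. Dom B g = fob P x}) x"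
  using assms by (auto simp: transport_arr_def)

lemma transport_arr_assoc:
  assumes "transport_arr x h \<phi> y" "transport_arr y i \<psi> z" "transport_arr z j \<chi> w"
    "g \<in> Arr B" "Dom B g = fob P w"
  shows "(\<chi> g \<cdot>\<^bsub>Q\<^esub> \<psi> (g \<cdot>\<^bsub>B\<^esub> j)) \<cdot>\<^bsub>Q\<^esub> \<phi> (g \<cdot>\<^bsub>B\<^esub> (j \<cdot>\<^bsub>B\<^esub> i)) = \<chi> g \<cdot>\<^bsub>Q\<^esub> (\<psi> (g \<cdot>\<^bsub>B\<^esub> j) \<cdot>\<^bsub>Q\<^esub> \<phi> ((g \<cdot>\<^bsub>B\<^esub> j) \<cdot>\<^bsub>B\<^esub> i))"
  using assms unfolding transport_arr_def by (simp add: P.B.assoc L.B.assoc)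

lemma transport_category: "category transport_cat"
proof
  show "a \<in> Obj transport_cat \<Longrightarrow> Ide transport_cat a \<in> Hom transport_cat a a" for a
    using transport_arr_Ide by (simp add: transport_cat_def Hom_iff)
  show "f \<in> Hom transport_cat a b \<Longrightarrow> g \<in> Hom transport_cat b c
    \<Longrightarrow> g \<cdot>\<^bsub>transport_cat\<^esub> f \<in> Hom transport_cat a c" for f g a b c
    using transport_arr_Comp by (auto simp: transport_cat_def Hom_iff)
  show "Dom transport_cat f \<in> Obj transport_cat" "Cod transport_cat f \<in> Obj transport_cat"
    if "f \<in> Arr transport_cat" for f
    using that by (auto simp: transport_cat_def transport_arr_def)
  show "Ide transport_cat (Cod transport_cat f) \<cdot>\<^bsub>transport_cat\<^esub> f = f" if "f \<in> Arr transport_cat" for f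
    using that
    by (auto simp: transport_cat_def transport_arr_def fun_eq_iff restrict_def extensional_def)
  show "f \<cdot>\<^bsub>transport_cat\<^esub> Ide transport_cat (Dom transport_cat f) = f" if "f \<in> Arr transport_cat" for f
    using that
    by (auto simp: transport_cat_def transport_arr_def fun_eq_iff restrict_def extensional_def)
  show "(h \<cdot>\<^bsub>transport_cat\<^esub> g) \<cdot>\<^bsub>transport_cat\<^esub> f = h \<cdot>\<^bsub>transport_cat\<^esub> (g \<cdot>\<^bsub>transport_cat\<^esub> f)"
    if fgh: "f \<in> Hom transport_cat a b" "g \<in> Hom transport_cat b c" "h \<in> Hom transport_cat c d" for f g h a b c d
  proof -
    obtain i \<phi> j \<psi> l \<chi> where eq: "f = (a, i, \<phi>, b)" "g = (b, j, \<psi>, c)" "h = (c, l, \<chi>, d)"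
      and t: "transport_arr a i \<phi> b" "transport_arr b j \<psi> c" "transport_arr c l \<chi> d"
      using fgh by (auto simp: Hom_iff transport_cat_def)
    have ty: "i \<in> Arr B" "j \<in> Arr B" "l \<in> Arr B" "Dom B j = Cod B i" "Dom B l = Cod B j" "fob P c = Dom B l"
      "fob P d = Cod B l" using t by (simp_all add: transport_arr_def)
    show ?thesis
      using transport_arr_assoc[OF t] ty
      by (auto simp: transport_cat_def eq fun_eq_iff restrict_def P.B.assoc)
  qed
qed

definition transport :: "('o, 'm, 'o, 'o \<times> 'n \<times> ('n \<Rightarrow> 'm) \<times> 'o) func" where
  "transport = \<lparr>fob = \<lambda>x. x, far = \<lambda>h. (Dom X h, far P h,
     restrict (\<lambda>g. far L (push g h)) {g \<in> Arr B. Dom B g = fob P (Cod X h)}, Cod X h)\<rparr>"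

lemma transport_functor: "cat_functor X transport_cat transport"
proof (rule cat_functorI[OF P.A.category_axioms transport_category])
  show "a \<in> Obj X \<Longrightarrow> far transport (Ide X a) = Ide transport_cat (fob transport a)" for a
    by (auto simp: transport_def transport_cat_def push_Ide fun_eq_iff restrict_def)
  show "far transport (g \<cdot>\<^bsub>X\<^esub> f) = far transport g \<cdot>\<^bsub>transport_cat\<^esub> far transport f"
    if "f \<in> Arr X" "g \<in> Arr X" "Dom X g = Cod X f" for f g
    using that by (auto simp: transport_def transport_cat_def push_Comp fun_eq_iff restrict_def P.B.assoc)
  show "far transport f \<in> Arr transport_cat \<and>
      Dom transport_cat (far transport f) = fob transport (Dom X f) \<and>
      Cod transport_cat (far transport f) = fob transport (Cod X f)" if "f \<in> Arr X" for f
    using that L_iso[OF push_vertical[OF that]]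
    by (auto simp: transport_def transport_cat_def transport_arr_def)
qed (simp add: transport_def transport_cat_def)

text \<open>A family over an identity is inverted componentwise, as its index is not shifted.\<close>

lemma transport_inverts: "inverts transport (vertical X B P) transport_cat"
  unfolding inverts_def
proof
  fix s assume s: "s \<in> vertical X B P"
  then obtain b where b: "s \<in> Arr X" "far P s = Ide B b" "b \<in> Obj B" by (auto simp: vertical_def)
  note Ps = P.vertical_objects[OF b]
  let ?out = "{g \<in> Arr B. Dom B g = b}"
  define \<psi> where "\<psi> = restrict (\<lambda>g. inv_arrow Q (far L (push g s))) ?out"
  have inv: "inverses Q (far L (push g s)) (inv_arrow Q (far L (push g s)))" if "g \<in> ?out" for g
    using that b Ps by (intro inverses_inv_arrow L_iso push_vertical) auto
  have "far P' (inv_arrow Q (far L (push g s))) = Ide B (Cod B g)" if "g \<in> ?out" for g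
    using P'.inverse_of_vertical[OF inv[OF that]] that b Ps by simp
  moreover have "is_iso Q (inv_arrow Q (far L (push g s)))" if "g \<in> ?out" for g
    using inverses_sym[OF inv[OF that]] by (auto simp: is_iso_iff)
  ultimately have "transport_arr (Cod X s) (Ide B b) \<psi> (Dom X s)"
    using inv b Ps by (auto simp: transport_arr_def \<psi>_def inverses_def)
  then have "inverses transport_cat (far transport s) (Cod X s, Ide B b, \<psi>, Dom X s)"
    using cat_functor.far_simps(1)[OF transport_functor b(1)] b Ps inv
    by (auto simp: inverses_def transport_cat_def transport_def \<psi>_def fun_eq_iff restrict_def)
  then show "is_iso transport_cat (far transport s)" by (auto simp: is_iso_iff)
qed

definition transport_Q :: "('o, 'm, 'o, 'o \<times> 'n \<times> ('n \<Rightarrow> 'm) \<times> 'o) func" where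
  "transport_Q = (SOME G. cat_functor Q transport_cat G \<and> (\<forall>x \<in> Obj X. fob G (fob L x) = x) \<and>
     (\<forall>h \<in> Arr X. far G (far L h) = far transport h))"

lemma transport_Q:
  "cat_functor Q transport_cat transport_Q" "x \<in> Obj X \<Longrightarrow> fob transport_Q (fob L x) = x"
  "h \<in> Arr X \<Longrightarrow> far transport_Q (far L h) = far transport h"
proof -
  have "\<exists>G. cat_functor Q transport_cat G \<and> (\<forall>x \<in> Obj X. fob G (fob L x) = x) \<and>
     (\<forall>h \<in> Arr X. far G (far L h) = far transport h)"
    by (rule extension[OF transport_functor transport_inverts]) (auto simp: transport_def)
  note * = someI_ex[OF this, folded transport_Q_def]
  show "cat_functor Q transport_cat transport_Q" "x \<in> Obj X \<Longrightarrow> fob transport_Q (fob L x) = x"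
    "h \<in> Arr X \<Longrightarrow> far transport_Q (far L h) = far transport h"
    using * by blast+
qed

interpretation G: cat_functor Q transport_cat transport_Q by (rule transport_Q(1))

text \<open>The vertical isomorphism \<open>(g \<cdot> P' w)\<^sub>* x \<rightarrow> g\<^sub>* y\<close> in \<open>Q\<close> attached to an arbitrary arrow \<open>w : x \<rightarrow> y\<close> of \<open>Q\<close>.\<close>

definition component :: "'m \<Rightarrow> 'n \<Rightarrow> 'm" where "component w = fst (snd (snd (far transport_Q w)))"

lemma transport_Q_eq:
  assumes "w \<in> Arr Q"
  shows "far transport_Q w = (obj (Dom Q w), far P' w, component w, obj (Cod Q w))"
proof -
  have ob: "fob transport_Q a = obj a" if "a \<in> Obj Q" for a
    using transport_Q(2)[of "obj a"] that by simp
  have 1: "far transport_Q w = (obj (Dom Q w), fst (snd (far transport_Q w)), component w, obj (Cod Q w))"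
    if "w \<in> Arr Q" for w
    using G.far_simps(2,3)[OF that] ob that
    by (cases "far transport_Q w") (simp add: transport_cat_def component_def)
  have "fst (snd (far transport_Q w)) = far P' w"
    using assms
  proof (induction rule: arr_induct)
    case (L h)
    then show ?case by (simp add: transport_Q transport_def)
  next
    case (Comp f g)
    have "fst (snd (far transport_Q (g \<cdot>\<^bsub>Q\<^esub> f))) = fst (snd (far transport_Q g)) \<cdot>\<^bsub>B\<^esub> fst (snd (far transport_Q f))"
      using Comp(1-3) by (subst G.far_Comp') (auto simp: transport_cat_def split: prod.splits)
    then show ?case using Comp by simp
  next
    case (inverse s t)
    then obtain b where s: "s \<in> Arr X" "far P s = Ide B b" "b \<in> Obj B" by (auto simp: vertical_def)
    have t: "t \<in> Arr Q" "Dom Q t = Cod Q (far L s)" "Cod Q t = Dom Q (far L s)"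
      using inverse(2) by (simp_all add: inverses_def)
    have "far P' t = Ide B b" using P'.inverse_of_vertical[OF inverse(2)] s by simp
    moreover have "inverses transport_cat (far transport_Q (far L s)) (far transport_Q t)"
      using inverse(2) by (rule G.inverses_far)
    then have "fst (snd (far transport_Q t)) \<cdot>\<^bsub>B\<^esub> Ide B b = Ide B b \<and> fst (snd (far transport_Q t)) \<in> Arr B \<and>
      Dom B (fst (snd (far transport_Q t))) = b"
      using 1[OF t(1)] s t P.vertical_objects[OF s]
      by (auto simp: inverses_def transport_Q(3) transport_def transport_cat_def transport_arr_def split: prod.splits)
    ultimately show ?case using P.B.Comp_Ide_right[of "fst (snd (far transport_Q t))" b] by metis
  qed
  then show ?thesis using 1[OF assms] by simp
qed

lemma component_simps [simp]:
  assumes "w \<in> Arr Q" "g \<in> Arr B" "Dom B g = fob P' (Cod Q w)"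
  shows "is_iso Q (component w g)" "Dom Q (component w g) = fob L (Cod X (k (g \<cdot>\<^bsub>B\<^esub> far P' w) (obj (Dom Q w))))"
    "Cod Q (component w g) = fob L (Cod X (k g (obj (Cod Q w))))" "far P' (component w g) = Ide B (Cod B g)"
  using G.far_simps(1)[OF assms(1)] assms
  by (simp_all add: transport_Q_eq transport_cat_def transport_arr_def)

lemma component_Comp:
  assumes "f \<in> Arr Q" "h \<in> Arr Q" "Dom Q h = Cod Q f" "g \<in> Arr B" "Dom B g = fob P' (Cod Q h)"
  shows "component (h \<cdot>\<^bsub>Q\<^esub> f) g = component h g \<cdot>\<^bsub>Q\<^esub> component f (g \<cdot>\<^bsub>B\<^esub> far P' h)"
proof -
  have "component (h \<cdot>\<^bsub>Q\<^esub> f) = fst (snd (snd (far transport_Q h \<cdot>\<^bsub>transport_cat\<^esub> far transport_Q f)))"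
    unfolding component_def using assms by simp
  then show ?thesis using assms by (simp add: transport_Q_eq transport_cat_def)
qed

lemma component_L:
  assumes "h \<in> Arr X" "g \<in> Arr B" "Dom B g = fob P (Cod X h)"
  shows "component (far L h) g = far L (push g h)"
  using assms by (simp add: component_def transport_Q transport_def)

lemma component_Ide:
  assumes "x \<in> Obj X" "g \<in> Arr B" "Dom B g = fob P x"
  shows "component (Ide Q (fob L x)) g = Ide Q (fob L (Cod X (k g x)))"
  using component_L[of "Ide X x" g] assms by (simp add: push_Ide)

text \<open>The defining square of \<open>push\<close>, extended from the arrows of \<open>X\<close> to those of \<open>Q\<close>. For \<open>g = 1\<close> its side
  \<open>L (k 1 y)\<close> is invertible, so \<open>w\<close> can be recovered from its component.\<close>

lemma component_square:
  assumes "w \<in> Arr Q"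
  shows "\<forall>g \<in> Arr B. Dom B g = fob P' (Cod Q w) \<longrightarrow>
    component w g \<cdot>\<^bsub>Q\<^esub> far L (k (g \<cdot>\<^bsub>B\<^esub> far P' w) (obj (Dom Q w))) = far L (k g (obj (Cod Q w))) \<cdot>\<^bsub>Q\<^esub> w"
  using assms
proof (induction rule: arr_induct)
  case (L h)
  then show ?case by (simp add: component_L push_square flip: L.far_Comp')
next
  case (Comp f h)
  show ?case
  proof (intro ballI impI)
    fix g assume "g \<in> Arr B" "Dom B g = fob P' (Cod Q (h \<cdot>\<^bsub>Q\<^esub> f))"
    then have g: "g \<in> Arr B" "Dom B g = fob P' (Cod Q h)" using Comp by simp_all
    let ?k = "k ((g \<cdot>\<^bsub>B\<^esub> far P' h) \<cdot>\<^bsub>B\<^esub> far P' f) (obj (Dom Q f))"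
    have "component (h \<cdot>\<^bsub>Q\<^esub> f) g \<cdot>\<^bsub>Q\<^esub> far L ?k = component h g \<cdot>\<^bsub>Q\<^esub> (component f (g \<cdot>\<^bsub>B\<^esub> far P' h) \<cdot>\<^bsub>Q\<^esub> far L ?k)"
      using Comp(1-3) g by (simp add: component_Comp L.B.assoc)
    also have "component f (g \<cdot>\<^bsub>B\<^esub> far P' h) \<cdot>\<^bsub>Q\<^esub> far L ?k = far L (k (g \<cdot>\<^bsub>B\<^esub> far P' h) (obj (Dom Q h))) \<cdot>\<^bsub>Q\<^esub> f"
      using Comp(1-4) g by simp
    also have "component h g \<cdot>\<^bsub>Q\<^esub> \<dots> = (component h g \<cdot>\<^bsub>Q\<^esub> far L (k (g \<cdot>\<^bsub>B\<^esub> far P' h) (obj (Dom Q h)))) \<cdot>\<^bsub>Q\<^esub> f"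
      using Comp(1-3) g by (simp add: L.B.assoc)
    also have "\<dots> = far L (k g (obj (Cod Q h))) \<cdot>\<^bsub>Q\<^esub> (h \<cdot>\<^bsub>Q\<^esub> f)"
      using Comp(1-3,5) g by (simp add: L.B.assoc)
    finally show "component (h \<cdot>\<^bsub>Q\<^esub> f) g \<cdot>\<^bsub>Q\<^esub> far L (k (g \<cdot>\<^bsub>B\<^esub> far P' (h \<cdot>\<^bsub>Q\<^esub> f)) (obj (Dom Q (h \<cdot>\<^bsub>Q\<^esub> f))))
        = far L (k g (obj (Cod Q (h \<cdot>\<^bsub>Q\<^esub> f)))) \<cdot>\<^bsub>Q\<^esub> (h \<cdot>\<^bsub>Q\<^esub> f)"
      using Comp(1-3) g by (simp add: P.B.assoc)
  qed
next
  case (inverse s t)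
  then obtain b where s: "s \<in> Arr X" "far P s = Ide B b" "b \<in> Obj B" by (auto simp: vertical_def)
  note Ps = P.vertical_objects[OF s]
  have t: "t \<in> Arr Q" "Dom Q t = fob L (Cod X s)" "Cod Q t = fob L (Dom X s)"
    and st: "far L s \<cdot>\<^bsub>Q\<^esub> t = Ide Q (fob L (Cod X s))" "t \<cdot>\<^bsub>Q\<^esub> far L s = Ide Q (fob L (Dom X s))"
    using inverse(2) s by (simp_all add: inverses_def)
  have Pt: "far P' t = Ide B b" using P'.inverse_of_vertical[OF inverse(2)] s by simp
  show ?case
  proof (intro ballI impI)
    fix g assume "g \<in> Arr B" "Dom B g = fob P' (Cod Q t)"
    then have g: "g \<in> Arr B" "Dom B g = b" using t s Ps by simp_all
    have inv: "component t g \<cdot>\<^bsub>Q\<^esub> component (far L s) g = Ide Q (fob L (Cod X (k g (Dom X s))))"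
      using component_Comp[of "far L s" t g] t s g Ps Pt st by (simp add: component_Ide)
    have "component t g \<cdot>\<^bsub>Q\<^esub> far L (k g (Cod X s)) = component t g \<cdot>\<^bsub>Q\<^esub> ((far L (k g (Cod X s)) \<cdot>\<^bsub>Q\<^esub> far L s) \<cdot>\<^bsub>Q\<^esub> t)"
      using s t g Ps st by (simp add: L.B.assoc del: L.far_Comp')
    also have "far L (k g (Cod X s)) \<cdot>\<^bsub>Q\<^esub> far L s = component (far L s) g \<cdot>\<^bsub>Q\<^esub> far L (k g (Dom X s))"
      using inverse(3) s g Ps by simp
    also have "component t g \<cdot>\<^bsub>Q\<^esub> ((component (far L s) g \<cdot>\<^bsub>Q\<^esub> far L (k g (Dom X s))) \<cdot>\<^bsub>Q\<^esub> t)
      = (component t g \<cdot>\<^bsub>Q\<^esub> component (far L s) g) \<cdot>\<^bsub>Q\<^esub> (far L (k g (Dom X s)) \<cdot>\<^bsub>Q\<^esub> t)"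
      using s t g Ps Pt by (simp add: L.B.assoc)
    also have "\<dots> = far L (k g (Dom X s)) \<cdot>\<^bsub>Q\<^esub> t"
      unfolding inv using s t g Ps by simp
    finally show "component t g \<cdot>\<^bsub>Q\<^esub> far L (k (g \<cdot>\<^bsub>B\<^esub> far P' t) (obj (Dom Q t))) = far L (k g (obj (Cod Q t))) \<cdot>\<^bsub>Q\<^esub> t"
      using s t g Ps Pt by simp
  qed
qed

lemma k_Ide_vertical:
  assumes "x \<in> Obj X"
  shows "k (Ide B (fob P x)) x \<in> vertical X B P"
  using assms by (auto simp: vertical_def)

text \<open>For \<open>P' w = 1\<close> and \<open>g = 1\<close>, the three other sides of \<open>component_square\<close> are invertible.\<close>

lemma vertical_is_iso:
  assumes "w \<in> vertical Q B P'"
  shows "is_iso Q w"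
proof -
  obtain b where w: "w \<in> Arr Q" "far P' w = Ide B b" "b \<in> Obj B" using assms by (auto simp: vertical_def)
  note Pw = P'.vertical_objects[OF w]
  let ?x = "obj (Dom Q w)" and ?y = "obj (Cod Q w)" and ?i = "Ide B b"
  have iso: "is_iso Q (far L (k ?i ?x))" "is_iso Q (far L (k ?i ?y))"
    using L_iso[OF k_Ide_vertical[of ?x]] L_iso[OF k_Ide_vertical[of ?y]] w Pw by simp_all
  then obtain j where j: "inverses Q (far L (k ?i ?y)) j" by (auto simp: is_iso_iff)
  have sq: "far L (k ?i ?y) \<cdot>\<^bsub>Q\<^esub> w = component w ?i \<cdot>\<^bsub>Q\<^esub> far L (k ?i ?x)"
    using component_square[OF w(1), rule_format, of ?i] w Pw by simp
  have "w = j \<cdot>\<^bsub>Q\<^esub> (component w ?i \<cdot>\<^bsub>Q\<^esub> far L (k ?i ?x))"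
    using L.B.move_inverse_left[OF j w(1) _ sq] w Pw by simp
  moreover have "is_iso Q (j \<cdot>\<^bsub>Q\<^esub> (component w ?i \<cdot>\<^bsub>Q\<^esub> far L (k ?i ?x)))"
  proof (rule L.B.is_iso_Comp[OF L.B.is_iso_Comp[OF iso(1)]])
    show "is_iso Q j" using inverses_sym[OF j] by (auto simp: is_iso_iff)
    show "Dom Q j = Cod Q (component w ?i \<cdot>\<^bsub>Q\<^esub> far L (k ?i ?x))"
      using j w Pw by (simp add: inverses_def)
  qed (use w Pw in simp_all)
  ultimately show ?thesis by simp
qed

text \<open>Let \<open>v\<close> lie over \<open>g \<cdot> P u\<close>. By \<open>component_square\<close>, \<open>v\<close> is a vertical arrow after \<open>L\<close> of the lifting of
  \<open>g \<cdot> P u\<close>, and this lifting factors through \<open>u\<close> in \<open>X\<close>; so \<open>v\<close> factors through \<open>L u\<close>. For uniqueness,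
  the component at \<open>1\<close> of \<open>v = w \<cdot> L u\<close> is the component of \<open>w\<close> at \<open>1\<close> after the invertible \<open>L (push g u)\<close>;
  so \<open>v\<close> determines the component of \<open>w\<close>, and hence \<open>w\<close>.\<close>

lemma cocartesian_L:
  assumes u: "cocartesian X B P u"
  shows "cocartesian Q B P' (far L u)"
proof -
  have u': "u \<in> Arr X" using u by (simp add: cocartesian_def)
  let ?x = "Dom X u" and ?x' = "Cod X u"
  have "\<exists>!w. w \<in> Hom Q (fob L ?x') (Cod Q v) \<and> far P' w = g \<and> w \<cdot>\<^bsub>Q\<^esub> far L u = v"
    if v: "v \<in> Arr Q" "Dom Q v = fob L ?x" and g: "g \<in> Arr B" "Dom B g = fob P ?x'" "Cod B g = fob P' (Cod Q v)"
      and gu: "g \<cdot>\<^bsub>B\<^esub> far P u = far P' v" for v g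
  proof -
    let ?y = "obj (Cod Q v)" and ?b = "fob P' (Cod Q v)"
    let ?i = "Ide B ?b"
    have "is_iso Q (far L (k ?i ?y))" using L_iso[OF k_Ide_vertical[of ?y]] v by simp
    then obtain j where j: "inverses Q (far L (k ?i ?y)) j" by (auto simp: is_iso_iff)
    then have j': "j \<in> Arr Q" "Dom Q j = fob L (Cod X (k ?i ?y))" "Cod Q j = Cod Q v"
      using v by (simp_all add: inverses_def)
    have Pj: "far P' j = ?i" using P'.inverse_of_vertical[OF j] v by simp
    have sq: "far L (k ?i ?y) \<cdot>\<^bsub>Q\<^esub> v = component v ?i \<cdot>\<^bsub>Q\<^esub> far L (k (g \<cdot>\<^bsub>B\<^esub> far P u) ?x)"
      using component_square[OF v(1), rule_format, of ?i] v u' gu by simp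
    have v_eq: "v = j \<cdot>\<^bsub>Q\<^esub> (component v ?i \<cdot>\<^bsub>Q\<^esub> far L (k (g \<cdot>\<^bsub>B\<^esub> far P u) ?x))"
      using L.B.move_inverse_left[OF j v(1) _ sq] v by simp
    have kg: "k (g \<cdot>\<^bsub>B\<^esub> far P u) ?x \<in> Arr X" "Dom X (k (g \<cdot>\<^bsub>B\<^esub> far P u) ?x) = ?x"
      "far P (k (g \<cdot>\<^bsub>B\<^esub> far P u) ?x) = g \<cdot>\<^bsub>B\<^esub> far P u"
      "fob P (Cod X (k (g \<cdot>\<^bsub>B\<^esub> far P u) ?x)) = Cod B g"
      using u' g by simp_all
    then obtain e where e: "e \<in> Arr X" "Dom X e = ?x'" "Cod X e = Cod X (k (g \<cdot>\<^bsub>B\<^esub> far P u) ?x)"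
      "far P e = g" "e \<cdot>\<^bsub>X\<^esub> u = k (g \<cdot>\<^bsub>B\<^esub> far P u) ?x"
      using u[unfolded cocartesian_def, THEN conjunct2, rule_format, of "k (g \<cdot>\<^bsub>B\<^esub> far P u) ?x" g] g u'
      by (auto simp: Hom_iff)
    have comp_v: "component v ?i \<in> Arr Q" "Dom Q (component v ?i) = fob L (Cod X e)" "Cod Q (component v ?i) = Dom Q j"
      "far P' (component v ?i) = ?i"
      using v j' e gu u' by simp_all
    let ?w = "j \<cdot>\<^bsub>Q\<^esub> (component v ?i \<cdot>\<^bsub>Q\<^esub> far L e)"
    have "far P' ?w = g" using comp_v e j' Pj g v by simp
    moreover have "?w \<cdot>\<^bsub>Q\<^esub> far L u = j \<cdot>\<^bsub>Q\<^esub> (component v ?i \<cdot>\<^bsub>Q\<^esub> far L (k (g \<cdot>\<^bsub>B\<^esub> far P u) ?x))"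
      using comp_v e(1-3) j' u' by (simp add: L.B.assoc e(5) flip: L.far_Comp')
    then have "?w \<cdot>\<^bsub>Q\<^esub> far L u = v" using v_eq by (rule trans[OF _ sym])
    ultimately have w': "?w \<in> Hom Q (fob L ?x') (Cod Q v) \<and> far P' ?w = g \<and> ?w \<cdot>\<^bsub>Q\<^esub> far L u = v"
      using comp_v e j' v by (simp add: Hom_iff)
    \<comment> \<open>An opaque name for the factorization found above, to be compared with any other one.\<close>
    define w0 where "w0 = ?w"
    have w0: "w0 \<in> Hom Q (fob L ?x') (Cod Q v) \<and> far P' w0 = g \<and> w0 \<cdot>\<^bsub>Q\<^esub> far L u = v"
      unfolding w0_def by (rule w')
    have *: "w = j \<cdot>\<^bsub>Q\<^esub> (component w ?i \<cdot>\<^bsub>Q\<^esub> far L (k g ?x')) \<and> component w ?i \<cdot>\<^bsub>Q\<^esub> far L (push g u) = component v ?i \<and>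
        component w ?i \<in> Arr Q \<and> Dom Q (component w ?i) = fob L (Cod X (k g ?x'))"
      if "w \<in> Hom Q (fob L ?x') (Cod Q v) \<and> far P' w = g \<and> w \<cdot>\<^bsub>Q\<^esub> far L u = v" for w
    proof -
      have w: "w \<in> Arr Q" "Dom Q w = fob L ?x'" "Cod Q w = Cod Q v" "far P' w = g" "w \<cdot>\<^bsub>Q\<^esub> far L u = v"
        using that by (simp_all add: Hom_iff)
      have 1: "far L (k ?i ?y) \<cdot>\<^bsub>Q\<^esub> w = component w ?i \<cdot>\<^bsub>Q\<^esub> far L (k g ?x')"
        using component_square[OF w(1), rule_format, of ?i] w g u' v by simp
      have 2: "w = j \<cdot>\<^bsub>Q\<^esub> (component w ?i \<cdot>\<^bsub>Q\<^esub> far L (k g ?x'))"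
        using L.B.move_inverse_left[OF j w(1) _ 1] v w(3) by simp
      have "component v ?i = component w ?i \<cdot>\<^bsub>Q\<^esub> far L (push g u)"
        using component_Comp[of "far L u" w ?i] w u' g v by (simp add: component_L)
      moreover have "component w ?i \<in> Arr Q \<and> Dom Q (component w ?i) = fob L (Cod X (k g ?x'))"
        using w(1-4) g u' v by simp
      ultimately show ?thesis by (intro conjI 2) simp_all
    qed
    have "w = w0" if w: "w \<in> Hom Q (fob L ?x') (Cod Q v) \<and> far P' w = g \<and> w \<cdot>\<^bsub>Q\<^esub> far L u = v" for w
    proof -
      have eq: "component w ?i = component w0 ?i"
        by (rule L.B.iso_cancel_right[OF L_iso[OF push_vertical[OF u' g(1,2)]]])
          (use *[OF w, THEN conjunct2] *[OF w0, THEN conjunct2] g u' in simp_all)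
      show ?thesis
        by (rule trans[OF *[OF w, THEN conjunct1, unfolded eq] *[OF w0, THEN conjunct1, symmetric]])
    qed
    with w0 show ?thesis by blast
  qed
  then show ?thesis using u' by (auto simp: cocartesian_def Hom_iff)
qed

lemma opfibration_fractions: "opfibration Q B P'"
proof
  fix a f assume a: "a \<in> Obj Q" and f: "f \<in> Arr B" "Dom B f = fob P' a"
  show "\<exists>u. cocartesian Q B P' u \<and> Dom Q u = a \<and> far P' u = f"
    using a f by (intro exI[of _ "far L (k f (obj a))"]) (simp add: cocartesian_L)
qed

lemma groupoidal_fractions: "groupoidal_fibres Q B P'"
  unfolding P'.groupoidal_fibres_iff using vertical_is_iso by blast

end

section \<open>Opfibrations with groupoidal fibres\<close>

locale groupoidal_opfibration = opfibration +
  assumes groupoidal: "groupoidal_fibres X B P"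
begin

text \<open>An arrow is a cocartesian lifting followed by a vertical arrow, which is invertible.\<close>

lemma all_cocartesian:
  assumes u: "u \<in> Arr X"
  shows "cocartesian X B P u"
proof -
  obtain c where c: "cocartesian X B P c" "Dom X c = Dom X u" "far P c = far P u"
    using cocartesian_lifting[of "Dom X u" "far P u"] u by auto
  then have c': "c \<in> Arr X" by (simp add: cocartesian_def)
  define e where "e = induced X B P c u"
  have e: "e \<in> Arr X" "Dom X e = Cod X c" "Cod X e = Cod X u" "far P e = Ide B (fob P (Cod X c))" "e \<cdot>\<^bsub>X\<^esub> c = u"
    using induced[OF c(1) u] c by (simp_all add: e_def)
  have "e \<in> vertical X B P" using e c' by (auto simp: vertical_def)
  then obtain e' where e': "inverses X e e'" using groupoidal by (auto simp: groupoidal_fibres_iff is_iso_iff)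
  have Pe': "far P e' = Ide B (fob P (Cod X c))"
    using inverse_of_vertical[OF e' e(4)] c' by simp
  have e'': "e' \<in> Arr X" "Dom X e' = Cod X u" "Cod X e' = Cod X c" "e' \<cdot>\<^bsub>X\<^esub> e = Ide X (Cod X c)" "e \<cdot>\<^bsub>X\<^esub> e' = Ide X (Cod X u)"
    using e' e by (simp_all add: inverses_def)
  have Pu: "fob P (Cod X u) = fob P (Cod X c)" using vertical_objects[OF e(1,4)] e c' by simp
  have cu: "c = e' \<cdot>\<^bsub>X\<^esub> u" using A.move_inverse_left[OF e' c' _ e(5)] e by simp
  have "\<exists>!w. w \<in> Hom X (Cod X u) (Cod X v) \<and> far P w = g \<and> w \<cdot>\<^bsub>X\<^esub> u = v"
    if v: "v \<in> Arr X" "Dom X v = Dom X u" and g: "g \<in> Arr B" "Dom B g = fob P (Cod X u)"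
      "Cod B g = fob P (Cod X v)" "g \<cdot>\<^bsub>B\<^esub> far P u = far P v" for v g
  proof -
    obtain w where w: "w \<in> Arr X" "Dom X w = Cod X c" "Cod X w = Cod X v" "far P w = g" "w \<cdot>\<^bsub>X\<^esub> c = v"
      using c(1)[unfolded cocartesian_def, THEN conjunct2, rule_format, of v g] v g c Pu
      by (auto simp: Hom_iff)
    have "(w \<cdot>\<^bsub>X\<^esub> e') \<cdot>\<^bsub>X\<^esub> u = w \<cdot>\<^bsub>X\<^esub> (e' \<cdot>\<^bsub>X\<^esub> u)"
      using w(1-3) e''(1-3) u by (intro A.assoc) simp_all
    then have wu: "(w \<cdot>\<^bsub>X\<^esub> e') \<cdot>\<^bsub>X\<^esub> u = v" unfolding cu[symmetric] w(5) .
    have "far P (w \<cdot>\<^bsub>X\<^esub> e') = g \<cdot>\<^bsub>B\<^esub> Ide B (fob P (Cod X c))"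
      using w(1-4) e'' Pe' by simp
    also have "\<dots> = g" by (rule B.Comp_Ide_right[OF g(1) trans[OF Pu[symmetric] g(2)[symmetric]]])
    finally have Pw: "far P (w \<cdot>\<^bsub>X\<^esub> e') = g" .
    have factor: "w1 \<in> Arr X \<and> Dom X w1 = Cod X u \<and> Cod X w1 = Cod X v \<and> far P w1 = g \<and>
        (w1 \<cdot>\<^bsub>X\<^esub> e) \<cdot>\<^bsub>X\<^esub> c = v"
      if w1: "w1 \<in> Hom X (Cod X u) (Cod X v) \<and> far P w1 = g \<and> w1 \<cdot>\<^bsub>X\<^esub> u = v" for w1
    proof -
      have "(w1 \<cdot>\<^bsub>X\<^esub> e) \<cdot>\<^bsub>X\<^esub> c = w1 \<cdot>\<^bsub>X\<^esub> (e \<cdot>\<^bsub>X\<^esub> c)"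
        using w1 e(1-3) c' by (intro A.assoc) (simp_all add: Hom_iff)
      then show ?thesis using w1 unfolding e(5) by (simp add: Hom_iff)
    qed
    have "w1 = w2" if w1: "w1 \<in> Hom X (Cod X u) (Cod X v) \<and> far P w1 = g \<and> w1 \<cdot>\<^bsub>X\<^esub> u = v"
      and w2: "w2 \<in> Hom X (Cod X u) (Cod X v) \<and> far P w2 = g \<and> w2 \<cdot>\<^bsub>X\<^esub> u = v" for w1 w2
    proof (rule A.iso_cancel_right[of e])
      show "is_iso X e" using e' by (auto simp: is_iso_iff)
      show "w1 \<cdot>\<^bsub>X\<^esub> e = w2 \<cdot>\<^bsub>X\<^esub> e"
        by (rule cocartesian_ext[OF c(1)]) (use factor[OF w1] factor[OF w2] e(1-3) in simp_all)
    qed (use factor[OF w1] factor[OF w2] e(1-3) in simp_all)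
    moreover have "w \<cdot>\<^bsub>X\<^esub> e' \<in> Hom X (Cod X u) (Cod X v)" using w(1-3) e''(1-3) by (simp add: Hom_iff)
    ultimately show ?thesis using Pw wu by blast
  qed
  then show ?thesis using u by (auto simp: cocartesian_def Hom_iff)
qed

text \<open>Every arrow behaves like an epimorphism with respect to pairs of arrows over the same base
  arrow.\<close>

lemma arrow_ext:
  assumes "c \<in> Arr X" "h \<in> Arr X" "h' \<in> Arr X" "Dom X h = Cod X c" "Dom X h' = Cod X c"
    "Cod X h = Cod X h'" "far P h = far P h'" "h \<cdot>\<^bsub>X\<^esub> c = h' \<cdot>\<^bsub>X\<^esub> c"
  shows "h = h'"
  by (rule cocartesian_ext[OF all_cocartesian[OF assms(1)] assms(2-8)])

end

section \<open>Sums of arrows in an additive category\<close>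

definition zero_arr :: "('o, 'm) cat \<Rightarrow> ('o, 'm) products \<Rightarrow> 'o \<Rightarrow> 'o \<Rightarrow> 'm" where
  "zero_arr C S a b = from_zero C S b \<cdot>\<^bsub>C\<^esub> to_one C S a"

text \<open>In an additive category this is the sum of the parallel arrows \<open>p\<close> and \<open>q\<close>, written with the
  codiagonal because the tensor product of the fibres is defined by it.\<close>

definition sum_arr :: "('o, 'm) cat \<Rightarrow> ('o, 'm) products \<Rightarrow> 'm \<Rightarrow> 'm \<Rightarrow> 'm" where
  "sum_arr C S p q = codiagonal C S (Cod C p) \<cdot>\<^bsub>C\<^esub> pairing C S p q"

context additive_category begin

definition bilinear_groups :: "('m \<Rightarrow> 'm \<Rightarrow> 'm) \<Rightarrow> ('o \<Rightarrow> 'o \<Rightarrow> 'm) \<Rightarrow> bool" where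
  "bilinear_groups addition neutral \<longleftrightarrow>
     (\<forall>a \<in> Obj C. \<forall>b \<in> Obj C.
        comm_group \<lparr>carrier = Hom C a b, monoid.mult = addition, one = neutral a b\<rparr>) \<and>
     (\<forall>a b c f f' g. f \<in> Hom C a b \<and> f' \<in> Hom C a b \<and> g \<in> Hom C b c \<longrightarrow>
        g \<cdot>\<^bsub>C\<^esub> addition f f' = addition (g \<cdot>\<^bsub>C\<^esub> f) (g \<cdot>\<^bsub>C\<^esub> f')) \<and>
     (\<forall>a b c f g g'. f \<in> Hom C a b \<and> g \<in> Hom C b c \<and> g' \<in> Hom C b c \<longrightarrow>
        addition g g' \<cdot>\<^bsub>C\<^esub> f = addition (g \<cdot>\<^bsub>C\<^esub> f) (g' \<cdot>\<^bsub>C\<^esub> f))"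

text \<open>The additive structure is only assumed to exist; one is chosen here, and \<open>sum_arr_eq\<close> shows that it
  is the one given by the codiagonal.\<close>

definition addition :: "'m \<Rightarrow> 'm \<Rightarrow> 'm" where "addition = (SOME addition. \<exists>neutral. bilinear_groups addition neutral)"

definition neutral :: "'o \<Rightarrow> 'o \<Rightarrow> 'm" where "neutral = (SOME neutral. bilinear_groups addition neutral)"

lemma bilinear_groups: "bilinear_groups addition neutral"
proof -
  have "\<exists>addition neutral. bilinear_groups addition neutral"
    using preadditive unfolding bilinear_groups_def .
  then have "\<exists>neutral. bilinear_groups addition neutral" unfolding addition_def by (rule someI_ex)
  then show ?thesis unfolding neutral_def by (rule someI_ex)
qed

lemma addition_comm_group:
  assumes "a \<in> Obj C" "b \<in> Obj C"
  shows "comm_group \<lparr>carrier = Hom C a b, monoid.mult = addition, one = neutral a b\<rparr>"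
  by (rule bilinear_groups[unfolded bilinear_groups_def, THEN conjunct1, THEN bspec, THEN bspec]) (fact assms)+

lemma Comp_addition:
  assumes "f \<in> Hom C a b" "f' \<in> Hom C a b" "g \<in> Hom C b c"
  shows "g \<cdot>\<^bsub>C\<^esub> addition f f' = addition (g \<cdot>\<^bsub>C\<^esub> f) (g \<cdot>\<^bsub>C\<^esub> f')"
  by (rule bilinear_groups[unfolded bilinear_groups_def, THEN conjunct2, THEN conjunct1, rule_format,
      OF conjI[OF assms(1) conjI[OF assms(2,3)]]])

lemma addition_Comp:
  assumes "f \<in> Hom C a b" "g \<in> Hom C b c" "g' \<in> Hom C b c"
  shows "addition g g' \<cdot>\<^bsub>C\<^esub> f = addition (g \<cdot>\<^bsub>C\<^esub> f) (g' \<cdot>\<^bsub>C\<^esub> f)"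
  by (rule bilinear_groups[unfolded bilinear_groups_def, THEN conjunct2, THEN conjunct2, rule_format,
      OF conjI[OF assms(1) conjI[OF assms(2,3)]]])

text \<open>The terminal object is initial because its identity is zero. The two defining equations of
  the codiagonal have the unique solution \<open>Fst + Snd\<close>, by the biproduct identity
  \<open>\<langle>1, 0\<rangle> \<cdot> Fst + \<langle>0, 1\<rangle> \<cdot> Snd = 1\<close>.\<close>

lemma
  shows zero_Hom: "\<lbrakk>a \<in> Obj C; b \<in> Obj C\<rbrakk> \<Longrightarrow> neutral a b \<in> Hom C a b"
    and plus_Hom: "\<lbrakk>p \<in> Hom C a b; q \<in> Hom C a b\<rbrakk> \<Longrightarrow> addition p q \<in> Hom C a b"
    and initial: "h \<in> Hom C (One S) b \<Longrightarrow> h = neutral (One S) b"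
    and from_zero_eq: "b \<in> Obj C \<Longrightarrow> from_zero C S b = neutral (One S) b"
    and zero_arr_eq: "\<lbrakk>a \<in> Obj C; b \<in> Obj C\<rbrakk> \<Longrightarrow> zero_arr C S a b = neutral a b"
    and codiagonal_eq: "b \<in> Obj C \<Longrightarrow> codiagonal C S b = addition (Fst S b b) (Snd S b b)"
proof -
  have zero: "neutral a b \<in> Hom C a b" if "a \<in> Obj C" "b \<in> Obj C" for a b
    using monoid.one_closed[OF group.is_monoid[OF comm_group.axioms(2)[OF addition_comm_group[OF that]]]] by simp
  have closed: "addition f g \<in> Hom C a b" if "f \<in> Hom C a b" "g \<in> Hom C a b" for f g a b
    using monoid.m_closed[OF group.is_monoid[OF comm_group.axioms(2)[OF addition_comm_group[of a b]]]] that
    by (auto simp: Hom_iff)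
  have l_one: "addition (neutral a b) f = f" and r_one: "addition f (neutral a b) = f" if "f \<in> Hom C a b" for f a b
    using monoid.l_one[OF group.is_monoid[OF comm_group.axioms(2)[OF addition_comm_group[of a b]]]]
      monoid.r_one[OF group.is_monoid[OF comm_group.axioms(2)[OF addition_comm_group[of a b]]]] that
    by (auto simp: Hom_iff)
  have idem: "f = neutral a b" if f: "f \<in> Hom C a b" "addition f f = f" for f a b
  proof -
    have "a \<in> Obj C" "b \<in> Obj C" using f by (auto simp: Hom_iff)
    then interpret G: comm_group "\<lparr>carrier = Hom C a b, monoid.mult = addition, one = neutral a b\<rparr>" by (rule addition_comm_group)
    show ?thesis using G.l_cancel_one[of f f] f by simp
  qed
  have zero_right: "g \<cdot>\<^bsub>C\<^esub> neutral a b = neutral a c" if "g \<in> Hom C b c" "a \<in> Obj C" for g a b c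
  proof (rule idem)
    have b: "b \<in> Obj C" using that by (auto simp: Hom_iff)
    show "g \<cdot>\<^bsub>C\<^esub> neutral a b \<in> Hom C a c" using Comp_Hom zero that b by blast
    show "addition (g \<cdot>\<^bsub>C\<^esub> neutral a b) (g \<cdot>\<^bsub>C\<^esub> neutral a b) = g \<cdot>\<^bsub>C\<^esub> neutral a b"
      using Comp_addition[OF zero[OF that(2) b] zero[OF that(2) b] that(1)] l_one[OF zero[OF that(2) b]] by simp
  qed
  have zero_left: "neutral b c \<cdot>\<^bsub>C\<^esub> f = neutral a c" if "f \<in> Hom C a b" "c \<in> Obj C" for f a b c
  proof (rule idem)
    have b: "b \<in> Obj C" using that by (auto simp: Hom_iff)
    show "neutral b c \<cdot>\<^bsub>C\<^esub> f \<in> Hom C a c" using Comp_Hom zero that b by blast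
    show "addition (neutral b c \<cdot>\<^bsub>C\<^esub> f) (neutral b c \<cdot>\<^bsub>C\<^esub> f) = neutral b c \<cdot>\<^bsub>C\<^esub> f"
      using addition_Comp[OF that(1) zero[OF b that(2)] zero[OF b that(2)]] l_one[OF zero[OF b that(2)]] by simp
  qed
  have one: "Ide C (One S) = neutral (One S) (One S)"
    using One_terminal[of "One S"] Ide_Hom zero by auto
  have initial: "h = neutral (One S) b" if "h \<in> Hom C (One S) b" for h b
    using zero_right[OF that, of "One S"] that by (simp add: Hom_iff flip: one)
  have from_zero: "from_zero C S b = neutral (One S) b" if "b \<in> Obj C" for b
    unfolding from_zero_def using zero[OF One_Obj that] initial by (intro the_equality)
  have zero_arr: "zero_arr C S a b = neutral a b" if "a \<in> Obj C" "b \<in> Obj C" for a b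
    unfolding zero_arr_def from_zero[OF that(2)]
    by (rule zero_left) (use that in \<open>simp_all add: Hom_iff\<close>)
  have codiag: "codiagonal C S b = addition (Fst S b b) (Snd S b b)" if b: "b \<in> Obj C" for b
  proof -
    let ?z = "neutral b b" and ?p = "Prod S b b"
    let ?i = "pairing C S (Ide C b) ?z" and ?j = "pairing C S ?z (Ide C b)"
    have z: "?z \<in> Arr C" "Dom C ?z = b" "Cod C ?z = b" using zero[OF b b] by (simp_all add: Hom_iff)
    have F: "Fst S b b \<in> Hom C ?p b" "Snd S b b \<in> Hom C ?p b" using b by (simp_all add: Hom_iff)
    have ij: "?i \<in> Hom C b ?p" "?j \<in> Hom C b ?p" using b z by (simp_all add: Hom_iff)
    have iF: "?i \<cdot>\<^bsub>C\<^esub> Fst S b b \<in> Hom C ?p ?p" "?j \<cdot>\<^bsub>C\<^esub> Snd S b b \<in> Hom C ?p ?p"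
      using Comp_Hom F ij by blast+
    have "addition (?i \<cdot>\<^bsub>C\<^esub> Fst S b b) (?j \<cdot>\<^bsub>C\<^esub> Snd S b b) = Ide C ?p" (is "?l = _")
    proof (rule product_ext[of _ _ b b])
      have l: "?l \<in> Hom C ?p ?p" using closed iF by blast
      then show "?l \<in> Arr C" "Dom C ?l = Dom C (Ide C ?p)" "Cod C ?l = Prod S b b"
        using b by (simp_all add: Hom_iff)
      have "Fst S b b \<cdot>\<^bsub>C\<^esub> ?l = addition ((Fst S b b \<cdot>\<^bsub>C\<^esub> ?i) \<cdot>\<^bsub>C\<^esub> Fst S b b) ((Fst S b b \<cdot>\<^bsub>C\<^esub> ?j) \<cdot>\<^bsub>C\<^esub> Snd S b b)"
        unfolding Comp_addition[OF iF F(1)] using b z by (simp add: assoc del: Fst_pairing Snd_pairing)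
      then show "Fst S b b \<cdot>\<^bsub>C\<^esub> ?l = Fst S b b \<cdot>\<^bsub>C\<^esub> Ide C ?p"
        using b z zero_left[OF F(2) b] r_one[OF F(1)] by simp
      have "Snd S b b \<cdot>\<^bsub>C\<^esub> ?l = addition ((Snd S b b \<cdot>\<^bsub>C\<^esub> ?i) \<cdot>\<^bsub>C\<^esub> Fst S b b) ((Snd S b b \<cdot>\<^bsub>C\<^esub> ?j) \<cdot>\<^bsub>C\<^esub> Snd S b b)"
        unfolding Comp_addition[OF iF F(2)] using b z by (simp add: assoc del: Fst_pairing Snd_pairing)
      then show "Snd S b b \<cdot>\<^bsub>C\<^esub> ?l = Snd S b b \<cdot>\<^bsub>C\<^esub> Ide C ?p"
        using b z zero_left[OF F(1) b] l_one[OF F(2)] by simp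
    qed (use b in simp_all)
    note id = this
    have s: "addition (Fst S b b) (Snd S b b) \<in> Hom C ?p b" using closed F by blast
    have zb: "from_zero C S b \<cdot>\<^bsub>C\<^esub> to_one C S b = ?z" using zero_arr[OF b b] by (simp add: zero_arr_def)
    show ?thesis
      unfolding codiagonal_def Let_def zb
    proof (rule the_equality)
      have "addition (Fst S b b) (Snd S b b) \<cdot>\<^bsub>C\<^esub> ?i = Ide C b"
        using addition_Comp[OF ij(1) F] b z r_one[of "Ide C b" b b] by (simp add: Hom_iff)
      moreover have "addition (Fst S b b) (Snd S b b) \<cdot>\<^bsub>C\<^esub> ?j = Ide C b"
        using addition_Comp[OF ij(2) F] b z l_one[of "Ide C b" b b] by (simp add: Hom_iff)
      ultimately show "addition (Fst S b b) (Snd S b b) \<in> Hom C ?p b \<and>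
        addition (Fst S b b) (Snd S b b) \<cdot>\<^bsub>C\<^esub> ?i = Ide C b \<and> addition (Fst S b b) (Snd S b b) \<cdot>\<^bsub>C\<^esub> ?j = Ide C b"
        using s by blast
      fix r assume "r \<in> Hom C ?p b \<and> r \<cdot>\<^bsub>C\<^esub> ?i = Ide C b \<and> r \<cdot>\<^bsub>C\<^esub> ?j = Ide C b"
      then have r: "r \<in> Hom C ?p b" "r \<cdot>\<^bsub>C\<^esub> ?i = Ide C b" "r \<cdot>\<^bsub>C\<^esub> ?j = Ide C b" by blast+
      have "r = r \<cdot>\<^bsub>C\<^esub> addition (?i \<cdot>\<^bsub>C\<^esub> Fst S b b) (?j \<cdot>\<^bsub>C\<^esub> Snd S b b)"
        using r(1) unfolding id by (simp add: Hom_iff)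
      also have "\<dots> = addition (r \<cdot>\<^bsub>C\<^esub> (?i \<cdot>\<^bsub>C\<^esub> Fst S b b)) (r \<cdot>\<^bsub>C\<^esub> (?j \<cdot>\<^bsub>C\<^esub> Snd S b b))" by (rule Comp_addition[OF iF r(1)])
      also have "r \<cdot>\<^bsub>C\<^esub> (?i \<cdot>\<^bsub>C\<^esub> Fst S b b) = (r \<cdot>\<^bsub>C\<^esub> ?i) \<cdot>\<^bsub>C\<^esub> Fst S b b"
        using r(1) ij F by (intro assoc[symmetric]) (simp_all add: Hom_iff)
      also have "r \<cdot>\<^bsub>C\<^esub> (?j \<cdot>\<^bsub>C\<^esub> Snd S b b) = (r \<cdot>\<^bsub>C\<^esub> ?j) \<cdot>\<^bsub>C\<^esub> Snd S b b"
        using r(1) ij F by (intro assoc[symmetric]) (simp_all add: Hom_iff)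
      finally show "r = addition (Fst S b b) (Snd S b b)" using r(2,3) b by simp
    qed
  qed
  show "a \<in> Obj C \<Longrightarrow> b \<in> Obj C \<Longrightarrow> neutral a b \<in> Hom C a b"
    "p \<in> Hom C a b \<Longrightarrow> q \<in> Hom C a b \<Longrightarrow> addition p q \<in> Hom C a b"
    "h \<in> Hom C (One S) b \<Longrightarrow> h = neutral (One S) b" "b \<in> Obj C \<Longrightarrow> from_zero C S b = neutral (One S) b"
    "a \<in> Obj C \<Longrightarrow> b \<in> Obj C \<Longrightarrow> zero_arr C S a b = neutral a b"
    "b \<in> Obj C \<Longrightarrow> codiagonal C S b = addition (Fst S b b) (Snd S b b)"
    by (fact zero closed initial from_zero zero_arr codiag)+
qed

lemma sum_arr_eq:
  assumes "p \<in> Arr C" "q \<in> Arr C" "Dom C p = Dom C q" "Cod C p = Cod C q"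
  shows "sum_arr C S p q = addition p q"
  using addition_Comp[of "pairing C S p q" "Dom C q" "Prod S (Cod C q) (Cod C q)"
      "Fst S (Cod C q) (Cod C q)" "Cod C q" "Snd S (Cod C q) (Cod C q)"] assms
  by (simp add: sum_arr_def codiagonal_eq Hom_iff)

lemma from_zero_simps [simp]:
  assumes "b \<in> Obj C"
  shows "from_zero C S b \<in> Arr C" "Dom C (from_zero C S b) = One S" "Cod C (from_zero C S b) = b"
  using zero_Hom[of "One S" b] assms by (simp_all add: from_zero_eq Hom_iff)

lemma from_zero_unique: "\<lbrakk>h \<in> Arr C; Dom C h = One S; b = Cod C h\<rbrakk> \<Longrightarrow> h = from_zero C S b"
  using initial[of h b] by (simp add: from_zero_eq Hom_iff)

lemma zero_arr_simps [simp]: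
  assumes "a \<in> Obj C" "b \<in> Obj C"
  shows "zero_arr C S a b \<in> Arr C" "Dom C (zero_arr C S a b) = a" "Cod C (zero_arr C S a b) = b"
  using assms by (simp_all add: zero_arr_def)

lemma Comp_from_zero: "\<lbrakk>f \<in> Arr C; b = Dom C f\<rbrakk> \<Longrightarrow> f \<cdot>\<^bsub>C\<^esub> from_zero C S b = from_zero C S (Cod C f)"
  by (rule from_zero_unique) simp_all

lemma Comp_zero_arr:
  "\<lbrakk>f \<in> Arr C; b = Dom C f; a \<in> Obj C\<rbrakk> \<Longrightarrow> f \<cdot>\<^bsub>C\<^esub> zero_arr C S a b = zero_arr C S a (Cod C f)"
  by (simp add: zero_arr_def Comp_from_zero flip: assoc)

lemma codiagonal_simps [simp]:
  assumes b: "b \<in> Obj C"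
  shows "codiagonal C S b \<in> Arr C" "Dom C (codiagonal C S b) = Prod S b b" "Cod C (codiagonal C S b) = b"
  using plus_Hom[OF Fst_Hom[OF b b] Snd_Hom[OF b b]] b by (simp_all add: codiagonal_eq Hom_iff)

lemma sum_simps [simp]:
  assumes "p \<in> Arr C" "q \<in> Arr C" "Dom C p = Dom C q" "Cod C p = Cod C q"
  shows "sum_arr C S p q \<in> Arr C" "Dom C (sum_arr C S p q) = Dom C q" "Cod C (sum_arr C S p q) = Cod C q"
  using assms by (simp_all add: sum_arr_def)

lemma sum_Fst_Snd: "b \<in> Obj C \<Longrightarrow> sum_arr C S (Fst S b b) (Snd S b b) = codiagonal C S b"
  by (simp add: sum_arr_def)

lemma Comp_sum:
  assumes "p \<in> Arr C" "q \<in> Arr C" "Dom C p = Dom C q" "Cod C p = Cod C q" "f \<in> Arr C" "Dom C f = Cod C q"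
  shows "f \<cdot>\<^bsub>C\<^esub> sum_arr C S p q = sum_arr C S (f \<cdot>\<^bsub>C\<^esub> p) (f \<cdot>\<^bsub>C\<^esub> q)"
  using Comp_addition[of p "Dom C q" "Cod C q" q f "Cod C f"] assms by (simp add: sum_arr_eq Hom_iff)

lemma sum_assoc:
  assumes "p \<in> Arr C" "q \<in> Arr C" "r \<in> Arr C" "Dom C p = Dom C q" "Cod C p = Cod C q"
    "Dom C q = Dom C r" "Cod C q = Cod C r"
  shows "sum_arr C S (sum_arr C S p q) r = sum_arr C S p (sum_arr C S q r)"
proof -
  interpret G: comm_group "\<lparr>carrier = Hom C (Dom C r) (Cod C r), monoid.mult = addition, one = neutral (Dom C r) (Cod C r)\<rparr>"
    using assms by (intro addition_comm_group) simp_all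
  have m: "p \<in> Hom C (Dom C r) (Cod C r)" "q \<in> Hom C (Dom C r) (Cod C r)" "r \<in> Hom C (Dom C r) (Cod C r)"
    using assms by (simp_all add: Hom_iff)
  have "addition p q \<in> Hom C (Dom C r) (Cod C r)" "addition q r \<in> Hom C (Dom C r) (Cod C r)"
    using plus_Hom m by blast+
  then show ?thesis using G.m_assoc[of p q r] m assms by (simp add: sum_arr_eq Hom_iff)
qed

lemma sum_commute:
  assumes "p \<in> Arr C" "q \<in> Arr C" "Dom C p = Dom C q" "Cod C p = Cod C q"
  shows "sum_arr C S p q = sum_arr C S q p"
proof -
  interpret G: comm_group "\<lparr>carrier = Hom C (Dom C q) (Cod C q), monoid.mult = addition, one = neutral (Dom C q) (Cod C q)\<rparr>"
    using assms by (intro addition_comm_group) simp_all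
  show ?thesis using G.m_comm[of p q] assms by (simp add: sum_arr_eq Hom_iff)
qed

lemma sum_zero:
  assumes p: "p \<in> Arr C" "a = Dom C p" "b = Cod C p"
  shows "sum_arr C S (zero_arr C S a b) p = p" "sum_arr C S p (zero_arr C S a b) = p"
proof -
  have ab: "a \<in> Obj C" "b \<in> Obj C" using p by simp_all
  interpret G: comm_group "\<lparr>carrier = Hom C a b, monoid.mult = addition, one = neutral a b\<rparr>"
    using ab by (rule addition_comm_group)
  have "addition (neutral a b) p = p" using G.l_one[of p] p by (simp add: Hom_iff)
  then show *: "sum_arr C S (zero_arr C S a b) p = p"
    using p ab sum_arr_eq[of "zero_arr C S a b" p] zero_arr_eq[of a b] by simp
  have "sum_arr C S p (zero_arr C S a b) = sum_arr C S (zero_arr C S a b) p"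
    using p ab by (intro sum_commute) simp_all
  then show "sum_arr C S p (zero_arr C S a b) = p" using * by (rule trans)
qed

lemma negative:
  assumes b: "b \<in> Obj C"
  obtains n where "n \<in> Arr C" "Dom C n = b" "Cod C n = b"
    "sum_arr C S (Ide C b) n = zero_arr C S b b" "sum_arr C S n (Ide C b) = zero_arr C S b b"
proof -
  interpret G: comm_group "\<lparr>carrier = Hom C b b, monoid.mult = addition, one = neutral b b\<rparr>"
    using b b by (rule addition_comm_group)
  obtain n where n: "n \<in> Hom C b b" "addition n (Ide C b) = neutral b b"
    using G.l_inv_ex[of "Ide C b"] Ide_Hom[OF b] by auto
  moreover have "addition (Ide C b) n = addition n (Ide C b)"
    using G.m_comm[of "Ide C b" n] n Ide_Hom[OF b] by simp
  ultimately show ?thesis using that[of n] b by (simp add: sum_arr_eq zero_arr_eq Hom_iff)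
qed

end

section \<open>The symmetric 2-groups over an additive base\<close>

locale additive_groupoidal_opfibration =
  P: groupoidal_opfibration X B P + X: finite_products X SX + B: additive_category B SB
  for X :: "('o, 'm) cat" and SX and B :: "('p, 'n) cat" and SB and P +
  fixes k
  assumes strict: "strictly_preserves_products X SX SB P"
    and cleavage: "cleavage X B P k"
begin

sublocale PP: product_functor X SX B SB P
  by unfold_locales (rule strict)

lemma k_simps [simp]:
  assumes "x \<in> Obj X" "f \<in> Arr B" "Dom B f = fob P x"
  shows "k f x \<in> Arr X" "Dom X (k f x) = x" "far P (k f x) = f"
    "fob P (Cod X (k f x)) = Cod B f"
proof -
  have "cocartesian X B P (k f x)"
    and *: "Dom X (k f x) = x" "far P (k f x) = f"
    using cleavage assms by (simp_all add: cleavage_def)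
  then show **: "k f x \<in> Arr X" by (simp add: cocartesian_def)
  show "Dom X (k f x) = x" "far P (k f x) = f" using * .
  show "fob P (Cod X (k f x)) = Cod B f" using P.far_simps(3)[OF **] *(2) by simp
qed

lemma induced [simp]:
  assumes "c \<in> Arr X" "d \<in> Arr X" "Dom X d = Dom X c" "far P d = far P c"
  shows "induced X B P c d \<in> Arr X" "Dom X (induced X B P c d) = Cod X c"
    "Cod X (induced X B P c d) = Cod X d" "far P (induced X B P c d) = Ide B (fob P (Cod X c))"
    "induced X B P c d \<cdot>\<^bsub>X\<^esub> c = d"
  using P.induced[OF P.all_cocartesian[OF assms(1)] assms(2-4)] by simp_all

definition M :: "'p \<Rightarrow> ('o, 'm) monoidal" where "M b = fibre_monoidal X SX B SB P k b"

abbreviation t where "t \<equiv> to_tensor SX B SB k"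

text \<open>Arrows \<open>p : c \<rightarrow> x\<close> are thought of as generalized elements of \<open>x\<close> at the stage \<open>c\<close>, which
  need not lie in the same fibre as \<open>x\<close>. The tensor product of elements at the same stage lies
  over the sum of their images.\<close>

definition tens :: "'p \<Rightarrow> 'm \<Rightarrow> 'm \<Rightarrow> 'm" where
  "tens b p q = t b (Cod X p) (Cod X q) \<cdot>\<^bsub>X\<^esub> pairing X SX p q"

text \<open>The element of the unit object obtained from the unique element \<open>c \<rightarrow> 1\<close>; it lies over a zero
  arrow.\<close>

definition unit_elt :: "'p \<Rightarrow> 'o \<Rightarrow> 'm" where
  "unit_elt b c = to_unit SX B SB k b \<cdot>\<^bsub>X\<^esub> to_one X SX c"

lemma t_simps [simp]:
  assumes "x \<in> Obj X" "y \<in> Obj X" "fob P x = b" "fob P y = b"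
  shows "t b x y \<in> Arr X" "Dom X (t b x y) = Prod SX x y" "Cod X (t b x y) = tensor (M b) x y"
    "far P (t b x y) = codiagonal B SB b" "tensor (M b) x y \<in> Obj X" "fob P (tensor (M b) x y) = b"
proof -
  have b: "b \<in> Obj B" using assms by auto
  show 1: "t b x y \<in> Arr X" "Dom X (t b x y) = Prod SX x y" "far P (t b x y) = codiagonal B SB b"
    using assms b by (simp_all add: to_tensor_def)
  show 2: "Cod X (t b x y) = tensor (M b) x y" by (simp add: M_def fibre_monoidal_def Let_def)
  show "tensor (M b) x y \<in> Obj X" using 1 by (simp flip: 2)
  show "fob P (tensor (M b) x y) = b" using assms b by (simp add: to_tensor_def flip: 2)
qed

lemma tens_simps [simp]:
  assumes "p \<in> Arr X" "q \<in> Arr X" "Dom X p = Dom X q" "fob P (Cod X p) = b" "fob P (Cod X q) = b"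
  shows "tens b p q \<in> Arr X" "Dom X (tens b p q) = Dom X q"
    "Cod X (tens b p q) = tensor (M b) (Cod X p) (Cod X q)"
    "far P (tens b p q) = sum_arr B SB (far P p) (far P q)"
  using assms by (simp_all add: tens_def sum_arr_def)

lemma tens_Comp [simp]:
  assumes "p \<in> Arr X" "q \<in> Arr X" "Dom X p = Dom X q" "fob P (Cod X p) = b" "fob P (Cod X q) = b"
    "h \<in> Arr X" "Cod X h = Dom X q"
  shows "tens b p q \<cdot>\<^bsub>X\<^esub> h = tens b (p \<cdot>\<^bsub>X\<^esub> h) (q \<cdot>\<^bsub>X\<^esub> h)"
  using assms by (simp add: tens_def X.pairing_Comp P.A.assoc)

lemma t_eq_tens: "\<lbrakk>x \<in> Obj X; y \<in> Obj X; fob P x = b; fob P y = b\<rbrakk> \<Longrightarrow> t b x y = tens b (Fst SX x y) (Snd SX x y)"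
  by (simp add: tens_def)

lemma t_pairing [simp]:
  "\<lbrakk>p \<in> Arr X; q \<in> Arr X; Cod X p = x; Cod X q = y\<rbrakk> \<Longrightarrow> t b x y \<cdot>\<^bsub>X\<^esub> pairing X SX p q = tens b p q"
  by (simp add: tens_def)

lemma t_prod_arr [simp]:
  "\<lbrakk>p \<in> Arr X; q \<in> Arr X; Cod X p = x; Cod X q = y\<rbrakk> \<Longrightarrow> t b x y \<cdot>\<^bsub>X\<^esub> prod_arr X SX p q
    = tens b (p \<cdot>\<^bsub>X\<^esub> Fst SX (Dom X p) (Dom X q)) (q \<cdot>\<^bsub>X\<^esub> Snd SX (Dom X p) (Dom X q))"
  by (simp add: prod_arr_def)

lemma unit_simps [simp]:
  assumes "b \<in> Obj B"
  shows "to_unit SX B SB k b \<in> Arr X" "Dom X (to_unit SX B SB k b) = One SX"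
    "Cod X (to_unit SX B SB k b) = unit_obj (M b)" "far P (to_unit SX B SB k b) = from_zero B SB b"
    "unit_obj (M b) \<in> Obj X" "fob P (unit_obj (M b)) = b"
proof -
  show 1: "to_unit SX B SB k b \<in> Arr X" "Dom X (to_unit SX B SB k b) = One SX"
     "far P (to_unit SX B SB k b) = from_zero B SB b"
    using assms by (simp_all add: to_unit_def)
  show 2: "Cod X (to_unit SX B SB k b) = unit_obj (M b)" by (simp add: M_def fibre_monoidal_def Let_def)
  show "unit_obj (M b) \<in> Obj X" using 1 by (simp flip: 2)
  show "fob P (unit_obj (M b)) = b" using assms by (simp add: to_unit_def flip: 2)
qed

lemma unit_elt_simps [simp]:
  assumes "b \<in> Obj B" "c \<in> Obj X"
  shows "unit_elt b c \<in> Arr X" "Dom X (unit_elt b c) = c" "Cod X (unit_elt b c) = unit_obj (M b)"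
    "far P (unit_elt b c) = zero_arr B SB (fob P c) b"
  using assms by (simp_all add: unit_elt_def zero_arr_def)

lemma unit_elt_Comp [simp]:
  assumes "b \<in> Obj B" "h \<in> Arr X" "c = Cod X h"
  shows "unit_elt b c \<cdot>\<^bsub>X\<^esub> h = unit_elt b (Dom X h)"
  using assms X.to_one_unique[of "to_one X SX c \<cdot>\<^bsub>X\<^esub> h"] by (simp add: unit_elt_def P.A.assoc)

lemma tensor_arr_simps [simp]:
  assumes "f \<in> Arr X" "g \<in> Arr X" "far P f = Ide B b" "far P g = Ide B b" "b \<in> Obj B"
  shows "tensor_arr (M b) f g \<in> Arr X"
    "Dom X (tensor_arr (M b) f g) = tensor (M b) (Dom X f) (Dom X g)"
    "Cod X (tensor_arr (M b) f g) = tensor (M b) (Cod X f) (Cod X g)"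
    "far P (tensor_arr (M b) f g) = Ide B b"
    and tensor_arr_tens [simp]: "\<lbrakk>p \<in> Arr X; q \<in> Arr X; Dom X p = Dom X q; Cod X p = Dom X f; Cod X q = Dom X g\<rbrakk>
      \<Longrightarrow> tensor_arr (M b) f g \<cdot>\<^bsub>X\<^esub> tens b p q = tens b (f \<cdot>\<^bsub>X\<^esub> p) (g \<cdot>\<^bsub>X\<^esub> q)"
proof -
  note ob [simp] = P.vertical_objects[OF assms(1,3,5)] P.vertical_objects[OF assms(2,4,5)]
  let ?c = "t b (Dom X f) (Dom X g)" and ?d = "t b (Cod X f) (Cod X g) \<cdot>\<^bsub>X\<^esub> prod_arr X SX f g"
  have eq: "tensor_arr (M b) f g = induced X B P ?c ?d"
    by (simp add: M_def fibre_monoidal_def Let_def)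
  have d: "?c \<in> Arr X" "?d \<in> Arr X" "Dom X ?d = Dom X ?c" "far P ?d = far P ?c"
    using assms by (simp_all add: B.sum_Fst_Snd)
  note i = induced[OF d, folded eq]
  show ty: "tensor_arr (M b) f g \<in> Arr X"
    "Dom X (tensor_arr (M b) f g) = tensor (M b) (Dom X f) (Dom X g)"
    "Cod X (tensor_arr (M b) f g) = tensor (M b) (Cod X f) (Cod X g)"
    "far P (tensor_arr (M b) f g) = Ide B b"
    using i assms by simp_all
  assume pq: "p \<in> Arr X" "q \<in> Arr X" "Dom X p = Dom X q" "Cod X p = Dom X f" "Cod X q = Dom X g"
  have "tensor_arr (M b) f g \<cdot>\<^bsub>X\<^esub> tens b p q = (tensor_arr (M b) f g \<cdot>\<^bsub>X\<^esub> ?c) \<cdot>\<^bsub>X\<^esub> pairing X SX p q"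
    unfolding tens_def pq(4,5) using pq assms ty by (intro P.A.assoc[symmetric]) simp_all
  also have "\<dots> = tens b (f \<cdot>\<^bsub>X\<^esub> p) (g \<cdot>\<^bsub>X\<^esub> q)"
    unfolding i(5) using pq assms by (simp add: P.A.assoc)
  finally show "tensor_arr (M b) f g \<cdot>\<^bsub>X\<^esub> tens b p q = tens b (f \<cdot>\<^bsub>X\<^esub> p) (g \<cdot>\<^bsub>X\<^esub> q)" .
qed

text \<open>A structure arrow is defined by its composite with one generic element; by naturality in
  the stage this determines its value on all elements.\<close>

lemma induced_at:
  assumes "c \<in> Arr X" "d \<in> Arr X" "Dom X d = Dom X c" "far P d = far P c"
    and "m \<in> Arr X" "Cod X m = Dom X c" "c \<cdot>\<^bsub>X\<^esub> m = e" "d \<cdot>\<^bsub>X\<^esub> m = e'"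
  shows "induced X B P c d \<cdot>\<^bsub>X\<^esub> e = e'"
proof -
  note i = induced[OF assms(1-4)]
  have "induced X B P c d \<cdot>\<^bsub>X\<^esub> (c \<cdot>\<^bsub>X\<^esub> m) = (induced X B P c d \<cdot>\<^bsub>X\<^esub> c) \<cdot>\<^bsub>X\<^esub> m"
    using i(1-3) assms(1,5,6) by (intro P.A.assoc[symmetric]) simp_all
  then show ?thesis unfolding i(5) assms(7,8) .
qed

lemma associator_simps [simp]:
  assumes "x \<in> Obj X" "y \<in> Obj X" "z \<in> Obj X" "fob P x = b" "fob P y = b" "fob P z = b"
  shows "associator (M b) x y z \<in> Arr X"
    "Dom X (associator (M b) x y z) = tensor (M b) (tensor (M b) x y) z"
    "Cod X (associator (M b) x y z) = tensor (M b) x (tensor (M b) y z)"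
    "far P (associator (M b) x y z) = Ide B b"
    and associator_tens [simp]: "\<lbrakk>p \<in> Arr X; q \<in> Arr X; r \<in> Arr X; Dom X p = Dom X q; Dom X q = Dom X r;
        Cod X p = x; Cod X q = y; Cod X r = z\<rbrakk>
      \<Longrightarrow> associator (M b) x y z \<cdot>\<^bsub>X\<^esub> tens b (tens b p q) r = tens b p (tens b q r)"
proof -
  have b: "b \<in> Obj B" using assms by auto
  define c where "c = t b (Cod X (t b x y)) z \<cdot>\<^bsub>X\<^esub> prod_arr X SX (t b x y) (Ide X z)"
  define d where "d = t b x (Cod X (t b y z)) \<cdot>\<^bsub>X\<^esub> prod_arr X SX (Ide X x) (t b y z) \<cdot>\<^bsub>X\<^esub> prod_assoc X SX x y z"
  have eq: "associator (M b) x y z = induced X B P c d"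
    by (simp add: M_def fibre_monoidal_def Let_def c_def d_def)
  let ?p = "Fst SX x y \<cdot>\<^bsub>X\<^esub> Fst SX (Prod SX x y) z" and ?q = "Snd SX x y \<cdot>\<^bsub>X\<^esub> Fst SX (Prod SX x y) z"
    and ?r = "Snd SX (Prod SX x y) z"
  have c: "c = tens b (tens b ?p ?q) ?r" using assms by (simp add: c_def t_eq_tens)
  have d: "d = tens b ?p (tens b ?q ?r)" using assms by (simp add: d_def t_eq_tens prod_assoc_def P.A.assoc)
  have cd: "c \<in> Arr X" "d \<in> Arr X" "Dom X d = Dom X c" "far P d = far P c"
    unfolding c d using assms b by (simp_all add: B.sum_assoc)
  note i = induced[OF cd, folded eq]
  show "associator (M b) x y z \<in> Arr X"
    "Dom X (associator (M b) x y z) = tensor (M b) (tensor (M b) x y) z"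
    "Cod X (associator (M b) x y z) = tensor (M b) x (tensor (M b) y z)"
    "far P (associator (M b) x y z) = Ide B b"
    using i(1-4) assms b by (simp_all add: c d)
  assume e: "p \<in> Arr X" "q \<in> Arr X" "r \<in> Arr X" "Dom X p = Dom X q" "Dom X q = Dom X r"
    "Cod X p = x" "Cod X q = y" "Cod X r = z"
  show "associator (M b) x y z \<cdot>\<^bsub>X\<^esub> tens b (tens b p q) r = tens b p (tens b q r)"
    unfolding eq
    by (rule induced_at[OF cd, of "pairing X SX (pairing X SX p q) r"])
      (use e assms b in \<open>simp_all add: c d P.A.assoc\<close>)
qed

lemma to_one_One [simp]: "to_one X SX (One SX) = Ide X (One SX)"
  using X.to_one_unique[of "Ide X (One SX)"] by simp

lemma to_unit_eq: "b \<in> Obj B \<Longrightarrow> to_unit SX B SB k b = unit_elt b (One SX)"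
  by (simp add: unit_elt_def)

lemma lunitor_simps [simp]:
  assumes "x \<in> Obj X" "fob P x = b"
  shows "lunitor (M b) x \<in> Arr X" "Dom X (lunitor (M b) x) = tensor (M b) (unit_obj (M b)) x"
    "Cod X (lunitor (M b) x) = x" "far P (lunitor (M b) x) = Ide B b"
    and lunitor_tens [simp]: "\<lbrakk>p \<in> Arr X; Cod X p = x; c = Dom X p\<rbrakk>
      \<Longrightarrow> lunitor (M b) x \<cdot>\<^bsub>X\<^esub> tens b (unit_elt b c) p = p"
proof -
  have b: "b \<in> Obj B" using assms by auto
  define c' where "c' = t b (Cod X (to_unit SX B SB k b)) x \<cdot>\<^bsub>X\<^esub> prod_arr X SX (to_unit SX B SB k b) (Ide X x)"
  have eq: "lunitor (M b) x = induced X B P c' (Snd SX (One SX) x)"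
    by (simp add: M_def fibre_monoidal_def Let_def c'_def)
  have c: "c' = tens b (unit_elt b (Prod SX (One SX) x)) (Snd SX (One SX) x)"
    using assms b by (simp add: c'_def t_eq_tens to_unit_eq)
  have cd: "c' \<in> Arr X" "Snd SX (One SX) x \<in> Arr X" "Dom X (Snd SX (One SX) x) = Dom X c'"
    "far P (Snd SX (One SX) x) = far P c'"
    unfolding c using assms b by (simp_all add: B.sum_zero)
  note i = induced[OF cd, folded eq]
  show "lunitor (M b) x \<in> Arr X" "Dom X (lunitor (M b) x) = tensor (M b) (unit_obj (M b)) x"
    "Cod X (lunitor (M b) x) = x" "far P (lunitor (M b) x) = Ide B b"
    using i(1-4) assms b by (simp_all add: c)
  assume e: "p \<in> Arr X" "Cod X p = x" "c = Dom X p"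
  show "lunitor (M b) x \<cdot>\<^bsub>X\<^esub> tens b (unit_elt b c) p = p"
    unfolding eq
    by (rule induced_at[OF cd, of "pairing X SX (to_one X SX c) p"])
      (use e assms b in \<open>simp_all add: c\<close>)
qed

lemma runitor_simps [simp]:
  assumes "x \<in> Obj X" "fob P x = b"
  shows "runitor (M b) x \<in> Arr X" "Dom X (runitor (M b) x) = tensor (M b) x (unit_obj (M b))"
    "Cod X (runitor (M b) x) = x" "far P (runitor (M b) x) = Ide B b"
    and runitor_tens [simp]: "\<lbrakk>p \<in> Arr X; Cod X p = x; c = Dom X p\<rbrakk>
      \<Longrightarrow> runitor (M b) x \<cdot>\<^bsub>X\<^esub> tens b p (unit_elt b c) = p"
proof -
  have b: "b \<in> Obj B" using assms by auto
  define c' where "c' = t b x (Cod X (to_unit SX B SB k b)) \<cdot>\<^bsub>X\<^esub> prod_arr X SX (Ide X x) (to_unit SX B SB k b)"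
  have eq: "runitor (M b) x = induced X B P c' (Fst SX x (One SX))"
    by (simp add: M_def fibre_monoidal_def Let_def c'_def)
  have c: "c' = tens b (Fst SX x (One SX)) (unit_elt b (Prod SX x (One SX)))"
    using assms b by (simp add: c'_def t_eq_tens to_unit_eq)
  have cd: "c' \<in> Arr X" "Fst SX x (One SX) \<in> Arr X" "Dom X (Fst SX x (One SX)) = Dom X c'"
    "far P (Fst SX x (One SX)) = far P c'"
    unfolding c using assms b by (simp_all add: B.sum_zero)
  note i = induced[OF cd, folded eq]
  show "runitor (M b) x \<in> Arr X" "Dom X (runitor (M b) x) = tensor (M b) x (unit_obj (M b))"
    "Cod X (runitor (M b) x) = x" "far P (runitor (M b) x) = Ide B b"
    using i(1-4) assms b by (simp_all add: c)
  assume e: "p \<in> Arr X" "Cod X p = x" "c = Dom X p"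
  show "runitor (M b) x \<cdot>\<^bsub>X\<^esub> tens b p (unit_elt b c) = p"
    unfolding eq
    by (rule induced_at[OF cd, of "pairing X SX p (to_one X SX c)"])
      (use e assms b in \<open>simp_all add: c\<close>)
qed

lemma braiding_simps [simp]:
  assumes "x \<in> Obj X" "y \<in> Obj X" "fob P x = b" "fob P y = b"
  shows "braiding (M b) x y \<in> Arr X" "Dom X (braiding (M b) x y) = tensor (M b) x y"
    "Cod X (braiding (M b) x y) = tensor (M b) y x" "far P (braiding (M b) x y) = Ide B b"
    and braiding_tens [simp]: "\<lbrakk>p \<in> Arr X; q \<in> Arr X; Dom X p = Dom X q; Cod X p = x; Cod X q = y\<rbrakk>
      \<Longrightarrow> braiding (M b) x y \<cdot>\<^bsub>X\<^esub> tens b p q = tens b q p"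
proof -
  have b: "b \<in> Obj B" using assms by auto
  define d where "d = t b y x \<cdot>\<^bsub>X\<^esub> prod_swap X SX x y"
  have eq: "braiding (M b) x y = induced X B P (t b x y) d"
    by (simp add: M_def fibre_monoidal_def Let_def d_def)
  have c: "t b x y = tens b (Fst SX x y) (Snd SX x y)" using assms by (rule t_eq_tens)
  have d: "d = tens b (Snd SX x y) (Fst SX x y)"
    using assms by (simp add: d_def t_eq_tens prod_swap_def)
  have cd: "t b x y \<in> Arr X" "d \<in> Arr X" "Dom X d = Dom X (t b x y)" "far P d = far P (t b x y)"
    unfolding c d using assms b by (simp_all add: B.sum_commute)
  note i = induced[OF cd, folded eq]
  show "braiding (M b) x y \<in> Arr X" "Dom X (braiding (M b) x y) = tensor (M b) x y"
    "Cod X (braiding (M b) x y) = tensor (M b) y x" "far P (braiding (M b) x y) = Ide B b"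
    using i(1-4) assms b by (simp_all add: d)
  assume e: "p \<in> Arr X" "q \<in> Arr X" "Dom X p = Dom X q" "Cod X p = x" "Cod X q = y"
  show "braiding (M b) x y \<cdot>\<^bsub>X\<^esub> tens b p q = tens b q p"
    unfolding eq
    by (rule induced_at[OF cd, of "pairing X SX p q"])
      (use e assms b in \<open>simp_all add: d\<close>)
qed

text \<open>By \<open>arrow_ext\<close>, parallel vertical arrows are equal as soon as they agree on one element. So
  each coherence condition is checked on a tuple of elements at a common stage, which exists:
  take the projections of a product.\<close>

lemma elements:
  assumes "w \<in> Obj X" "x \<in> Obj X" "y \<in> Obj X" "z \<in> Obj X"
  obtains c p q r s where "c \<in> Obj X"
    "p \<in> Arr X" "Dom X p = c" "Cod X p = w" "q \<in> Arr X" "Dom X q = c" "Cod X q = x"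
    "r \<in> Arr X" "Dom X r = c" "Cod X r = y" "s \<in> Arr X" "Dom X s = c" "Cod X s = z"
proof -
  let ?a = "Prod SX w x" and ?b = "Prod SX y z"
  show ?thesis
    by (rule that[of "Prod SX ?a ?b" "Fst SX w x \<cdot>\<^bsub>X\<^esub> Fst SX ?a ?b" "Snd SX w x \<cdot>\<^bsub>X\<^esub> Fst SX ?a ?b"
        "Fst SX y z \<cdot>\<^bsub>X\<^esub> Snd SX ?a ?b" "Snd SX y z \<cdot>\<^bsub>X\<^esub> Snd SX ?a ?b"])
      (use assms in simp_all)
qed

lemma elements_2:
  assumes "x \<in> Obj X" "y \<in> Obj X"
  obtains c p q where "c \<in> Obj X" "p \<in> Arr X" "Dom X p = c" "Cod X p = x"
    "q \<in> Arr X" "Dom X q = c" "Cod X q = y"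
  by (rule elements[OF assms assms]) (rule that)

lemma elements_3:
  assumes "x \<in> Obj X" "y \<in> Obj X" "z \<in> Obj X"
  obtains c p q r where "c \<in> Obj X" "p \<in> Arr X" "Dom X p = c" "Cod X p = x"
    "q \<in> Arr X" "Dom X q = c" "Cod X q = y" "r \<in> Arr X" "Dom X r = c" "Cod X r = z"
  by (rule elements[OF assms assms(1)]) (rule that)

lemma fibre_HomD:
  assumes "f \<in> Hom (fibre X B P b) x y" "b \<in> Obj B"
  shows "f \<in> Arr X" "Dom X f = x" "Cod X f = y" "far P f = Ide B b"
    "x \<in> Obj X" "y \<in> Obj X" "fob P x = b" "fob P y = b"
proof -
  show f: "f \<in> Arr X" "Dom X f = x" "Cod X f = y" "far P f = Ide B b"
    using assms(1) by (simp_all add: Hom_iff)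
  show "x \<in> Obj X" "y \<in> Obj X" "fob P x = b" "fob P y = b"
    using f P.vertical_objects[OF f(1,4) assms(2)] by auto
qed

lemma fibre_groupoid: "b \<in> Obj B \<Longrightarrow> groupoid (fibre X B P b)"
  using P.groupoidal by (simp add: groupoidal_fibres_def)

lemma fibre_iso:
  "\<lbrakk>f \<in> Arr X; far P f = Ide B b; b \<in> Obj B\<rbrakk> \<Longrightarrow> is_iso (fibre X B P b) f"
  using groupoid.all_iso[OF fibre_groupoid] by simp

text \<open>Each equation of arrows follows by evaluating both sides on elements; the other conditions
  concern domains, codomains and invertibility, which is automatic in a groupoid.\<close>

lemma fibre_monoidal_category:
  assumes b: "b \<in> Obj B"
  shows "monoidal_category (fibre X B P b) (M b)"
proof -
  interpret category "fibre X B P b" using b by (rule P.category_fibre)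
  show ?thesis
  proof
    show "x \<in> Obj (fibre X B P b) \<Longrightarrow> y \<in> Obj (fibre X B P b) \<Longrightarrow> tensor (M b) x y \<in> Obj (fibre X B P b)" for x y
      by simp
    show "f \<in> Hom (fibre X B P b) x x' \<Longrightarrow> g \<in> Hom (fibre X B P b) y y' \<Longrightarrow>
        tensor_arr (M b) f g \<in> Hom (fibre X B P b) (tensor (M b) x y) (tensor (M b) x' y')" for f g x x' y y'
      using b by (simp add: Hom_iff)
    show "tensor_arr (M b) (Ide (fibre X B P b) x) (Ide (fibre X B P b) y) = Ide (fibre X B P b) (tensor (M b) x y)"
      if xy: "x \<in> Obj (fibre X B P b)" "y \<in> Obj (fibre X B P b)" for x y
    proof -
      have o: "x \<in> Obj X" "y \<in> Obj X" using xy by simp_all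
      obtain c p q where el: "c \<in> Obj X" "p \<in> Arr X" "Dom X p = c" "Cod X p = x" "q \<in> Arr X" "Dom X q = c" "Cod X q = y"
        by (rule elements_2[OF o])
      show ?thesis
        by (rule P.arrow_ext[of "tens b p q"]) (use el xy b in simp_all)
    qed
    show "tensor_arr (M b) (f' \<cdot>\<^bsub>fibre X B P b\<^esub> f) (g' \<cdot>\<^bsub>fibre X B P b\<^esub> g) =
       tensor_arr (M b) f' g' \<cdot>\<^bsub>fibre X B P b\<^esub> tensor_arr (M b) f g"
      if "f \<in> Hom (fibre X B P b) x x'" "f' \<in> Hom (fibre X B P b) x' x''"
         "g \<in> Hom (fibre X B P b) y y'" "g' \<in> Hom (fibre X B P b) y' y''" for f f' g g' x x' x'' y y' y''
    proof -
      note [simp] = that[THEN fibre_HomD(1)] that[THEN fibre_HomD(2)] that[THEN fibre_HomD(3)]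
         that[THEN fibre_HomD(4)] that[THEN fibre_HomD(5)] that[THEN fibre_HomD(6)]
         that[THEN fibre_HomD(7)] that[THEN fibre_HomD(8)]
      note [simp] = b
      have o: "x \<in> Obj X" "y \<in> Obj X" by simp_all
      obtain c p q where el: "c \<in> Obj X" "p \<in> Arr X" "Dom X p = c" "Cod X p = x" "q \<in> Arr X" "Dom X q = c" "Cod X q = y"
        by (rule elements_2[OF o])
      show ?thesis
        by (rule P.arrow_ext[of "tens b p q"]) (use el in \<open>simp_all add: P.A.assoc\<close>)
    qed
    show "unit_obj (M b) \<in> Obj (fibre X B P b)" using b by simp
    show "associator (M b) x y z \<in> Hom (fibre X B P b) (tensor (M b) (tensor (M b) x y) z) (tensor (M b) x (tensor (M b) y z))"
      "is_iso (fibre X B P b) (associator (M b) x y z)"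
      if "x \<in> Obj (fibre X B P b)" "y \<in> Obj (fibre X B P b)" "z \<in> Obj (fibre X B P b)" for x y z
      using that b by (simp_all add: Hom_iff fibre_iso)
    show "associator (M b) x' y' z' \<cdot>\<^bsub>fibre X B P b\<^esub> tensor_arr (M b) (tensor_arr (M b) f g) h =
       tensor_arr (M b) f (tensor_arr (M b) g h) \<cdot>\<^bsub>fibre X B P b\<^esub> associator (M b) x y z"
      if "f \<in> Hom (fibre X B P b) x x'" "g \<in> Hom (fibre X B P b) y y'" "h \<in> Hom (fibre X B P b) z z'"
      for f g h x x' y y' z z'
    proof -
      note [simp] = that[THEN fibre_HomD(1)] that[THEN fibre_HomD(2)] that[THEN fibre_HomD(3)]
         that[THEN fibre_HomD(4)] that[THEN fibre_HomD(5)] that[THEN fibre_HomD(6)]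
         that[THEN fibre_HomD(7)] that[THEN fibre_HomD(8)]
      note [simp] = b
      have o: "x \<in> Obj X" "y \<in> Obj X" "z \<in> Obj X" by simp_all
      obtain c p q r where el: "c \<in> Obj X" "p \<in> Arr X" "Dom X p = c" "Cod X p = x" "q \<in> Arr X" "Dom X q = c" "Cod X q = y"
        "r \<in> Arr X" "Dom X r = c" "Cod X r = z"
        by (rule elements_3[OF o])
      show ?thesis
        by (rule P.arrow_ext[of "tens b (tens b p q) r"]) (use el in \<open>simp_all add: P.A.assoc\<close>)
    qed
    show "lunitor (M b) x \<in> Hom (fibre X B P b) (tensor (M b) (unit_obj (M b)) x) x"
      "is_iso (fibre X B P b) (lunitor (M b) x)"
      "runitor (M b) x \<in> Hom (fibre X B P b) (tensor (M b) x (unit_obj (M b))) x"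
      "is_iso (fibre X B P b) (runitor (M b) x)"
      if "x \<in> Obj (fibre X B P b)" for x
      using that b by (simp_all add: Hom_iff fibre_iso)
    show "lunitor (M b) x' \<cdot>\<^bsub>fibre X B P b\<^esub> tensor_arr (M b) (Ide (fibre X B P b) (unit_obj (M b))) f = f \<cdot>\<^bsub>fibre X B P b\<^esub> lunitor (M b) x"
      "runitor (M b) x' \<cdot>\<^bsub>fibre X B P b\<^esub> tensor_arr (M b) f (Ide (fibre X B P b) (unit_obj (M b))) = f \<cdot>\<^bsub>fibre X B P b\<^esub> runitor (M b) x"
      if f: "f \<in> Hom (fibre X B P b) x x'" for f x x'
    proof -
      note [simp] = fibre_HomD[OF f b] b
      show "lunitor (M b) x' \<cdot>\<^bsub>fibre X B P b\<^esub> tensor_arr (M b) (Ide (fibre X B P b) (unit_obj (M b))) f = f \<cdot>\<^bsub>fibre X B P b\<^esub> lunitor (M b) x"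
        by (rule P.arrow_ext[of "tens b (unit_elt b x) (Ide X x)"]) (simp_all add: P.A.assoc)
      show "runitor (M b) x' \<cdot>\<^bsub>fibre X B P b\<^esub> tensor_arr (M b) f (Ide (fibre X B P b) (unit_obj (M b))) = f \<cdot>\<^bsub>fibre X B P b\<^esub> runitor (M b) x"
        by (rule P.arrow_ext[of "tens b (Ide X x) (unit_elt b x)"]) (simp_all add: P.A.assoc)
    qed
    show "associator (M b) w x (tensor (M b) y z) \<cdot>\<^bsub>fibre X B P b\<^esub> associator (M b) (tensor (M b) w x) y z =
       tensor_arr (M b) (Ide (fibre X B P b) w) (associator (M b) x y z) \<cdot>\<^bsub>fibre X B P b\<^esub>
       associator (M b) w (tensor (M b) x y) z \<cdot>\<^bsub>fibre X B P b\<^esub> tensor_arr (M b) (associator (M b) w x y) (Ide (fibre X B P b) z)"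
      if ob: "w \<in> Obj (fibre X B P b)" "x \<in> Obj (fibre X B P b)" "y \<in> Obj (fibre X B P b)" "z \<in> Obj (fibre X B P b)" for w x y z
    proof -
      have o: "w \<in> Obj X" "x \<in> Obj X" "y \<in> Obj X" "z \<in> Obj X" using ob by simp_all
      obtain c p q r s where el: "c \<in> Obj X" "p \<in> Arr X" "Dom X p = c" "Cod X p = w" "q \<in> Arr X" "Dom X q = c" "Cod X q = x"
        "r \<in> Arr X" "Dom X r = c" "Cod X r = y" "s \<in> Arr X" "Dom X s = c" "Cod X s = z"
        by (rule elements[OF o])
      show ?thesis
        by (rule P.arrow_ext[of "tens b (tens b (tens b p q) r) s"]) (use el ob b in \<open>simp_all add: P.A.assoc\<close>)
    qed
    show "tensor_arr (M b) (Ide (fibre X B P b) x) (lunitor (M b) y) \<cdot>\<^bsub>fibre X B P b\<^esub> associator (M b) x (unit_obj (M b)) y =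
       tensor_arr (M b) (runitor (M b) x) (Ide (fibre X B P b) y)"
      if ob: "x \<in> Obj (fibre X B P b)" "y \<in> Obj (fibre X B P b)" for x y
    proof -
      have o: "x \<in> Obj X" "y \<in> Obj X" using ob by simp_all
      obtain c p q where el: "c \<in> Obj X" "p \<in> Arr X" "Dom X p = c" "Cod X p = x" "q \<in> Arr X" "Dom X q = c" "Cod X q = y"
        by (rule elements_2[OF o])
      show ?thesis
        by (rule P.arrow_ext[of "tens b (tens b p (unit_elt b c)) q"]) (use el ob b in \<open>simp_all add: P.A.assoc\<close>)
    qed
  qed
qed

lemma fibre_symmetric_monoidal_category:
  assumes b: "b \<in> Obj B"
  shows "symmetric_monoidal_category (fibre X B P b) (M b)"
proof -
  interpret monoidal_category "fibre X B P b" "M b" using b by (rule fibre_monoidal_category)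
  show ?thesis
  proof
    show "braiding (M b) x y \<in> Hom (fibre X B P b) (tensor (M b) x y) (tensor (M b) y x)"
      if "x \<in> Obj (fibre X B P b)" "y \<in> Obj (fibre X B P b)" for x y
      using that by (simp add: Hom_iff)
    show "braiding (M b) x' y' \<cdot>\<^bsub>fibre X B P b\<^esub> tensor_arr (M b) f g = tensor_arr (M b) g f \<cdot>\<^bsub>fibre X B P b\<^esub> braiding (M b) x y"
      if f: "f \<in> Hom (fibre X B P b) x x'" and g: "g \<in> Hom (fibre X B P b) y y'" for f g x x' y y'
    proof -
      note [simp] = fibre_HomD[OF f b] fibre_HomD[OF g b] b
      have o: "x \<in> Obj X" "y \<in> Obj X" by simp_all
      obtain c p q where el: "c \<in> Obj X" "p \<in> Arr X" "Dom X p = c" "Cod X p = x" "q \<in> Arr X" "Dom X q = c" "Cod X q = y"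
        by (rule elements_2[OF o])
      show ?thesis
        by (rule P.arrow_ext[of "tens b p q"]) (use el in \<open>simp_all add: P.A.assoc\<close>)
    qed
    show "braiding (M b) y x \<cdot>\<^bsub>fibre X B P b\<^esub> braiding (M b) x y = Ide (fibre X B P b) (tensor (M b) x y)"
      if ob: "x \<in> Obj (fibre X B P b)" "y \<in> Obj (fibre X B P b)" for x y
    proof -
      have o: "x \<in> Obj X" "y \<in> Obj X" using ob by simp_all
      obtain c p q where el: "c \<in> Obj X" "p \<in> Arr X" "Dom X p = c" "Cod X p = x" "q \<in> Arr X" "Dom X q = c" "Cod X q = y"
        by (rule elements_2[OF o])
      show ?thesis
        by (rule P.arrow_ext[of "tens b p q"]) (use el ob b in \<open>simp_all add: P.A.assoc\<close>)
    qed
    show "associator (M b) y z x \<cdot>\<^bsub>fibre X B P b\<^esub> braiding (M b) x (tensor (M b) y z) \<cdot>\<^bsub>fibre X B P b\<^esub> associator (M b) x y z =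
       tensor_arr (M b) (Ide (fibre X B P b) y) (braiding (M b) x z) \<cdot>\<^bsub>fibre X B P b\<^esub> associator (M b) y x z
         \<cdot>\<^bsub>fibre X B P b\<^esub> tensor_arr (M b) (braiding (M b) x y) (Ide (fibre X B P b) z)"
      if ob: "x \<in> Obj (fibre X B P b)" "y \<in> Obj (fibre X B P b)" "z \<in> Obj (fibre X B P b)" for x y z
    proof -
      have o: "x \<in> Obj X" "y \<in> Obj X" "z \<in> Obj X" using ob by simp_all
      obtain c p q r where el: "c \<in> Obj X" "p \<in> Arr X" "Dom X p = c" "Cod X p = x" "q \<in> Arr X" "Dom X q = c" "Cod X q = y"
        "r \<in> Arr X" "Dom X r = c" "Cod X r = z"
        by (rule elements_3[OF o])
      show ?thesis
        by (rule P.arrow_ext[of "tens b (tens b p q) r"]) (use el ob b in \<open>simp_all add: P.A.assoc\<close>)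
    qed
  qed
qed

text \<open>Two arrows with the same domain and the same image in the base are both cocartesian liftings
  of this image.\<close>

lemma fibre_isomorphic:
  assumes "c \<in> Arr X" "d \<in> Arr X" "Dom X d = Dom X c" "far P d = far P c" "fob P (Cod X c) = b" "b \<in> Obj B"
  shows "isomorphic (fibre X B P b) (Cod X c) (Cod X d)"
  unfolding isomorphic_def
proof
  show "induced X B P c d \<in> Hom (fibre X B P b) (Cod X c) (Cod X d)"
    using assms by (simp add: Hom_iff)
  show "is_iso (fibre X B P b) (induced X B P c d)"
    using assms by (intro fibre_iso) simp_all
qed

text \<open>With \<open>n\<close> the negative of the identity of \<open>b\<close>, the object \<open>n\<^sub>* x\<close> is inverse to \<open>x\<close>: the arrow
  \<open>x \<rightarrow> x \<otimes> n\<^sub>* x\<close> with components the identity and the lifting of \<open>n\<close> lies over \<open>1 + n = 0\<close>, just as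
  \<open>x \<rightarrow> 1 \<rightarrow> I\<close>. As both are cocartesian, their codomains are isomorphic in the fibre.\<close>

lemma fibre_symmetric_two_group:
  assumes b: "b \<in> Obj B"
  shows "symmetric_two_group (fibre X B P b) (M b)"
proof -
  interpret symmetric_monoidal_category "fibre X B P b" "M b" using b by (rule fibre_symmetric_monoidal_category)
  interpret groupoid "fibre X B P b" using b by (rule fibre_groupoid)
  show ?thesis
  proof
    fix x assume "x \<in> Obj (fibre X B P b)"
    then have x: "x \<in> Obj X" "fob P x = b" by simp_all
    obtain n where n: "n \<in> Arr B" "Dom B n = b" "Cod B n = b"
      "sum_arr B SB (Ide B b) n = zero_arr B SB b b" "sum_arr B SB n (Ide B b) = zero_arr B SB b b"
      using b by (rule B.negative)
    let ?y = "Cod X (k n x)"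
    have "isomorphic (fibre X B P b) (tensor (M b) x ?y) (unit_obj (M b))"
      using fibre_isomorphic[of "tens b (Ide X x) (k n x)" "unit_elt b x" b] x n b by simp
    moreover have "isomorphic (fibre X B P b) (tensor (M b) ?y x) (unit_obj (M b))"
      using fibre_isomorphic[of "tens b (k n x) (Ide X x)" "unit_elt b x" b] x n b by simp
    moreover have "?y \<in> Obj (fibre X B P b)" using x n by simp
    ultimately show "\<exists>y \<in> Obj (fibre X B P b). isomorphic (fibre X B P b) (tensor (M b) x y) (unit_obj (M b)) \<and>
        isomorphic (fibre X B P b) (tensor (M b) y x) (unit_obj (M b))"
      by blast
  qed
qed

text \<open>The image of an element under change of base along \<open>f\<close>; it stays at the same stage.\<close>

definition along :: "'n \<Rightarrow> 'm \<Rightarrow> 'm" where "along f p = k f (Cod X p) \<cdot>\<^bsub>X\<^esub> p"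

lemma along_simps [simp]:
  assumes "f \<in> Arr B" "p \<in> Arr X" "fob P (Cod X p) = Dom B f"
  shows "along f p \<in> Arr X" "Dom X (along f p) = Dom X p" "Cod X (along f p) = Cod X (k f (Cod X p))"
    "far P (along f p) = f \<cdot>\<^bsub>B\<^esub> far P p"
  using assms by (simp_all add: along_def)

lemma along_Comp [simp]:
  assumes "f \<in> Arr B" "p \<in> Arr X" "fob P (Cod X p) = Dom B f" "h \<in> Arr X" "Cod X h = Dom X p"
  shows "along f p \<cdot>\<^bsub>X\<^esub> h = along f (p \<cdot>\<^bsub>X\<^esub> h)"
  using assms by (simp add: along_def P.A.assoc)

lemma k_Comp [simp]: "x = Cod X p \<Longrightarrow> k f x \<cdot>\<^bsub>X\<^esub> p = along f p"
  by (simp add: along_def)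

abbreviation base where "base f \<equiv> change_of_base X B P k f"

lemma fob_base: "fob (base f) x = Cod X (k f x)"
  by (simp add: change_of_base_def)

lemma far_base_simps [simp]:
  assumes f: "f \<in> Arr B" and h: "h \<in> Arr X" "far P h = Ide B (Dom B f)"
  shows "far (base f) h \<in> Arr X" "Dom X (far (base f) h) = Cod X (k f (Dom X h))"
    "Cod X (far (base f) h) = Cod X (k f (Cod X h))" "far P (far (base f) h) = Ide B (Cod B f)"
    and far_base_along [simp]: "\<lbrakk>p \<in> Arr X; Cod X p = Dom X h\<rbrakk>
      \<Longrightarrow> far (base f) h \<cdot>\<^bsub>X\<^esub> along f p = along f (h \<cdot>\<^bsub>X\<^esub> p)"
proof -
  note ob [simp] = P.vertical_objects[OF h P.B.Dom_Obj[OF f]]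
  have eq: "far (base f) h = induced X B P (k f (Dom X h)) (along f h)"
    by (simp add: change_of_base_def)
  have cd: "k f (Dom X h) \<in> Arr X" "along f h \<in> Arr X" "Dom X (along f h) = Dom X (k f (Dom X h))"
    "far P (along f h) = far P (k f (Dom X h))"
    using f h by simp_all
  note i = induced[OF cd, folded eq]
  show "far (base f) h \<in> Arr X" "Dom X (far (base f) h) = Cod X (k f (Dom X h))"
    "Cod X (far (base f) h) = Cod X (k f (Cod X h))" "far P (far (base f) h) = Ide B (Cod B f)"
    using i(1-4) f h by simp_all
  assume p: "p \<in> Arr X" "Cod X p = Dom X h"
  show "far (base f) h \<cdot>\<^bsub>X\<^esub> along f p = along f (h \<cdot>\<^bsub>X\<^esub> p)"
    unfolding eq by (rule induced_at[OF cd, of p]) (use p f h in simp_all)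
qed

abbreviation m where "m f \<equiv> change_tensor X SX B SB P k f"
abbreviation e where "e f \<equiv> change_unit X SX B SB P k f"

lemma m_simps [simp]:
  assumes f: "f \<in> Arr B" and xy: "x \<in> Obj X" "y \<in> Obj X" "fob P x = Dom B f" "fob P y = Dom B f"
  shows "m f x y \<in> Arr X" "Dom X (m f x y) = tensor (M (Cod B f)) (Cod X (k f x)) (Cod X (k f y))"
    "Cod X (m f x y) = Cod X (k f (tensor (M (Dom B f)) x y))" "far P (m f x y) = Ide B (Cod B f)"
    and m_tens [simp]: "\<lbrakk>p \<in> Arr X; q \<in> Arr X; Dom X p = Dom X q; Cod X p = x; Cod X q = y; b = Cod B f\<rbrakk>
      \<Longrightarrow> m f x y \<cdot>\<^bsub>X\<^esub> tens b (along f p) (along f q) = along f (tens (Dom B f) p q)"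
proof -
  define c where "c = t (Cod B f) (Cod X (k f x)) (Cod X (k f y)) \<cdot>\<^bsub>X\<^esub> prod_arr X SX (k f x) (k f y)"
  define d where "d = k f (Cod X (t (Dom B f) x y)) \<cdot>\<^bsub>X\<^esub> t (Dom B f) x y"
  have eq: "m f x y = induced X B P c d" by (simp add: change_tensor_def Let_def c_def d_def del: k_Comp)
  let ?p = "Fst SX x y" and ?q = "Snd SX x y"
  have c: "c = tens (Cod B f) (along f ?p) (along f ?q)" using f xy by (simp add: c_def)
  have d: "d = along f (tens (Dom B f) ?p ?q)" using f xy by (simp add: d_def t_eq_tens)
  have cd: "c \<in> Arr X" "d \<in> Arr X" "Dom X d = Dom X c" "far P d = far P c"
    unfolding c d using f xy by (simp_all add: B.Comp_sum)
  note i = induced[OF cd, folded eq]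
  show "m f x y \<in> Arr X" "Dom X (m f x y) = tensor (M (Cod B f)) (Cod X (k f x)) (Cod X (k f y))"
    "Cod X (m f x y) = Cod X (k f (tensor (M (Dom B f)) x y))" "far P (m f x y) = Ide B (Cod B f)"
    using i(1-4) f xy by (simp_all add: c d)
  assume e: "p \<in> Arr X" "q \<in> Arr X" "Dom X p = Dom X q" "Cod X p = x" "Cod X q = y" "b = Cod B f"
  show "m f x y \<cdot>\<^bsub>X\<^esub> tens b (along f p) (along f q) = along f (tens (Dom B f) p q)"
    unfolding eq by (rule induced_at[OF cd, of "pairing X SX p q"]) (use e f xy in \<open>simp_all add: c d\<close>)
qed

lemma e_simps [simp]:
  assumes f: "f \<in> Arr B"
  shows "e f \<in> Arr X" "Dom X (e f) = unit_obj (M (Cod B f))"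
    "Cod X (e f) = Cod X (k f (unit_obj (M (Dom B f))))" "far P (e f) = Ide B (Cod B f)"
    and e_unit [simp]: "\<lbrakk>c \<in> Obj X; b = Cod B f\<rbrakk> \<Longrightarrow> e f \<cdot>\<^bsub>X\<^esub> unit_elt b c = along f (unit_elt (Dom B f) c)"
proof -
  let ?c = "to_unit SX B SB k (Cod B f)"
  define d where "d = k f (Cod X (to_unit SX B SB k (Dom B f))) \<cdot>\<^bsub>X\<^esub> to_unit SX B SB k (Dom B f)"
  have eq: "e f = induced X B P ?c d" by (simp add: change_unit_def Let_def d_def del: k_Comp)
  have d: "d = along f (unit_elt (Dom B f) (One SX))" using f by (simp add: d_def to_unit_eq)
  have cd: "?c \<in> Arr X" "d \<in> Arr X" "Dom X d = Dom X ?c" "far P d = far P ?c"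
    unfolding d using f by (simp_all add: B.Comp_zero_arr to_unit_eq)
  note i = induced[OF cd, folded eq]
  show "e f \<in> Arr X" "Dom X (e f) = unit_obj (M (Cod B f))"
    "Cod X (e f) = Cod X (k f (unit_obj (M (Dom B f))))" "far P (e f) = Ide B (Cod B f)"
    using i(1-4) f by (simp_all add: d)
  assume c: "c \<in> Obj X" "b = Cod B f"
  show "e f \<cdot>\<^bsub>X\<^esub> unit_elt b c = along f (unit_elt (Dom B f) c)"
    unfolding eq by (rule induced_at[OF cd, of "to_one X SX c"]) (use c f in \<open>simp_all add: d to_unit_eq\<close>)
qed

text \<open>On elements the comparison arrows act by \<open>along f p \<otimes> along f q \<mapsto> along f (p \<otimes> q)\<close>, and the image of
  \<open>h\<close> acts by \<open>along f p \<mapsto> along f (h \<cdot> p)\<close>; the conditions are evaluated as for the monoidal structure.\<close>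

lemma change_of_base_symmetric_monoidal:
  assumes f: "f \<in> Arr B"
  shows "symmetric_monoidal_functor (fibre X B P (Dom B f)) (M (Dom B f)) (fibre X B P (Cod B f)) (M (Cod B f))
    (base f) (m f) (e f)"
proof -
  let ?a = "Dom B f" and ?b = "Cod B f"
  have ab: "?a \<in> Obj B" "?b \<in> Obj B" using f by simp_all
  interpret C: symmetric_monoidal_category "fibre X B P ?a" "M ?a"
    using ab(1) by (rule fibre_symmetric_monoidal_category)
  interpret D: symmetric_monoidal_category "fibre X B P ?b" "M ?b"
    using ab(2) by (rule fibre_symmetric_monoidal_category)
  have base_functor: "cat_functor (fibre X B P ?a) (fibre X B P ?b) (base f)"
  proof (rule cat_functorI[OF C.category_axioms D.category_axioms])
    show "x \<in> Obj (fibre X B P ?a) \<Longrightarrow> fob (base f) x \<in> Obj (fibre X B P ?b)" for x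
      using f by (simp add: fob_base)
    show "h \<in> Arr (fibre X B P ?a) \<Longrightarrow> far (base f) h \<in> Arr (fibre X B P ?b) \<and>
       Dom (fibre X B P ?b) (far (base f) h) = fob (base f) (Dom (fibre X B P ?a) h) \<and>
       Cod (fibre X B P ?b) (far (base f) h) = fob (base f) (Cod (fibre X B P ?a) h)" for h
      using f by (simp add: fob_base)
    show "far (base f) (Ide (fibre X B P ?a) x) = Ide (fibre X B P ?b) (fob (base f) x)"
      if "x \<in> Obj (fibre X B P ?a)" for x
      by (rule P.arrow_ext[of "along f (Ide X x)"]) (use that f in \<open>simp_all add: fob_base\<close>)
    show "far (base f) (g \<cdot>\<^bsub>fibre X B P ?a\<^esub> h) = far (base f) g \<cdot>\<^bsub>fibre X B P ?b\<^esub> far (base f) h"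
      if gh: "h \<in> Arr (fibre X B P ?a)" "g \<in> Arr (fibre X B P ?a)" "Dom (fibre X B P ?a) g = Cod (fibre X B P ?a) h" for h g
    proof -
      have ob: "fob P (Dom X h) = ?a" "fob P (Cod X h) = ?a" "fob P (Cod X g) = ?a"
        using gh P.vertical_objects[OF _ _ ab(1)] by simp_all
      show ?thesis
        by (rule P.arrow_ext[of "along f (Ide X (Dom X h))"]) (use ob gh f in \<open>simp_all add: P.A.assoc\<close>)
    qed
  qed
  show ?thesis
  proof (intro symmetric_monoidal_functor.intro base_functor C.symmetric_monoidal_category_axioms
      D.symmetric_monoidal_category_axioms symmetric_monoidal_functor_axioms.intro)
    show "m f x y \<in> Hom (fibre X B P ?b) (tensor (M ?b) (fob (base f) x) (fob (base f) y)) (fob (base f) (tensor (M ?a) x y))"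
      "is_iso (fibre X B P ?b) (m f x y)"
      if "x \<in> Obj (fibre X B P ?a)" "y \<in> Obj (fibre X B P ?a)" for x y
      using that f by (simp_all add: Hom_iff fob_base fibre_iso)
    show "m f x' y' \<cdot>\<^bsub>fibre X B P ?b\<^esub> tensor_arr (M ?b) (far (base f) h) (far (base f) g) =
       far (base f) (tensor_arr (M ?a) h g) \<cdot>\<^bsub>fibre X B P ?b\<^esub> m f x y"
      if h: "h \<in> Hom (fibre X B P ?a) x x'" and g: "g \<in> Hom (fibre X B P ?a) y y'" for h g x x' y y'
    proof -
      note [simp] = fibre_HomD[OF h ab(1)] fibre_HomD[OF g ab(1)] f
      have o: "x \<in> Obj X" "y \<in> Obj X" by simp_all
      obtain c p q where el: "c \<in> Obj X" "p \<in> Arr X" "Dom X p = c" "Cod X p = x" "q \<in> Arr X" "Dom X q = c" "Cod X q = y"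
        by (rule elements_2[OF o])
      show ?thesis
        by (rule P.arrow_ext[of "tens ?b (along f p) (along f q)"]) (use el in \<open>simp_all add: P.A.assoc\<close>)
    qed
    show "e f \<in> Hom (fibre X B P ?b) (unit_obj (M ?b)) (fob (base f) (unit_obj (M ?a)))" "is_iso (fibre X B P ?b) (e f)"
      using f by (simp_all add: Hom_iff fob_base fibre_iso)
    show "far (base f) (associator (M ?a) x y z) \<cdot>\<^bsub>fibre X B P ?b\<^esub> m f (tensor (M ?a) x y) z
         \<cdot>\<^bsub>fibre X B P ?b\<^esub> tensor_arr (M ?b) (m f x y) (Ide (fibre X B P ?b) (fob (base f) z)) =
       m f x (tensor (M ?a) y z) \<cdot>\<^bsub>fibre X B P ?b\<^esub> tensor_arr (M ?b) (Ide (fibre X B P ?b) (fob (base f) x)) (m f y z)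
         \<cdot>\<^bsub>fibre X B P ?b\<^esub> associator (M ?b) (fob (base f) x) (fob (base f) y) (fob (base f) z)"
      if ob: "x \<in> Obj (fibre X B P ?a)" "y \<in> Obj (fibre X B P ?a)" "z \<in> Obj (fibre X B P ?a)" for x y z
    proof -
      have o: "x \<in> Obj X" "y \<in> Obj X" "z \<in> Obj X" using ob by simp_all
      obtain c p q r where el: "c \<in> Obj X" "p \<in> Arr X" "Dom X p = c" "Cod X p = x" "q \<in> Arr X" "Dom X q = c" "Cod X q = y"
        "r \<in> Arr X" "Dom X r = c" "Cod X r = z"
        by (rule elements_3[OF o])
      show ?thesis
        by (rule P.arrow_ext[of "tens ?b (tens ?b (along f p) (along f q)) (along f r)"]) (use el ob f in \<open>simp_all add: P.A.assoc fob_base\<close>)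
    qed
    show "far (base f) (lunitor (M ?a) x) \<cdot>\<^bsub>fibre X B P ?b\<^esub> m f (unit_obj (M ?a)) x
         \<cdot>\<^bsub>fibre X B P ?b\<^esub> tensor_arr (M ?b) (e f) (Ide (fibre X B P ?b) (fob (base f) x)) = lunitor (M ?b) (fob (base f) x)"
      if ob: "x \<in> Obj (fibre X B P ?a)" for x
      by (rule P.arrow_ext[of "tens ?b (unit_elt ?b x) (along f (Ide X x))"]) (use ob f in \<open>simp_all add: P.A.assoc fob_base\<close>)
    show "far (base f) (runitor (M ?a) x) \<cdot>\<^bsub>fibre X B P ?b\<^esub> m f x (unit_obj (M ?a))
         \<cdot>\<^bsub>fibre X B P ?b\<^esub> tensor_arr (M ?b) (Ide (fibre X B P ?b) (fob (base f) x)) (e f) = runitor (M ?b) (fob (base f) x)"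
      if ob: "x \<in> Obj (fibre X B P ?a)" for x
      by (rule P.arrow_ext[of "tens ?b (along f (Ide X x)) (unit_elt ?b x)"]) (use ob f in \<open>simp_all add: P.A.assoc fob_base\<close>)
    show "far (base f) (braiding (M ?a) x y) \<cdot>\<^bsub>fibre X B P ?b\<^esub> m f x y =
       m f y x \<cdot>\<^bsub>fibre X B P ?b\<^esub> braiding (M ?b) (fob (base f) x) (fob (base f) y)"
      if ob: "x \<in> Obj (fibre X B P ?a)" "y \<in> Obj (fibre X B P ?a)" for x y
    proof -
      have o: "x \<in> Obj X" "y \<in> Obj X" using ob by simp_all
      obtain c p q where el: "c \<in> Obj X" "p \<in> Arr X" "Dom X p = c" "Cod X p = x" "q \<in> Arr X" "Dom X q = c" "Cod X q = y"
        by (rule elements_2[OF o])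
      show ?thesis
        by (rule P.arrow_ext[of "tens ?b (along f p) (along f q)"]) (use el ob f in \<open>simp_all add: P.A.assoc fob_base\<close>)
    qed
  qed
qed

end

section \<open>The fractions of a product-preserving opfibration\<close>

theorem proposition4p6:
  fixes X Q :: "('o, 'm::infinite) cat" and SX :: "('o, 'm) products"
    and B :: "('p, 'n) cat" and SB :: "('p, 'n) products"
    and P :: "('o, 'm, 'p, 'n) func"
    and L :: "('o, 'm, 'o, 'm) func"
    and P' :: "('o, 'm, 'p, 'n) func"
  assumes "finite_products X SX"
    and "finite_products B SB"
    and "opfibration X B P"
    and "strictly_preserves_products X SX SB P"
    and "category_of_fractions X (vertical X B P) Q L"
    and "cat_functor Q B P'"
    and "func_eq X (func_comp P' L) P"
  shows "\<exists>SQ :: ('o, 'm) products.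
    strictly_preserves_products X SX SQ L \<and>
    cartesian_monoidal_opfibration Q SQ B SB P' \<and>
    groupoidal_fibres Q B P' \<and>
    (additive_category B SB \<longrightarrow>
      (\<forall>k. cleavage Q B P' k \<longrightarrow>
        (\<forall>b \<in> Obj B.
          symmetric_two_group (fibre Q B P' b) (fibre_monoidal Q SQ B SB P' k b)) \<and>
        (\<forall>f \<in> Arr B.
          symmetric_monoidal_functor
            (fibre Q B P' (Dom B f)) (fibre_monoidal Q SQ B SB P' k (Dom B f))
            (fibre Q B P' (Cod B f)) (fibre_monoidal Q SQ B SB P' k (Cod B f))
            (change_of_base Q B P' k f)
            (change_tensor Q SQ B SB P' k f) (change_unit Q SQ B SB P' k f))))"
proof -
  interpret P: opfibration X B P by fact
  interpret X: finite_products X SX by fact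
  interpret B: finite_products B SB by fact
  interpret P': cat_functor Q B P' by fact
  interpret PP: product_functor X SX B SB P by unfold_locales fact
  interpret V: vertical_fractions X Q B P L P'
    by unfold_locales (use assms in \<open>auto simp: vertical_def\<close>)
  \<comment> \<open>By strict preservation, the product of a vertical arrow with an identity lies over an identity.\<close>
  have times_vertical: "prod_arr X SX s (Ide X a) \<in> vertical X B P" "prod_arr X SX (Ide X a) s \<in> vertical X B P"
    if s: "s \<in> vertical X B P" and a: "a \<in> Obj X" for s a
  proof -
    obtain b where b: "s \<in> Arr X" "far P s = Ide B b" "b \<in> Obj B" using s by (auto simp: vertical_def)
    have "far P (prod_arr X SX s (Ide X a)) = Ide B (Prod SB b (fob P a))"
      "far P (prod_arr X SX (Ide X a) s) = Ide B (Prod SB (fob P a) b)"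
      using a b by simp_all
    then show "prod_arr X SX s (Ide X a) \<in> vertical X B P" "prod_arr X SX (Ide X a) s \<in> vertical X B P"
      using a b by (auto simp: vertical_def)
  qed
  interpret V: product_fractions X "vertical X B P" Q L SX
    by unfold_locales (fact times_vertical)+
  interpret SQ: finite_products Q V.SQ by (rule V.finite_products_fractions)
  interpret O: groupoidal_opfibration Q B P'
    using V.opfibration_fractions V.groupoidal_fractions
    by (simp add: groupoidal_opfibration_def groupoidal_opfibration_axioms_def)
  have strict: "strictly_preserves_products Q V.SQ SB P'"
    by (simp add: strictly_preserves_products_def V.SQ_def)
  have "cartesian_monoidal_opfibration Q V.SQ B SB P'"
    by unfold_locales (auto simp: strict dest!: cocartesian_Arr intro!: O.all_cocartesian)
  moreover have "symmetric_two_group (fibre Q B P' b) (fibre_monoidal Q V.SQ B SB P' k b)"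
    if "additive_category B SB" "cleavage Q B P' k" "b \<in> Obj B" for k b
  proof -
    interpret additive_category B SB by fact
    interpret additive_groupoidal_opfibration Q V.SQ B SB P' k
      by unfold_locales (fact strict that)+
    show ?thesis using fibre_symmetric_two_group[OF that(3)] by (simp add: M_def)
  qed
  moreover have "symmetric_monoidal_functor
      (fibre Q B P' (Dom B f)) (fibre_monoidal Q V.SQ B SB P' k (Dom B f))
      (fibre Q B P' (Cod B f)) (fibre_monoidal Q V.SQ B SB P' k (Cod B f))
      (change_of_base Q B P' k f)
      (change_tensor Q V.SQ B SB P' k f) (change_unit Q V.SQ B SB P' k f)"
    if "additive_category B SB" "cleavage Q B P' k" "f \<in> Arr B" for k f
  proof -
    interpret additive_category B SB by fact
    interpret additive_groupoidal_opfibration Q V.SQ B SB P' k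
      by unfold_locales (fact strict that)+
    show ?thesis using change_of_base_symmetric_monoidal[OF that(3)] by (simp add: M_def)
  qed
  ultimately show ?thesis using V.strict_L V.groupoidal_fractions by blast
qed

end
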